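(* Assume the standing assumptions in the context with case (CI), where $w_n=n^p$ for some $p>1$, and assume $\sum_{n=1}^{j-1}nb_{n,j}\le j$ for all $j\ge2$. Let $\mu:(0,T)\to(0,\infty)$ be a monotone increasing function such that for each $t'\in(0,T)$, $k_{n,j}(t)\le\mu(t')(n+j)$ for all $n,j\in\mathbb N$ and $t\in[0,t']$. Let $\mathring u\in(\ell^1_w)_+$ and let $u$ be the unique mild solution of $u'=G^{(w)}u+K(t,u)$, $u(0)=\mathring u$, on its maximal interval $[0,t_{\max})$. Then $t_{\max}=T$, and $\|u(t)\|_w\le\|\mathring u\|_we^{c_p\mu(t)\phi_{[1]}(\mathring u)t}$ for $t\in[0,T)$, where $\phi_{[1]}(f)=\sum_{n}nf_n$ and $c_p=p$ if $p\in(1,2]$, $c_p=2^p-2$ if $p\in(2,\infty)$.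
   Context: Let $0<T\le\infty$, $a_n\ge0$, $b_{n,j}\ge0$ with $b_{n,j}=0$ for $j\le n$, $k_{n,j}:[0,T)\to[0,\infty)$ continuous with $k_{n,j}=k_{j,n}$. $\ell^1_w=\{f:\|f\|_w=\sum w_n|f_n|<\infty\}$ with componentwise order, $w_n=n^p$. Standing assumptions: there is $\kappa\in(0,1]$ with $\sum_{n=1}^{j-1}w_nb_{n,j}\le\kappa w_j$ for all $j\ge2$; case (CI): for every $t'\in(0,T)$ there is $c(t')>0$ with $k_{n,j}(t)\le c(t')w_nw_j/w_{n+j}$ for all $n,j$ and $t\in[0,t']$. $G^{(w)}$ is the closure in $\ell^1_w$ of $A^{(w)}+B^{(w)}$, $A^{(w)}f=(-a_nf_n)_n$, $B^{(w)}f=(\sum_{j>n}a_jb_{n,j}f_j)_n$ on maximal domains; it generates a substochastic $C_0$-semigroup $(S^{(w)}(t))_{t\ge 0}$. $K(t,f)=(\tfrac12\sum_{j=1}^{n-1}k_{n-j,j}(t)f_{n-j}f_j-\sum_{j\ge1}k_{n,j}(t)f_nf_j)_n$. A mild solution on $[0,t_1)$ is $u\in C([0,t_1),\ell^1_w)$ with $u(t)=S^{(w)}(t)\mathring u+\int_0^tS^{(w)}(t-s)K(s,u(s))\,ds$; a unique maximal one exists on some $[0,t_{\max})$, $t_{\max}\in(0,T]$. *)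

theory Defs
  imports "HOL-Analysis.Analysis" "HOL-Library.Extended_Real"
begin

(* Sequences f = (f_n)_{n>=1} are modelled as nat => real with f 0 = 0.
   Weight w_n = n^p (note w_0 = 0). *)

definition wgt :: "real \<Rightarrow> nat \<Rightarrow> real" where
  "wgt p n = real n powr p"

definition wnorm :: "real \<Rightarrow> (nat \<Rightarrow> real) \<Rightarrow> real" where
  "wnorm p f = (\<Sum>n. wgt p n * \<bar>f n\<bar>)"

definition l1w :: "real \<Rightarrow> (nat \<Rightarrow> real) set" where
  "l1w p = {f. f 0 = 0 \<and> summable (\<lambda>n. wgt p n * \<bar>f n\<bar>)}"

definition tset :: "ereal \<Rightarrow> real set" where
  "tset t1 = {t. 0 \<le> t \<and> ereal t < t1}"

definition Aop :: "(nat \<Rightarrow> real) \<Rightarrow> (nat \<Rightarrow> real) \<Rightarrow> nat \<Rightarrow> real" where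
  "Aop a f n = (if n = 0 then 0 else - a n * f n)"

definition Bop :: "(nat \<Rightarrow> real) \<Rightarrow> (nat \<Rightarrow> nat \<Rightarrow> real) \<Rightarrow> (nat \<Rightarrow> real) \<Rightarrow> nat \<Rightarrow> real" where
  "Bop a b f n = (if n = 0 then 0 else (\<Sum>i. a (n + 1 + i) * b n (n + 1 + i) * f (n + 1 + i)))"

definition domAB :: "real \<Rightarrow> (nat \<Rightarrow> real) \<Rightarrow> (nat \<Rightarrow> nat \<Rightarrow> real) \<Rightarrow> (nat \<Rightarrow> real) set" where
  "domAB p a b = {f \<in> l1w p. Aop a f \<in> l1w p
      \<and> (\<forall>n\<ge>1. summable (\<lambda>i. a (n + 1 + i) * b n (n + 1 + i) * f (n + 1 + i)))
      \<and> Bop a b f \<in> l1w p}"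

definition ABop :: "(nat \<Rightarrow> real) \<Rightarrow> (nat \<Rightarrow> nat \<Rightarrow> real) \<Rightarrow> (nat \<Rightarrow> real) \<Rightarrow> nat \<Rightarrow> real" where
  "ABop a b f n = Aop a f n + Bop a b f n"

(* graph of G^(w) = closure in l^1_w x l^1_w of the graph of A + B *)
definition Gw_rel :: "real \<Rightarrow> (nat \<Rightarrow> real) \<Rightarrow> (nat \<Rightarrow> nat \<Rightarrow> real)
    \<Rightarrow> (nat \<Rightarrow> real) \<Rightarrow> (nat \<Rightarrow> real) \<Rightarrow> bool" where
  "Gw_rel p a b f g \<longleftrightarrow> f \<in> l1w p \<and> g \<in> l1w p \<and>
     (\<exists>fs. (\<forall>k. fs k \<in> domAB p a b)
        \<and> (\<lambda>k. wnorm p (\<lambda>n. fs k n - f n)) \<longlonglongrightarrow> 0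
        \<and> (\<lambda>k. wnorm p (\<lambda>n. ABop a b (fs k) n - g n)) \<longlonglongrightarrow> 0)"

definition C0_semigroup :: "real \<Rightarrow> (real \<Rightarrow> (nat \<Rightarrow> real) \<Rightarrow> nat \<Rightarrow> real) \<Rightarrow> bool" where
  "C0_semigroup p S \<longleftrightarrow>
     (\<forall>t\<ge>0. \<forall>f\<in>l1w p. S t f \<in> l1w p) \<and>
     (\<forall>t\<ge>0. \<forall>f\<in>l1w p. \<forall>g\<in>l1w p. \<forall>x y.
         S t (\<lambda>n. x * f n + y * g n) = (\<lambda>n. x * S t f n + y * S t g n)) \<and>
     (\<forall>t\<ge>0. \<exists>M. \<forall>f\<in>l1w p. wnorm p (S t f) \<le> M * wnorm p f) \<and>
     (\<forall>f\<in>l1w p. S 0 f = f) \<and>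
     (\<forall>s\<ge>0. \<forall>t\<ge>0. \<forall>f\<in>l1w p. S (s + t) f = S s (S t f)) \<and>
     (\<forall>f\<in>l1w p. ((\<lambda>t. wnorm p (\<lambda>n. S t f n - f n)) \<longlongrightarrow> 0) (at_right 0))"

definition generator_rel :: "real \<Rightarrow> (real \<Rightarrow> (nat \<Rightarrow> real) \<Rightarrow> nat \<Rightarrow> real)
    \<Rightarrow> (nat \<Rightarrow> real) \<Rightarrow> (nat \<Rightarrow> real) \<Rightarrow> bool" where
  "generator_rel p S f g \<longleftrightarrow> f \<in> l1w p \<and> g \<in> l1w p \<and>
     ((\<lambda>h. wnorm p (\<lambda>n. (S h f n - f n) / h - g n)) \<longlongrightarrow> 0) (at_right 0)"

definition generated_by_Gw :: "real \<Rightarrow> (nat \<Rightarrow> real) \<Rightarrow> (nat \<Rightarrow> nat \<Rightarrow> real)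
    \<Rightarrow> (real \<Rightarrow> (nat \<Rightarrow> real) \<Rightarrow> nat \<Rightarrow> real) \<Rightarrow> bool" where
  "generated_by_Gw p a b S \<longleftrightarrow> C0_semigroup p S \<and>
     (\<forall>f g. generator_rel p S f g \<longleftrightarrow> Gw_rel p a b f g)"

definition Kop :: "(nat \<Rightarrow> nat \<Rightarrow> real \<Rightarrow> real) \<Rightarrow> real \<Rightarrow> (nat \<Rightarrow> real) \<Rightarrow> nat \<Rightarrow> real" where
  "Kop k t f n = (if n = 0 then 0 else
      (1/2) * (\<Sum>j=1..n-1. k (n - j) j t * f (n - j) * f j)
      - (\<Sum>i. k n (i + 1) t * f n * f (i + 1)))"

definition mild_solution :: "real \<Rightarrow> (real \<Rightarrow> (nat \<Rightarrow> real) \<Rightarrow> nat \<Rightarrow> real)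
    \<Rightarrow> (nat \<Rightarrow> nat \<Rightarrow> real \<Rightarrow> real) \<Rightarrow> (nat \<Rightarrow> real) \<Rightarrow> ereal \<Rightarrow> (real \<Rightarrow> nat \<Rightarrow> real) \<Rightarrow> bool" where
  "mild_solution p S k u0 t1 u \<longleftrightarrow>
     (\<forall>t\<in>tset t1. u t \<in> l1w p) \<and>
     (\<forall>t\<in>tset t1. ((\<lambda>s. wnorm p (\<lambda>n. u s n - u t n)) \<longlongrightarrow> 0) (at t within tset t1)) \<and>
     (\<forall>t\<in>tset t1. \<forall>n. ((\<lambda>s. S (t - s) (Kop k s (u s)) n) has_integral (u t n - S t u0 n)) {0..t})"

definition maximal_mild_solution :: "real \<Rightarrow> (real \<Rightarrow> (nat \<Rightarrow> real) \<Rightarrow> nat \<Rightarrow> real)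
    \<Rightarrow> (nat \<Rightarrow> nat \<Rightarrow> real \<Rightarrow> real) \<Rightarrow> (nat \<Rightarrow> real) \<Rightarrow> ereal \<Rightarrow> ereal \<Rightarrow> (real \<Rightarrow> nat \<Rightarrow> real) \<Rightarrow> bool" where
  "maximal_mild_solution p S k u0 T tmax u \<longleftrightarrow>
     0 < tmax \<and> tmax \<le> T \<and> mild_solution p S k u0 tmax u \<and>
     \<not> (\<exists>t2 v. tmax < t2 \<and> t2 \<le> T \<and> mild_solution p S k u0 t2 v \<and> (\<forall>t\<in>tset tmax. v t = u t))"

definition phi1 :: "(nat \<Rightarrow> real) \<Rightarrow> real" where
  "phi1 f = (\<Sum>n. real n * f n)"

definition c_p :: "real \<Rightarrow> real" where
  "c_p p = (if p \<le> 2 then p else 2 powr p - 2)"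

end

theory Submission
  imports Defs
begin

text \<open>
  Weighting the coordinates identifies the state space with $\ell^1$, so that the problem becomes one
  about a semigroup $U$ and a quadratic, locally Lipschitz nonlinearity $K$ on a Banach space.  For the
  weights $v_n = n^p$ and $v_n = n$ the functional $N_v(f) = \sum v_n f_n^+$ satisfies
  $N_v(f) \le N_v(f - \lambda G f)$ on the domain of the fragmentation operator, hence on that of its
  closure, and therefore $N_v$ decreases along $U$; in particular $U$ is a positive contraction and
  does not increase mass.  A mild solution satisfies $u(t+h) = U(h)(u(t) + h K(t,u(t))) + o(h)$, so the
  upper right Dini derivative of $N_v(u(t))$ is controlled by $N_v(u + hK(t,u))$ alone.  Applied to the
  negative part this gives positivity, applied to the first moment it gives
  $\phi_{[1]}(u(t)) \le \phi_{[1]}(u_0)$, and applied to the norm, together with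
  $((n+j)^p - n^p - j^p)(n+j) \le c_p (n j^p + j n^p)$, it gives the exponential bound.  The bound rules
  out blow-up, so a solution with $t_{\max} < T$ could be continued by a contraction argument, the
  continuation being unique by the same Dini estimate for the difference.
\<close>

section \<open>Dini derivatives and uniform boundedness\<close>

text \<open>A mild solution need not lie in the domain of the generator, and the domain of the
  closure has no usable description, so the solution is never differentiated. All that is asked of
  the generator is an inequality that is continuous in the pair (f, Gf), and all that is asked of
  the solution is an Euler step up to o(h). Dini derivatives then also admit functionals that are
  not smooth, such as a positive part. \<open>C0_semigroup\<close> bounds each operator separately,
  so a bound near time 0 must be extracted from uniform boundedness before orbits are known to be
  continuous from the left. The constant is c_p = max(p, 2^p - 2): letting j/n tend to 0 in the
  moment inequality forces p, and n = j forces 2^p - 2; the two agree at p = 2. The factor n + j in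
  that inequality is the one of the kernel bound, and each product n j^p on the right splits over
  the double sum into first moment times norm. Since the first moment does not grow, the quadratic
  coagulation term enters the estimate of the norm linearly, hence exponential growth instead of
  blow-up.\<close>

lemma Dini_nonincreasing:
  fixes \<phi> :: "real \<Rightarrow> real"
  assumes cont: "continuous_on {a..b} \<phi>"
    and dini: "\<And>t \<epsilon>. a \<le> t \<Longrightarrow> t < b \<Longrightarrow> 0 < \<epsilon> \<Longrightarrow>
      eventually (\<lambda>h. \<phi> (t + h) \<le> \<phi> t + h * \<epsilon>) (at_right 0)"
    and ab: "a \<le> b"
  shows "\<phi> b \<le> \<phi> a"
proof (rule field_le_epsilon)
  fix e :: real assume "0 < e"
  \<comment> \<open>The tilt \<open>\<epsilon> * (t - a)\<close> costs at most e over the whole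
    interval, and the 1 in the denominator covers a = b. It turns the Dini bound into
    \<open>\<psi> (s + h) \<le> \<psi> s\<close> for some h > 0, so the last time at which
    \<open>\<psi>\<close> does not exceed its initial value can only be b.\<close>
  define \<epsilon> where "\<epsilon> = e / (b - a + 1)"
  have \<epsilon>: "\<epsilon> > 0" using \<open>0 < e\<close> ab by (simp add: \<epsilon>_def)
  define \<psi> where "\<psi> t = \<phi> t - \<epsilon> * (t - a)" for t
  define A where "A = {t \<in> {a..b}. \<psi> t \<le> \<psi> a}"
  have cpsi: "continuous_on {a..b} \<psi>"
    unfolding \<psi>_def by (intro continuous_intros cont)
  have A: "closed A" "a \<in> A" "A \<subseteq> {a..b}"
    using ab cpsi unfolding A_def
    by (auto intro: continuous_on_closed_Collect_le[of "{a..b}" \<psi> "\<lambda>_. \<psi> a", simplified])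
  have bdd: "bdd_above A" using A(3) by (meson bdd_above_Icc bdd_above_mono)
  define s where "s = Sup A"
  have sA: "s \<in> A" unfolding s_def using A bdd by (intro closed_contains_Sup) auto
  have "s = b"
  proof (rule ccontr)
    assume "s \<noteq> b"
    then have s: "a \<le> s" "s < b" using sA A(3) by auto
    have "eventually (\<lambda>h. \<phi> (s + h) \<le> \<phi> s + h * \<epsilon> \<and> 0 < h \<and> h < b - s) (at_right 0)"
      using dini[OF s \<epsilon>] s
      by (intro eventually_conj) (auto simp: eventually_at_right_less eventually_at_right_real intro: eventually_at_rightI)
    then obtain h where h: "\<phi> (s + h) \<le> \<phi> s + h * \<epsilon>" "0 < h" "h < b - s"
      by (metis (mono_tags, lifting) eventually_happens trivial_limit_at_right_real)
    have "\<psi> (s + h) \<le> \<psi> s" using h unfolding \<psi>_def by (simp add: algebra_simps)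
    with sA h s have "s + h \<in> A" unfolding A_def by auto
    then have "s + h \<le> s" unfolding s_def using bdd by (rule cSup_upper)
    with h show False by simp
  qed
  then have "\<phi> b - \<epsilon> * (b - a) \<le> \<phi> a" using sA unfolding A_def \<psi>_def by auto
  moreover have "\<epsilon> * (b - a) \<le> e" unfolding \<epsilon>_def using ab \<open>0 < e\<close> by (simp add: field_simps)
  ultimately show "\<phi> b \<le> \<phi> a + e" by simp
qed

text \<open>The factor exp (- C (t - a)) reduces the claim to monotonicity. No derivative is taken:
  1 + C h \<le> exp (C h) absorbs the growth term at finite h, and this gets multiplied by
  \<open>\<phi> t\<close>, whence the sign condition.\<close>

lemma Dini_Gronwall:
  fixes \<phi> :: "real \<Rightarrow> real"
  assumes cont: "continuous_on {a..b} \<phi>"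
    and nonneg: "\<And>t. a \<le> t \<Longrightarrow> t \<le> b \<Longrightarrow> 0 \<le> \<phi> t"
    and C: "0 \<le> C"
    and dini: "\<And>t \<epsilon>. a \<le> t \<Longrightarrow> t < b \<Longrightarrow> 0 < \<epsilon> \<Longrightarrow>
      eventually (\<lambda>h. \<phi> (t + h) \<le> \<phi> t + h * (C * \<phi> t + \<epsilon>)) (at_right 0)"
    and ab: "a \<le> b"
  shows "\<phi> b \<le> \<phi> a * exp (C * (b - a))"
proof -
  define \<psi> where "\<psi> t = exp (- (C * (t - a))) * \<phi> t" for t
  have "\<psi> b \<le> \<psi> a"
  proof (rule Dini_nonincreasing[OF _ _ ab])
    show "continuous_on {a..b} \<psi>" unfolding \<psi>_def by (intro continuous_intros cont)
    fix t \<epsilon> :: real assume t: "a \<le> t" "t < b" and \<epsilon>: "0 < \<epsilon>"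
    have "eventually (\<lambda>h. h > (0::real)) (at_right 0)" by (simp add: eventually_at_right_less)
    with dini[OF t \<epsilon>] show "eventually (\<lambda>h. \<psi> (t + h) \<le> \<psi> t + h * \<epsilon>) (at_right 0)"
    proof eventually_elim
      case (elim h)
      have nn: "0 \<le> \<phi> t" using nonneg t by simp
      have e1: "exp (- (C * h)) * (1 + C * h) \<le> 1"
        using exp_ge_add_one_self[of "C * h"] by (simp add: exp_minus field_simps)
      have "exp (- (C * h)) * \<phi> (t + h) \<le> exp (- (C * h)) * (\<phi> t + h * (C * \<phi> t + \<epsilon>))"
        using elim by simp
      also have "\<dots> = (exp (- (C * h)) * (1 + C * h)) * \<phi> t + exp (- (C * h)) * (h * \<epsilon>)"
        by (simp add: algebra_simps)
      also have "\<dots> \<le> 1 * \<phi> t + 1 * (h * \<epsilon>)"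
        using e1 nn elim C \<epsilon> by (intro add_mono mult_right_mono) auto
      finally have *: "exp (- (C * h)) * \<phi> (t + h) \<le> \<phi> t + h * \<epsilon>" by simp
      have "\<psi> (t + h) = exp (- (C * (t - a))) * (exp (- (C * h)) * \<phi> (t + h))"
        unfolding \<psi>_def by (simp add: exp_add[symmetric] algebra_simps flip: mult.assoc)
      also have "\<dots> \<le> exp (- (C * (t - a))) * (\<phi> t + h * \<epsilon>)"
        using * by simp
      also have "\<dots> = \<psi> t + exp (- (C * (t - a))) * (h * \<epsilon>)"
        by (simp add: \<psi>_def algebra_simps)
      also have "\<dots> \<le> \<psi> t + 1 * (h * \<epsilon>)"
        using elim C \<epsilon> t by (intro add_left_mono mult_right_mono) auto
      finally show ?case by simp
    qed
  qed
  then have "exp (- (C * (b - a))) * \<phi> b \<le> \<phi> a" unfolding \<psi>_def by simp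
  then have "exp (C * (b - a)) * (exp (- (C * (b - a))) * \<phi> b) \<le> exp (C * (b - a)) * \<phi> a"
    by (intro mult_left_mono) auto
  then show ?thesis by (simp add: mult.commute[of "\<phi> a"] flip: mult.assoc exp_add)
qed

text \<open>Sokal's gliding-hump argument.\<close>

lemma uniform_boundedness:
  fixes T :: "nat \<Rightarrow> 'a::banach \<Rightarrow> 'b::real_normed_vector"
  assumes lin: "\<And>n. bounded_linear (T n)"
    and ptw: "\<And>x. \<exists>B. \<forall>n. norm (T n x) \<le> B"
  shows "\<exists>M. \<forall>n x. norm (T n x) \<le> M * norm x"
proof (rule ccontr)
  assume neg: "\<not> ?thesis"
  have big: "\<exists>n. onorm (T n) > B" for B
  proof (rule ccontr)
    assume "\<not> ?thesis"
    then have "norm (T n x) \<le> B * norm x" for n x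
      by (meson lin linorder_not_less mult_right_mono norm_ge_zero onorm order_trans)
    with neg show False by blast
  qed
  \<comment> \<open>T n (x + v) and T n (x - v) differ by 2 T n v, so one of the two is at least as
    long as T n v. The factor 2/3 < 1 is there because the operator norm need not be
    attained.\<close>
  have step: "\<exists>y n. dist x y \<le> (1/3)^m \<and> 4^m < onorm (T n) \<and> 2/3 * (1/3)^m * onorm (T n) \<le> norm (T n y)" for x m
  proof -
    obtain n where n: "onorm (T n) > 4^m" using big by blast
    then have pos: "onorm (T n) > 0" using zero_less_power[of "4::real" m] by linarith
    obtain z where z: "norm (T n z) > 2/3 * onorm (T n) * norm z"
    proof (rule ccontr)
      assume "\<not> thesis"
      with that have "norm (T n z) \<le> (2/3 * onorm (T n)) * norm z" for z by (meson not_le)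
      then have "onorm (T n) \<le> 2/3 * onorm (T n)" using pos by (intro onorm_bound) auto
      with pos show False by simp
    qed
    interpret Tn: bounded_linear "T n" by (rule lin)
    have z0: "norm z > 0" using z Tn.zero by (cases "z = 0") auto
    define v where "v = ((1/3)^m / norm z) *\<^sub>R z"
    have nv: "norm v = (1/3)^m" using z0 unfolding v_def by simp
    have Tv: "norm (T n v) \<ge> 2/3 * (1/3)^m * onorm (T n)"
    proof -
      have "norm (T n v) = (1/3)^m / norm z * norm (T n z)" by (simp add: v_def Tn.scaleR)
      also have "\<dots> \<ge> (1/3)^m / norm z * (2/3 * onorm (T n) * norm z)"
        using z by (intro mult_left_mono) auto
      finally show ?thesis using z0 by (simp add: field_simps)
    qed
    have "T n v + T n v = T n (x + v) - T n (x - v)" by (simp add: Tn.add Tn.diff)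
    then have "norm (T n v + T n v) \<le> norm (T n (x + v)) + norm (T n (x - v))"
      by (metis norm_triangle_ineq4)
    moreover have "norm (T n v + T n v) = 2 * norm (T n v)"
      by (metis norm_scaleR scaleR_2 abs_numeral)
    ultimately have "norm (T n v) \<le> norm (T n (x + v)) \<or> norm (T n v) \<le> norm (T n (x - v))" by linarith
    then show ?thesis
    proof
      assume "norm (T n v) \<le> norm (T n (x + v))"
      then show ?thesis using n nv Tv by (intro exI[of _ "x + v"] exI[of _ n]) (auto simp: dist_norm)
    next
      assume "norm (T n v) \<le> norm (T n (x - v))"
      then show ?thesis using n nv Tv by (intro exI[of _ "x - v"] exI[of _ n]) (auto simp: dist_norm)
    qed
  qed
  then obtain Y N where YN: "\<And>x m. dist x (Y x m) \<le> (1/3)^m"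
      "\<And>x m. 4^m < onorm (T (N x m))"
      "\<And>x m. 2/3 * (1/3)^m * onorm (T (N x m)) \<le> norm (T (N x m) (Y x m))"
    by metis
  define X where "X = rec_nat 0 (\<lambda>m x. Y x (Suc m))"
  have XS: "X (Suc m) = Y (X m) (Suc m)" for m by (simp add: X_def)
  have d: "dist (X m) (X (Suc m)) \<le> (1/3)^(Suc m)" for m
    unfolding XS by (rule YN(1))
  \<comment> \<open>Sum of the geometric series of steps (1/3)^(m+1), ..., (1/3)^(m+k); the exact
    value, unlike the bound \<open>1/2 * (1/3)^m\<close>, survives the induction.\<close>
  have far: "dist (X m) (X (m + k)) \<le> 1/2 * (1/3)^m * (1 - (1/3)^k)" for m k
  proof (induction k)
    case (Suc k)
    have "dist (X m) (X (m + Suc k)) \<le> dist (X m) (X (m + k)) + (1/3)^(Suc (m + k))"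
      using dist_triangle[of "X m" "X (Suc (m + k))" "X (m + k)"] d[of "m + k"] by simp
    also have "\<dots> \<le> 1/2 * (1/3)^m * (1 - (1/3)^k) + (1/3)^(Suc (m + k))" using Suc by simp
    also have "\<dots> = 1/2 * (1/3)^m * (1 - (1/3)^(Suc k))" by (simp add: power_add field_simps)
    finally show ?case .
  qed simp
  have far': "dist (X m) (X n) \<le> 1/2 * (1/3)^m" if "m \<le> n" for m n
  proof -
    have "dist (X m) (X n) \<le> 1/2 * (1/3)^m * (1 - (1/3)^(n - m))"
      using far[of m "n - m"] that by simp
    also have "\<dots> \<le> 1/2 * (1/3)^m * 1" by (intro mult_left_mono) auto
    finally show ?thesis by simp
  qed
  have "Cauchy X"
  proof (rule metric_CauchyI)
    fix e :: real assume "0 < e"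
    then obtain M where M: "(1/3::real)^M < e" using real_arch_pow_inv[of e "1/3"] by auto
    have "dist (X m) (X n) < e" if "m \<ge> M" "n \<ge> M" for m n
    proof -
      have "dist (X m) (X n) \<le> dist (X M) (X m) + dist (X M) (X n)" by (metis dist_commute dist_triangle)
      also have "\<dots> \<le> (1/3)^M" using far'[OF that(1)] far'[OF that(2)] by simp
      finally show ?thesis using M by simp
    qed
    then show "\<exists>M. \<forall>m\<ge>M. \<forall>n\<ge>M. dist (X m) (X n) < e" by blast
  qed
  then obtain l where l: "X \<longlonglongrightarrow> l" using Cauchy_convergent_iff convergent_def by blast
  have dl: "dist (X m) l \<le> 1/2 * (1/3)^m" for m
    by (rule LIMSEQ_le_const2[OF tendsto_dist[OF tendsto_const l]]) (use far' in blast)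
  \<comment> \<open>The rest of the path moves the point by at most half of (1/3)^(m+1), so 2/3 -
    1/2 = 1/6 of the size gained at this step is left in the limit, while the operator norm exceeds
    4^(m+1).\<close>
  have lower: "1/6 * (4/3)^(Suc m) \<le> norm (T (N (X m) (Suc m)) l)" for m
  proof -
    let ?n = "N (X m) (Suc m)" and ?y = "X (Suc m)"
    interpret Tn: bounded_linear "T ?n" by (rule lin)
    have "norm (T ?n (?y - l)) \<le> onorm (T ?n) * norm (?y - l)" by (rule onorm[OF lin])
    also have "\<dots> \<le> onorm (T ?n) * (1/2 * (1/3)^(Suc m))"
      using dl[of "Suc m"] by (intro mult_left_mono onorm_pos_le lin) (simp add: dist_norm)
    finally have a: "norm (T ?n (?y - l)) \<le> onorm (T ?n) * (1/2 * (1/3)^(Suc m))" .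
    have "T ?n ?y = T ?n (?y - l) + T ?n l" by (simp flip: Tn.add)
    then have "norm (T ?n ?y) \<le> norm (T ?n (?y - l)) + norm (T ?n l)" by (metis norm_triangle_ineq)
    moreover have "2/3 * ((1/3)^(Suc m) * onorm (T ?n)) \<le> norm (T ?n ?y)"
      using YN(3)[of "Suc m" "X m"] unfolding XS by (simp only: mult.assoc)
    moreover have "norm (T ?n (?y - l)) \<le> 1/2 * ((1/3)^(Suc m) * onorm (T ?n))"
      using a by (simp only: mult_ac)
    ultimately have "1/6 * ((1/3)^(Suc m) * onorm (T ?n)) \<le> norm (T ?n l)" by linarith
    moreover have "1/6 * (4/3)^(Suc m) \<le> 1/6 * ((1/3)^(Suc m) * onorm (T ?n))"
    proof -
      have "(4/3::real)^(Suc m) = (1/3)^(Suc m) * 4^(Suc m)" by (simp flip: power_mult_distrib)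
      also have "\<dots> \<le> (1/3)^(Suc m) * onorm (T ?n)"
        using YN(2)[of "Suc m" "X m"] by (intro mult_left_mono) auto
      finally show ?thesis by simp
    qed
    ultimately show ?thesis by linarith
  qed
  obtain B where B: "\<And>n. norm (T n l) \<le> B" using ptw by blast
  obtain m where "6 * B < (4/3::real)^m" using real_arch_pow[of "4/3" "6*B"] by auto
  also have "\<dots> \<le> (4/3)^(Suc m)" by (intro power_increasing) auto
  finally show False using lower[of m] B[of "N (X m) (Suc m)"] by simp
qed

section \<open>Strongly continuous semigroups\<close>

locale strongly_continuous_semigroup =
  fixes U :: "real \<Rightarrow> 'a::banach \<Rightarrow> 'a"
  assumes linear: "0 \<le> t \<Longrightarrow> bounded_linear (U t)"
    and zero_time: "U 0 x = x"
    and add_time: "0 \<le> s \<Longrightarrow> 0 \<le> t \<Longrightarrow> U (s + t) x = U s (U t x)"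
    and right_cont: "((\<lambda>t. U t x) \<longlongrightarrow> x) (at_right 0)"
begin

definition has_generator_value :: "'a \<Rightarrow> 'a \<Rightarrow> bool" where
  "has_generator_value x g \<longleftrightarrow> ((\<lambda>h. (1/h) *\<^sub>R (U h x - x)) \<longlongrightarrow> g) (at_right 0)"

lemma small_time:
  assumes "0 < e"
  obtains d where "0 < d" "\<And>r. 0 \<le> r \<Longrightarrow> r < d \<Longrightarrow> norm (U r x - x) < e"
proof -
  from tendstoD[OF right_cont assms, of x] obtain d where
    d: "d > 0" "\<And>r. 0 < r \<Longrightarrow> r < d \<Longrightarrow> dist (U r x) x < e"
    unfolding eventually_at_right_field by auto
  have "norm (U r x - x) < e" if "0 \<le> r" "r < d" for r
    using d(2)[of r] that assms zero_time[of x] by (cases "r = 0") (auto simp: dist_norm)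
  with d(1) that show ?thesis by blast
qed

text \<open>Otherwise there are times tending to 0 at which the operator norms grow without bound.
  Each orbit stays bounded along these times because it converges to its starting point, which
  contradicts uniform boundedness.\<close>

lemma locally_bounded:
  obtains d M where "0 < d" "1 \<le> M" "\<And>t x. 0 \<le> t \<Longrightarrow> t \<le> d \<Longrightarrow> norm (U t x) \<le> M * norm x"
proof (rule ccontr)
  assume neg: "\<not> thesis"
  have "\<exists>t x. 0 \<le> t \<and> t \<le> inverse (real (Suc n)) \<and> norm (U t x) > real (Suc n) * norm x" for n
  proof (rule ccontr)
    assume "\<not> ?thesis"
    then have "\<And>t x. 0 \<le> t \<Longrightarrow> t \<le> inverse (real (Suc n)) \<Longrightarrow> norm (U t x) \<le> real (Suc n) * norm x"
      by (meson not_le)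
    then show False using neg that[of "inverse (real (Suc n))" "real (Suc n)"] by simp
  qed
  then obtain \<tau> X where \<tau>: "\<And>n. 0 \<le> \<tau> n" "\<And>n. \<tau> n \<le> inverse (real (Suc n))"
    and big: "\<And>n. norm (U (\<tau> n) (X n)) > real (Suc n) * norm (X n)" by metis
  have \<tau>0: "\<tau> \<longlonglongrightarrow> 0"
    by (rule tendsto_sandwich[OF _ _ tendsto_const LIMSEQ_inverse_real_of_nat]) (use \<tau> in auto)
  have "\<exists>M. \<forall>n x. norm (U (\<tau> n) x) \<le> M * norm x"
  proof (rule uniform_boundedness)
    show "bounded_linear (U (\<tau> n))" for n using linear \<tau> by simp
    fix x
    have "(\<lambda>n. U (\<tau> n) x) \<longlonglongrightarrow> x"
    proof (rule tendstoI)
      fix e :: real assume "0 < e"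
      then obtain d where d: "0 < d" "\<And>r. 0 \<le> r \<Longrightarrow> r < d \<Longrightarrow> norm (U r x - x) < e"
        using small_time[of e x] by blast
      from order_tendstoD(2)[OF \<tau>0 d(1)] show "eventually (\<lambda>n. dist (U (\<tau> n) x) x < e) sequentially"
        by eventually_elim (use d \<tau> in \<open>auto simp: dist_norm\<close>)
    qed
    then have "Bseq (\<lambda>n. U (\<tau> n) x)" by (intro convergent_imp_Bseq convergentI)
    then show "\<exists>B. \<forall>n. norm (U (\<tau> n) x) \<le> B" by (auto simp: Bseq_def)
  qed
  then obtain M where M: "\<And>n x. norm (U (\<tau> n) x) \<le> M * norm x" by blast
  obtain n where n: "M < real (Suc n)" using reals_Archimedean2 less_trans of_nat_less_iff lessI by metis
  have "norm (U (\<tau> n) (X n)) \<le> real (Suc n) * norm (X n)"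
    using M[of n "X n"] n by (meson mult_right_mono less_imp_le norm_ge_zero order_trans)
  with big[of n] show False by simp
qed

lemma bounded_on_compact:
  obtains M where "1 \<le> M" "\<And>t x. 0 \<le> t \<Longrightarrow> t \<le> b \<Longrightarrow> norm (U t x) \<le> M * norm x"
proof -
  obtain d M where dM: "0 < d" "1 \<le> M" "\<And>t x. 0 \<le> t \<Longrightarrow> t \<le> d \<Longrightarrow> norm (U t x) \<le> M * norm x"
    by (rule locally_bounded) blast
  have iter: "norm (U t x) \<le> M ^ Suc n * norm x" if "0 \<le> t" "t \<le> real (Suc n) * d" for n t x
    using that
  proof (induction n arbitrary: t)
    case 0 then show ?case using dM(3)[of t x] by simp
  next
    case (Suc n)
    show ?case
    proof (cases "t \<le> d")
      case True
      have "M * norm x \<le> M ^ Suc (Suc n) * norm x"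
        using dM(2) self_le_power[OF dM(2), of "Suc (Suc n)"] by (intro mult_right_mono) auto
      then show ?thesis using dM(3)[of t x] True Suc.prems by simp
    next
      case False
      have "U t x = U d (U (t - d) x)" using add_time[of d "t - d" x] False dM(1) by simp
      then have "norm (U t x) \<le> M * norm (U (t - d) x)" using dM by simp
      also have "\<dots> \<le> M * (M ^ Suc n * norm x)"
        using Suc.IH[of "t - d"] False Suc.prems dM by (intro mult_left_mono) (auto simp: algebra_simps)
      finally show ?thesis by (simp add: mult.assoc)
    qed
  qed
  obtain n where n: "b / d < real n" using reals_Archimedean2 by blast
  have b: "b \<le> real (Suc n) * d"
  proof -
    have "b \<le> real n * d" using n dM(1) by (simp add: field_simps)
    then show ?thesis using dM(1) by (simp add: algebra_simps)
  qed
  have "1 \<le> M ^ Suc n" using dM(2) by (intro one_le_power)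
  then show ?thesis using that iter b by (meson order_trans)
qed

lemma orbit_continuous: "continuous_on {0..} (\<lambda>t. U t x)"
  unfolding continuous_on_iff
proof (intro ballI allI impI)
  fix t e :: real assume t: "t \<in> {0..}" and e: "0 < e"
  obtain M where M: "1 \<le> M" "\<And>s x. 0 \<le> s \<Longrightarrow> s \<le> t + 1 \<Longrightarrow> norm (U s x) \<le> M * norm x"
    by (rule bounded_on_compact) blast
  obtain d where d: "0 < d" "\<And>r. 0 \<le> r \<Longrightarrow> r < d \<Longrightarrow> norm (U r x - x) < e / M"
    using small_time[of "e / M" x] e M by (metis divide_pos_pos less_le_trans zero_less_one)
  \<comment> \<open>Both one-sided limits are covered by calling r the earlier time: the increment
    is U r applied to the small vector U h x - x, and M is uniform in r up to t + 1.\<close>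
  have main: "norm (U (r + h) x - U r x) < e" if "0 \<le> r" "r \<le> t + 1" "0 \<le> h" "h < d" for r h
  proof -
    interpret Ur: bounded_linear "U r" using linear that by simp
    have "U (r + h) x - U r x = U r (U h x - x)" using add_time that by (simp add: Ur.diff)
    then have "norm (U (r + h) x - U r x) \<le> M * norm (U h x - x)" using M that by simp
    also have "\<dots> < M * (e / M)" using d(2)[of h] that M by (intro mult_strict_left_mono) auto
    finally show ?thesis using M by simp
  qed
  have "dist (U s x) (U t x) < e" if s: "s \<in> {0..}" "dist s t < min d 1" for s
  proof (cases "t \<le> s")
    case True
    then show ?thesis using main[of t "s - t"] s t by (auto simp: dist_norm dist_real_def)
  next
    case False
    then show ?thesis using main[of s "t - s"] s t
      by (auto simp: dist_norm dist_real_def norm_minus_commute)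
  qed
  then show "\<exists>d>0. \<forall>s\<in>{0..}. dist s t < d \<longrightarrow> dist (U s x) (U t x) < e"
    using d(1) by (metis min_less_iff_conj zero_less_one)
qed

text \<open>Expanding at the later time \<open>t + h\<close> makes the right derivative of the orbit sufficient.\<close>

lemma dissipative_functional_decreasing:
  fixes N :: "'a \<Rightarrow> real"
  assumes Lip: "\<And>x y. N (x + y) \<le> N x + L * norm y" and L: "0 \<le> L"
    and dense: "\<And>x e. 0 < e \<Longrightarrow> \<exists>y g. norm (x - y) < e \<and> has_generator_value y g"
    and diss: "\<And>x g l. has_generator_value x g \<Longrightarrow> 0 < l \<Longrightarrow> N x \<le> N (x - l *\<^sub>R g)"
    and t: "0 \<le> t"
  shows "N (U t x) \<le> N x"
proof -
  have Nc: "\<bar>N x - N y\<bar> \<le> L * norm (x - y)" for x y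
    using Lip[of y "x - y"] Lip[of x "y - x"] by (simp add: norm_minus_commute abs_le_iff)
  have contN: "continuous_on UNIV N"
    unfolding continuous_on_iff
  proof (intro ballI allI impI)
    fix x :: 'a and e :: real assume "0 < e"
    have "dist (N y) (N x) < e" if "dist y x < e / (L + 1)" for y
    proof -
      have "\<bar>N y - N x\<bar> \<le> (L + 1) * norm (y - x)" 
        using Nc[of y x] by (simp add: algebra_simps) (smt (verit) norm_ge_zero)
      also have "\<dots> < e" using that L by (simp add: dist_norm field_simps)
      finally show ?thesis by (simp add: dist_real_def)
    qed
    then show "\<exists>d>0. \<forall>y\<in>UNIV. dist y x < d \<longrightarrow> dist (N y) (N x) < e"
      using \<open>0 < e\<close> L by (intro exI[of _ "e / (L + 1)"]) auto
  qed
  have dom: "N (U t x) \<le> N x" if gen: "has_generator_value x g" for x g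
  proof -
    show ?thesis
    proof (rule Dini_nonincreasing[of 0 t "\<lambda>t. N (U t x)", unfolded zero_time])
      show "0 \<le> t" by (rule t)
      show "continuous_on {0..t} (\<lambda>t. N (U t x))"
        by (rule continuous_on_compose2[OF contN])
           (auto intro: continuous_on_subset[OF orbit_continuous])
      fix s \<epsilon> :: real assume s: "0 \<le> s" "s < t" and \<epsilon>: "0 < \<epsilon>"
      interpret Us: bounded_linear "U s" using linear s by simp
      have lim: "((\<lambda>h. L * norm (U s ((1/h) *\<^sub>R (U h x - x) - U h g))) \<longlongrightarrow> L * norm (U s (g - g))) (at_right 0)"
        using gen right_cont[of g] unfolding has_generator_value_def
        by (intro tendsto_intros Us.tendsto)
      have "eventually (\<lambda>h. L * norm (U s ((1/h) *\<^sub>R (U h x - x) - U h g)) < \<epsilon>) (at_right 0)"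
        using order_tendstoD(2)[OF lim, of \<epsilon>] \<epsilon> by (simp add: Us.zero)
      moreover have "eventually (\<lambda>h. h > (0::real)) (at_right 0)" by (simp add: eventually_at_right_less)
      ultimately show "eventually (\<lambda>h. N (U (s + h) x) \<le> N (U s x) + h * \<epsilon>) (at_right 0)"
      proof eventually_elim
        case (elim h)
        interpret Ush: bounded_linear "U (s + h)" using linear s elim by simp
        \<comment> \<open>The operators commute, so the limit defining the generator at x is carried
          to U (s + h) x by the bounded operator U (s + h).\<close>
        have gen': "has_generator_value (U (s + h) x) (U (s + h) g)"
          unfolding has_generator_value_def
        proof (rule tendsto_cong[THEN iffD1])
          show "((\<lambda>r. U (s + h) ((1/r) *\<^sub>R (U r x - x))) \<longlongrightarrow> U (s + h) g) (at_right 0)"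
            using gen unfolding has_generator_value_def by (intro Ush.tendsto)
          have "eventually (\<lambda>r. r > (0::real)) (at_right 0)" by (simp add: eventually_at_right_less)
          then show "eventually (\<lambda>r. U (s + h) ((1/r) *\<^sub>R (U r x - x)) = (1/r) *\<^sub>R (U r (U (s + h) x) - U (s + h) x)) (at_right 0)"
          proof eventually_elim
            case (elim r)
            have "U r (U (s + h) x) = U (s + h) (U r x)"
              using add_time[of r "s + h" x] add_time[of "s + h" r x] elim s \<open>0 < h\<close> by (simp add: add.commute)
            then show ?case by (simp add: Ush.scaleR Ush.diff)
          qed
        qed
        \<comment> \<open>The backward Euler point seen from time s + h is U s x up to h times a
          vector that tends to 0, since (U h x - x) / h and U h g have the same limit g.\<close>
        have eq: "U (s + h) x - h *\<^sub>R U (s + h) g = U s x + h *\<^sub>R U s ((1/h) *\<^sub>R (U h x - x) - U h g)"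
          using elim s by (simp add: add_time Us.diff Us.scaleR scaleR_diff_right)
        have "N (U (s + h) x) \<le> N (U (s + h) x - h *\<^sub>R U (s + h) g)"
          using diss[OF gen'] elim by simp
        also have "\<dots> \<le> N (U s x) + L * norm (h *\<^sub>R U s ((1/h) *\<^sub>R (U h x - x) - U h g))"
          unfolding eq by (rule Lip)
        also have "\<dots> = N (U s x) + h * (L * norm (U s ((1/h) *\<^sub>R (U h x - x) - U h g)))"
          using elim by simp
        also have "\<dots> \<le> N (U s x) + h * \<epsilon>"
          using elim by (intro add_left_mono mult_left_mono) auto
        finally show ?case .
      qed
    qed
  qed
  interpret Ut: bounded_linear "U t" using linear t by simp
  show ?thesis
  proof -
    \<comment> \<open>Only vectors in the domain of the generator have been treated so far; density
      together with continuity of N and of U t reaches every x.\<close>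
    have "\<exists>y g. norm (x - y) < inverse (real (Suc n)) \<and> has_generator_value y g" for n
      using dense by simp
    then obtain y g where y: "\<And>n. norm (x - y n) < inverse (real (Suc n))" "\<And>n. has_generator_value (y n) (g n)"
      by metis
    have "(\<lambda>n. norm (y n - x)) \<longlonglongrightarrow> 0"
      by (rule tendsto_sandwich[OF _ _ tendsto_const LIMSEQ_inverse_real_of_nat])
         (use y(1) in \<open>auto simp: norm_minus_commute less_imp_le\<close>)
    then have lim: "y \<longlonglongrightarrow> x" by (simp add: LIM_zero_iff tendsto_norm_zero_iff)
    have Ncont: "isCont N z" for z using contN continuous_on_eq_continuous_at by blast
    have "(\<lambda>n. N (U t (y n))) \<longlonglongrightarrow> N (U t x)" "(\<lambda>n. N (y n)) \<longlonglongrightarrow> N x"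
      using lim by (auto intro!: isCont_tendsto_compose[OF Ncont] Ut.tendsto)
    then show ?thesis using dom[OF y(2)] by (intro LIMSEQ_le) auto
  qed
qed

end

section \<open>Mild solutions for contraction semigroups\<close>

locale contraction_semigroup = strongly_continuous_semigroup +
  assumes contraction: "0 \<le> t \<Longrightarrow> norm (U t x) \<le> norm x"
begin

text \<open>Contractivity makes the change of the argument g harmless uniformly in time, which
  leaves the continuity of one fixed orbit.\<close>

lemma continuous_on_semigroup_apply:
  fixes f :: "'c::topological_space \<Rightarrow> real"
  assumes f: "continuous_on A f" and g: "continuous_on A g" and nn: "\<And>a. a \<in> A \<Longrightarrow> 0 \<le> f a"
  shows "continuous_on A (\<lambda>a. U (f a) (g a))"
  unfolding continuous_on_def
proof
  fix a assume a: "a \<in> A"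
  have 1: "((\<lambda>b. norm (g b - g a)) \<longlongrightarrow> 0) (at a within A)"
    using g a by (intro tendsto_norm_zero) (simp add: continuous_on_def LIM_zero_iff)
  have "continuous_on A (\<lambda>b. U (f b) (g a))"
    by (rule continuous_on_compose2[OF orbit_continuous f]) (use nn in auto)
  then have 2: "((\<lambda>b. norm (U (f b) (g a) - U (f a) (g a))) \<longlongrightarrow> 0) (at a within A)"
    using a by (intro tendsto_norm_zero) (simp add: continuous_on_def LIM_zero_iff)
  have "((\<lambda>b. U (f b) (g b) - U (f a) (g a)) \<longlongrightarrow> 0) (at a within A)"
  proof (rule Lim_null_comparison)
    show "((\<lambda>b. norm (g b - g a) + norm (U (f b) (g a) - U (f a) (g a))) \<longlongrightarrow> 0) (at a within A)"
      using tendsto_add[OF 1 2] by simp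
    have "norm (U (f b) (g b) - U (f a) (g a)) \<le> norm (g b - g a) + norm (U (f b) (g a) - U (f a) (g a))"
      if b: "b \<in> A" for b
    proof -
      interpret Ub: bounded_linear "U (f b)" using linear nn b by simp
      have "norm (U (f b) (g b - g a)) \<le> norm (g b - g a)" using contraction nn b by simp
      moreover have "U (f b) (g b) - U (f a) (g a) = U (f b) (g b - g a) + (U (f b) (g a) - U (f a) (g a))"
        by (simp add: Ub.diff)
      ultimately show ?thesis by (metis add_right_mono norm_triangle_ineq order_trans)
    qed
    then show "eventually (\<lambda>b. norm (U (f b) (g b) - U (f a) (g a)) \<le> norm (g b - g a) + norm (U (f b) (g a) - U (f a) (g a))) (at a within A)"
      by (simp add: eventually_at_filter)
  qed
  then show "((\<lambda>b. U (f b) (g b)) \<longlongrightarrow> U (f a) (g a)) (at a within A)" by (simp add: LIM_zero_iff)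
qed

text \<open>The Duhamel integral of the forcing g. The lower limit r is variable because solutions
  get restarted at later times.\<close>

definition conv :: "(real \<Rightarrow> 'a) \<Rightarrow> real \<Rightarrow> real \<Rightarrow> 'a" where
  "conv g r t = integral {r..t} (\<lambda>s. U (t - s) (g s))"

lemma conv_integrand_continuous:
  "continuous_on {r..t} g \<Longrightarrow> t \<le> t' \<Longrightarrow> continuous_on {r..t} (\<lambda>s. U (t' - s) (g s))"
  by (rule continuous_on_semigroup_apply) (auto intro!: continuous_intros)

lemma conv_diff:
  assumes "continuous_on {r..t} g" "continuous_on {r..t} g'"
  shows "conv g r t - conv g' r t = conv (\<lambda>s. g s - g' s) r t"
proof -
  have "integral {r..t} (\<lambda>s. U (t - s) (g s - g' s)) = integral {r..t} (\<lambda>s. U (t - s) (g s) - U (t - s) (g' s))"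
  proof (rule integral_cong)
    fix s assume s: "s \<in> {r..t}"
    interpret Ub: bounded_linear "U (t - s)" using linear s by simp
    show "U (t - s) (g s - g' s) = U (t - s) (g s) - U (t - s) (g' s)" by (rule Ub.diff)
  qed
  also have "\<dots> = conv g r t - conv g' r t"
    unfolding conv_def
    by (intro integral_diff integrable_continuous_real conv_integrand_continuous assms order_refl)
  finally show ?thesis by (simp add: conv_def)
qed

lemma norm_conv_le:
  assumes "continuous_on {r..t} g" "r \<le> t" "\<And>s. s \<in> {r..t} \<Longrightarrow> norm (g s) \<le> B"
  shows "norm (conv g r t) \<le> B * (t - r)"
  unfolding conv_def
  by (rule integral_bound[OF assms(2) conv_integrand_continuous[OF assms(1) order_refl]])
     (use assms(3) in \<open>auto intro: order_trans[OF contraction]\<close>)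

text \<open>Both the interval and the integrand depend on t. Cutting t - s off at 0 extends the
  integrand continuously to the fixed square; on s > t it is just g s, as U 0 is the identity, and
  that excess is subtracted as an ordinary integral.\<close>

lemma conv_continuous:
  assumes g: "continuous_on {r..b} g"
  shows "continuous_on {r..b} (conv g r)"
proof -
  have g2: "continuous_on ({r..b} \<times> {r..b}) (\<lambda>z. g (snd z))"
    by (rule continuous_on_compose2[OF g continuous_on_snd[OF continuous_on_id]]) auto
  have "continuous_on ({r..b} \<times> cbox r b) (\<lambda>(t, s). U (max (t - s) 0) (g s))"
    unfolding case_prod_beta cbox_interval
    by (rule continuous_on_semigroup_apply[OF _ g2]) (auto intro!: continuous_intros)
  then have 1: "continuous_on {r..b} (\<lambda>t. integral {r..b} (\<lambda>s. U (max (t - s) 0) (g s)))"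
    unfolding cbox_interval[symmetric] by (rule integral_continuous_on_param)
  have int: "g integrable_on {r..b}" using g by (rule integrable_continuous_real)
  have "continuous_on {r..b} (\<lambda>t. integral {r..b} g - integral {r..t} g)"
    by (intro continuous_intros indefinite_integral_continuous_1 int)
  then have 2: "continuous_on {r..b} (\<lambda>t. integral {r..b} (\<lambda>s. U (max (t - s) 0) (g s)) - (integral {r..b} g - integral {r..t} g))"
    by (rule continuous_on_diff[OF 1])
  show ?thesis
  proof (rule continuous_on_cong[THEN iffD1, OF refl _ 2])
    fix t assume t: "t \<in> {r..b}"
    have int2: "(\<lambda>s. U (max (t - s) 0) (g s)) integrable_on {r..b}"
      using g by (intro integrable_continuous_real continuous_on_semigroup_apply) (auto intro!: continuous_intros)
    have "integral {r..b} (\<lambda>s. U (max (t - s) 0) (g s))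
        = integral {r..t} (\<lambda>s. U (max (t - s) 0) (g s)) + integral {t..b} (\<lambda>s. U (max (t - s) 0) (g s))"
      using Henstock_Kurzweil_Integration.integral_combine[OF _ _ int2, of t] t by simp
    also have "integral {r..t} (\<lambda>s. U (max (t - s) 0) (g s)) = conv g r t"
      unfolding conv_def by (intro integral_cong) (auto simp: max_def)
    also have "integral {t..b} (\<lambda>s. U (max (t - s) 0) (g s)) = integral {t..b} g"
      by (intro integral_cong) (auto simp: max_def zero_time)
    finally show "integral {r..b} (\<lambda>s. U (max (t - s) 0) (g s)) - (integral {r..b} g - integral {r..t} g) = conv g r t"
      using Henstock_Kurzweil_Integration.integral_combine[OF _ _ int, of t] t by (simp add: algebra_simps)
  qed
qed

lemma conv_split:
  assumes g: "continuous_on {r..t'} g" and t: "r \<le> t" "t \<le> t'"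
  shows "conv g r t' = U (t' - t) (conv g r t) + conv g t t'"
proof -
  have int: "(\<lambda>s. U (t' - s) (g s)) integrable_on {r..t'}"
    using g by (intro integrable_continuous_real conv_integrand_continuous) auto
  have g1: "continuous_on {r..t} g" by (rule continuous_on_subset[OF g]) (use t in auto)
  have int1: "(\<lambda>s. U (t - s) (g s)) integrable_on {r..t}"
    using g1 by (intro integrable_continuous_real conv_integrand_continuous) auto
  have "conv g r t' = integral {r..t} (\<lambda>s. U (t' - s) (g s)) + conv g t t'"
    unfolding conv_def using Henstock_Kurzweil_Integration.integral_combine[OF t int] by simp
  also have "integral {r..t} (\<lambda>s. U (t' - s) (g s)) = integral {r..t} (U (t' - t) \<circ> (\<lambda>s. U (t - s) (g s)))"
    using t by (intro integral_cong) (auto simp flip: add_time)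
  also have "\<dots> = U (t' - t) (conv g r t)"
    unfolding conv_def by (rule integral_linear[OF int1 linear]) (use t in simp)
  finally show ?thesis .
qed

lemma mild_shift:
  assumes g: "continuous_on {0..b} g"
    and w: "\<And>t. t \<in> {0..b} \<Longrightarrow> w t = U t w0 + conv g 0 t"
    and t: "0 \<le> t" "t \<le> t'" "t' \<le> b"
  shows "w t' = U (t' - t) (w t) + conv g t t'"
proof -
  interpret Ut: bounded_linear "U (t' - t)" using linear t by simp
  have "U t' w0 = U (t' - t) (U t w0)" using add_time[of "t' - t" t w0] t by simp
  then show ?thesis
    using conv_split[OF continuous_on_subset[OF g], of 0 t' t] w t by (simp add: Ut.add)
qed

text \<open>The semigroup part of a mild solution does not increase \<open>N\<close>, so only the forcing term contributes
  to the upper right Dini derivative of \<open>N\<close> along the solution.\<close>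

lemma mild_functional_step:
  fixes N :: "'a \<Rightarrow> real"
  assumes g: "continuous_on {0..b} g"
    and w: "\<And>t. t \<in> {0..b} \<Longrightarrow> w t = U t w0 + conv g 0 t"
    and Lip: "\<And>x y. N (x + y) \<le> N x + L * norm y" and L: "0 \<le> L"
    and dec: "\<And>t x. 0 \<le> t \<Longrightarrow> N (U t x) \<le> N x"
    and t: "0 \<le> t" "t < b" and \<epsilon>: "0 < \<epsilon>"
  shows "eventually (\<lambda>h. N (w (t + h)) \<le> N (w t + h *\<^sub>R g t) + h * \<epsilon>) (at_right 0)"
proof -
  \<comment> \<open>A third for each of the comparisons of g s with g t, of U (t + h - s) (g t) with
    g t, and of U h (g t) with g t; L + 1 instead of L admits L = 0.\<close>
  define e where "e = \<epsilon> / (3 * (L + 1))"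
  have e: "e > 0" using \<epsilon> L by (simp add: e_def)
  obtain d1 where d1: "0 < d1" "\<And>r. 0 \<le> r \<Longrightarrow> r < d1 \<Longrightarrow> norm (U r (g t) - g t) < e"
    using small_time[OF e, of "g t"] by blast
  obtain d2 where d2: "0 < d2" "\<And>s. s \<in> {0..b} \<Longrightarrow> dist s t < d2 \<Longrightarrow> dist (g s) (g t) < e"
    using g t e unfolding continuous_on_iff by (metis atLeastAtMost_iff less_imp_le)
  define d where "d = min d1 (min d2 (b - t))"
  have d: "d > 0" using d1 d2 t by (simp add: d_def)
  have "N (w (t + h)) \<le> N (w t + h *\<^sub>R g t) + h * \<epsilon>" if h: "0 < h" "h < d" for h
  proof -
    interpret Uh: bounded_linear "U h" using linear h by simp
    have h': "h < d1" "h < d2" "t + h \<le> b" using h by (auto simp: d_def)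
    have gc: "continuous_on {t..t+h} g" by (rule continuous_on_subset[OF g]) (use t h' in auto)
    have step: "w (t + h) = U h (w t) + conv g t (t + h)"
      using mild_shift[OF g w, of t "t + h"] t h h' by simp
    \<comment> \<open>The Duhamel term is compared with h U h (g t) rather than with h g t: the main
      part is then U h applied to the Euler point, on which \<open>dec\<close> acts.\<close>
    define R where "R = conv g t (t + h) - h *\<^sub>R U h (g t)"
    have "integral {t..t+h} (\<lambda>s. U h (g t)) = h *\<^sub>R U h (g t)" using h by simp
    then have "R = integral {t..t+h} (\<lambda>s. U (t + h - s) (g s) - U h (g t))"
      unfolding R_def conv_def
      by (subst integral_diff[OF integrable_continuous_real[OF conv_integrand_continuous[OF gc order_refl]]
            integrable_continuous_real[OF continuous_on_const]]) (rule arg_cong2[OF refl], rule sym)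
    also have "norm \<dots> \<le> (3 * e) * (t + h - t)"
    proof (rule integral_bound)
      show "continuous_on {t..t+h} (\<lambda>s. U (t + h - s) (g s) - U h (g t))"
        by (intro continuous_intros conv_integrand_continuous gc order_refl)
      fix s assume s: "s \<in> {t..t+h}"
      interpret Us: bounded_linear "U (t + h - s)" using linear s by simp
      have "dist (g s) (g t) < e" using d2(2)[of s] s t h' by (auto simp: dist_real_def)
      then have 1: "norm (U (t + h - s) (g s - g t)) < e"
        using contraction[of "t + h - s" "g s - g t"] s by (simp add: dist_norm)
      have 2: "norm (U (t + h - s) (g t) - g t) < e" using d1(2)[of "t + h - s"] s h' by simp
      have 3: "norm (U h (g t) - g t) < e" using d1(2)[of h] h h' by simp
      have "U (t + h - s) (g s) - U h (g t) = U (t + h - s) (g s - g t)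
          + (U (t + h - s) (g t) - g t) - (U h (g t) - g t)"
        by (simp add: Us.diff)
      then have "norm (U (t + h - s) (g s) - U h (g t)) \<le> norm (U (t + h - s) (g s - g t))
          + norm (U (t + h - s) (g t) - g t) + norm (U h (g t) - g t)"
        by (simp only:) (rule order_trans[OF norm_triangle_ineq4 add_right_mono[OF norm_triangle_ineq]])
      then show "norm (U (t + h - s) (g s) - U h (g t)) \<le> 3 * e" using 1 2 3 by simp
    qed (use h in auto)
    finally have R: "norm R \<le> 3 * e * h" by simp
    have "w (t + h) = U h (w t + h *\<^sub>R g t) + R"
      unfolding step R_def by (simp add: Uh.add Uh.scaleR)
    then have "N (w (t + h)) \<le> N (U h (w t + h *\<^sub>R g t)) + L * norm R" by (simp add: Lip)
    also have "\<dots> \<le> N (w t + h *\<^sub>R g t) + (L + 1) * (3 * e * h)"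
      using dec h R L by (intro add_mono mult_mono) auto
    also have "(L + 1) * (3 * e * h) = h * \<epsilon>"
      unfolding e_def using L by (simp add: field_simps)
    finally show ?thesis .
  qed
  then show ?thesis using d by (auto simp: eventually_at_right_field)
qed

text \<open>Picard iteration: \<open>norm x0 + B * (b - r) \<le> R\<close> makes the ball of radius
  R invariant and \<open>\<Lambda> * (b - r) \<le> 1/2\<close> makes the iteration contract by 1/2.
  The bounds on F are asked only on this ball, as a quadratic nonlinearity has no global
  ones.\<close>

lemma local_mild_solution:
  assumes r: "r \<le> b"
    and Fc: "\<And>v. continuous_on {r..b} v \<Longrightarrow> continuous_on {r..b} (\<lambda>s. F s (v s))"
    and FL: "\<And>t x y. t \<in> {r..b} \<Longrightarrow> norm x \<le> R \<Longrightarrow> norm y \<le> R \<Longrightarrow> norm (F t x - F t y) \<le> \<Lambda> * norm (x - y)"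
    and FB: "\<And>t x. t \<in> {r..b} \<Longrightarrow> norm x \<le> R \<Longrightarrow> norm (F t x) \<le> B"
    and R: "norm x0 + B * (b - r) \<le> R" and \<Lambda>: "\<Lambda> * (b - r) \<le> 1/2" "0 \<le> \<Lambda>" and B: "0 \<le> B"
  obtains v where "continuous_on {r..b} v"
    "\<And>t. t \<in> {r..b} \<Longrightarrow> v t = U (t - r) x0 + conv (\<lambda>s. F s (v s)) r t"
proof -
  \<comment> \<open>Time is frozen outside [r, b], so that the fixed point is sought among the
    bounded continuous functions on the whole line, a complete space that is available as a
    type.\<close>
  define clip where "clip t = max r (min b t)" for t
  have clip: "clip t \<in> {r..b}" "t \<in> {r..b} \<Longrightarrow> clip t = t" for t using r by (auto simp: clip_def)
  have clipc: "continuous_on UNIV clip" unfolding clip_def by (intro continuous_intros)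
  define \<Phi> where "\<Phi> v t = U (clip t - r) x0 + conv (\<lambda>s. F s (v s)) r (clip t)" for v t
  define Ball where "Ball = PiC UNIV (\<lambda>_::real. cball (0::'a) R)"
  have memB: "v \<in> Ball \<longleftrightarrow> (\<forall>t. norm (apply_bcontfun v t) \<le> R)" for v
    by (auto simp: Ball_def mem_PiC_iff)
  have \<Phi>c: "continuous_on UNIV (\<Phi> v)" if "continuous_on {r..b} v" for v
  proof -
    have "continuous_on {r..b} (\<lambda>t. U (t - r) x0 + conv (\<lambda>s. F s (v s)) r t)"
      by (intro continuous_on_add conv_continuous Fc that continuous_on_semigroup_apply) (auto intro!: continuous_intros)
    moreover have "clip ` UNIV \<subseteq> {r..b}" using clip(1) by blast
    ultimately show ?thesis unfolding \<Phi>_def by (rule continuous_on_compose2[OF _ clipc])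
  qed
  have \<Phi>B: "norm (\<Phi> v t) \<le> R" if v: "continuous_on {r..b} v" "\<And>t. norm (v t) \<le> R" for v t
  proof -
    have "norm (conv (\<lambda>s. F s (v s)) r (clip t)) \<le> B * (clip t - r)"
      using clip(1)[of t] v
      by (intro norm_conv_le continuous_on_subset[OF Fc[OF v(1)]] FB) auto
    also have "\<dots> \<le> B * (b - r)" using clip(1)[of t] B by (intro mult_left_mono) auto
    moreover have "norm (U (clip t - r) x0) \<le> norm x0" using clip(1)[of t] by (intro contraction) auto
    ultimately show ?thesis using R norm_triangle_ineq[of "U (clip t - r) x0" "conv (\<lambda>s. F s (v s)) r (clip t)"]
      unfolding \<Phi>_def by linarith
  qed
  have \<Phi>bc: "\<Phi> (apply_bcontfun v) \<in> bcontfun" if "v \<in> Ball" for v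
    by (rule bcontfun_normI[of _ R]) (use that memB \<Phi>c \<Phi>B in auto)
  have app: "apply_bcontfun (Bcontfun (\<Phi> (apply_bcontfun v))) = \<Phi> (apply_bcontfun v)" if "v \<in> Ball" for v
    using \<Phi>bc[OF that] by (rule Bcontfun_inverse)
  have "\<exists>!v\<in>Ball. Bcontfun (\<Phi> (apply_bcontfun v)) = v"
  proof (rule Banach_fix[of _ "1/2"])
    show "complete Ball" unfolding Ball_def complete_eq_closed by (intro closed_PiC) auto
    have "0 \<le> R" using R B r by (smt (verit) mult_nonneg_nonneg norm_ge_zero)
    then have "0 \<in> Ball" by (simp add: memB)
    then show "Ball \<noteq> {}" by blast
    show "(\<lambda>v. Bcontfun (\<Phi> (apply_bcontfun v))) ` Ball \<subseteq> Ball"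
      using app memB \<Phi>B by auto
    fix v v' assume vv: "v \<in> Ball" "v' \<in> Ball"
    show "dist (Bcontfun (\<Phi> (apply_bcontfun v))) (Bcontfun (\<Phi> (apply_bcontfun v'))) \<le> 1/2 * dist v v'"
    proof (rule dist_bound)
      fix t
      have c: "continuous_on {r..clip t} (\<lambda>s. F s (apply_bcontfun u s))" for u
        by (rule continuous_on_subset[OF Fc]) (use clip(1)[of t] in auto)
      have "\<Phi> v t - \<Phi> v' t = conv (\<lambda>s. F s (v s) - F s (v' s)) r (clip t)"
        unfolding \<Phi>_def using conv_diff[OF c c] by simp
      also have "norm \<dots> \<le> (\<Lambda> * dist v v') * (clip t - r)"
      proof (rule norm_conv_le)
        show "continuous_on {r..clip t} (\<lambda>s. F s (v s) - F s (v' s))" by (intro continuous_intros c)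
        fix s assume "s \<in> {r..clip t}"
        then have "norm (F s (v s) - F s (v' s)) \<le> \<Lambda> * norm (v s - v' s)"
          using clip(1)[of t] vv memB by (intro FL) auto
        also have "\<dots> \<le> \<Lambda> * dist v v'"
          using \<Lambda>(2) dist_bounded[of v s v'] by (intro mult_left_mono) (auto simp: dist_norm)
        finally show "norm (F s (v s) - F s (v' s)) \<le> \<Lambda> * dist v v'" .
      qed (use clip(1)[of t] in auto)
      also have "\<dots> \<le> (\<Lambda> * dist v v') * (b - r)"
        using clip(1)[of t] \<Lambda>(2) by (intro mult_left_mono) auto
      also have "\<dots> \<le> 1/2 * dist v v'"
        using \<Lambda>(1) mult_right_mono[OF \<Lambda>(1), of "dist v v'"] by (simp add: mult_ac)
      finally show "dist (apply_bcontfun (Bcontfun (\<Phi> (apply_bcontfun v))) t) (apply_bcontfun (Bcontfun (\<Phi> (apply_bcontfun v'))) t) \<le> 1/2 * dist v v'"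
        unfolding app[OF vv(1)] app[OF vv(2)] by (simp add: dist_norm)
    qed
  qed auto
  then obtain v where v: "v \<in> Ball" "Bcontfun (\<Phi> (apply_bcontfun v)) = v" by blast
  have "apply_bcontfun v t = U (t - r) x0 + conv (\<lambda>s. F s (v s)) r t" if "t \<in> {r..b}" for t
    using fun_cong[OF app[OF v(1)], of t] clip(2)[OF that] unfolding v(2) \<Phi>_def by simp
  then show ?thesis using that[of "apply_bcontfun v"] by simp
qed

end

section \<open>The sequence space\<close>

text \<open>A type cannot depend on the exponent p, so the weight is kept out of it and goes into
  the isometry \<open>to_l1 p\<close>. Entry 0 is pinned to 0 because the weight w_0 = 0 would erase
  it there.\<close>

typedef l1 = "{f :: nat \<Rightarrow> real. f 0 = 0 \<and> summable (\<lambda>n. \<bar>f n\<bar>)}"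
  morphisms coord Abs_l1
  by (rule exI[of _ "\<lambda>_. 0"]) auto

setup_lifting type_definition_l1

lemma coord_0 [simp]: "coord x 0 = 0"
  and summable_coord: "summable (\<lambda>n. \<bar>coord x n\<bar>)"
  using coord[of x] by auto

lemma l1_eqI: "(\<And>n. coord x n = coord y n) \<Longrightarrow> x = y"
  by (metis coord_inject ext)

lemma summable_abs_add_diff:
  fixes f g :: "nat \<Rightarrow> real"
  assumes "summable (\<lambda>n. \<bar>f n\<bar>)" "summable (\<lambda>n. \<bar>g n\<bar>)"
  shows "summable (\<lambda>n. \<bar>f n + g n\<bar>)" "summable (\<lambda>n. \<bar>f n - g n\<bar>)"
  by (rule summable_comparison_test'[OF summable_add[OF assms], of 0]; simp)+

instantiation l1 :: real_vector
begin

lift_definition zero_l1 :: l1 is "\<lambda>_. 0" by simp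
lift_definition plus_l1 :: "l1 \<Rightarrow> l1 \<Rightarrow> l1" is "\<lambda>f g n. f n + g n"
  by (simp add: summable_abs_add_diff)
lift_definition uminus_l1 :: "l1 \<Rightarrow> l1" is "\<lambda>f n. - f n" by simp
lift_definition minus_l1 :: "l1 \<Rightarrow> l1 \<Rightarrow> l1" is "\<lambda>f g n. f n - g n"
  by (simp add: summable_abs_add_diff)
lift_definition scaleR_l1 :: "real \<Rightarrow> l1 \<Rightarrow> l1" is "\<lambda>c f n. c * f n"
  by (auto simp: abs_mult intro: summable_mult)

instance
  by standard (transfer; auto simp: algebra_simps)+

end

lemma coord_simps [simp]:
  "coord 0 n = 0" "coord (x + y) n = coord x n + coord y n" "coord (- x) n = - coord x n"
  "coord (x - y) n = coord x n - coord y n" "coord (c *\<^sub>R x) n = c * coord x n"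
  by (transfer; simp)+

instantiation l1 :: real_normed_vector
begin

definition norm_l1 :: "l1 \<Rightarrow> real" where "norm_l1 x = (\<Sum>n. \<bar>coord x n\<bar>)"
definition dist_l1 :: "l1 \<Rightarrow> l1 \<Rightarrow> real" where "dist_l1 x y = norm (x - y)"
definition sgn_l1 :: "l1 \<Rightarrow> l1" where "sgn_l1 x = x /\<^sub>R norm x"
definition uniformity_l1 :: "(l1 \<times> l1) filter"
  where "uniformity_l1 = (INF e\<in>{0 <..}. principal {(x, y). dist x y < e})"
definition open_l1 :: "l1 set \<Rightarrow> bool"
  where "open_l1 S = (\<forall>x\<in>S. \<forall>\<^sub>F (x', y) in uniformity. x' = x \<longrightarrow> y \<in> S)"

instance
proof
  fix x y :: l1 and c :: real
  show "dist x y = norm (x - y)" by (rule dist_l1_def)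
  show "sgn x = x /\<^sub>R norm x" by (rule sgn_l1_def)
  show "uniformity = (INF e\<in>{0 <..}. principal {(x, y :: l1). dist x y < e})" by (rule uniformity_l1_def)
  show "open S = (\<forall>x\<in>S. \<forall>\<^sub>F (x', y) in uniformity. x' = x \<longrightarrow> y \<in> S)" for S :: "l1 set" by (rule open_l1_def)
  show "norm x = 0 \<longleftrightarrow> x = 0"
  proof
    assume "norm x = 0"
    then have "\<forall>n. \<bar>coord x n\<bar> = 0"
      unfolding norm_l1_def by (subst (asm) suminf_eq_zero_iff[OF summable_coord]) auto
    then show "x = 0" by (intro l1_eqI) simp
  qed (simp add: norm_l1_def)
  show "norm (x + y) \<le> norm x + norm y"
    unfolding norm_l1_def suminf_add[OF summable_coord summable_coord]
    by (intro suminf_le summable_add summable_coord) auto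
  show "norm (c *\<^sub>R x) = \<bar>c\<bar> * norm x"
    unfolding norm_l1_def by (simp add: abs_mult suminf_mult summable_coord)
qed

end

lemma sum_coord_le_norm: "finite A \<Longrightarrow> (\<Sum>n\<in>A. \<bar>coord x n\<bar>) \<le> norm x"
  unfolding norm_l1_def by (rule sum_le_suminf[OF summable_coord]) auto

lemma abs_coord_le_norm: "\<bar>coord x n\<bar> \<le> norm x"
  using sum_coord_le_norm[of "{n}" x] by simp

lemma norm_l1_leI:
  assumes "\<And>m. (\<Sum>n<m. \<bar>coord x n\<bar>) \<le> B"
  shows "norm x \<le> B"
  unfolding norm_l1_def by (rule suminf_le_const[OF summable_coord assms])

lemma l1_of_bounded_sums:
  assumes "f 0 = 0" "\<And>m. (\<Sum>n<m. \<bar>f n\<bar>) \<le> B"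
  shows "coord (Abs_l1 f) = f"
proof (rule Abs_l1_inverse)
  have "(\<Sum>n\<le>m. \<bar>f n\<bar>) \<le> B" for m using assms(2)[of "Suc m"] by (simp only: lessThan_Suc_atMost)
  then show "f \<in> {f. f 0 = 0 \<and> summable (\<lambda>n. \<bar>f n\<bar>)}"
    using assms(1) bounded_imp_summable[of "\<lambda>n. \<bar>f n\<bar>" B] by simp
qed

lemma bounded_linear_coord: "bounded_linear (\<lambda>x. coord x n)"
  by (rule bounded_linear_intro[of _ 1]) (auto simp: abs_coord_le_norm)

instance l1 :: banach
proof
  fix X :: "nat \<Rightarrow> l1" assume X: "Cauchy X"
  interpret c: bounded_linear "\<lambda>x. coord x n" for n by (rule bounded_linear_coord)
  have "\<exists>l. (\<lambda>m. coord (X m) n) \<longlonglongrightarrow> l" for n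
    using c.Cauchy[OF X] Cauchy_convergent_iff convergent_def by blast
  then obtain f where f: "\<And>n. (\<lambda>m. coord (X m) n) \<longlonglongrightarrow> f n" by metis
  have f0: "f 0 = 0" using f[of 0] LIMSEQ_const_iff[of 0 "f 0"] by simp
  \<comment> \<open>Coordinatewise convergence passes only finite partial sums to the limit; the
    bound is uniform in N, so one for the full norm follows.\<close>
  have lim: "(\<Sum>n<N. \<bar>f n - coord (X m) n\<bar>) \<le> e" if "\<And>m'. m' \<ge> M \<Longrightarrow> norm (X m' - X m) \<le> e" for N m M e
  proof (rule LIMSEQ_le_const2)
    show "(\<lambda>m'. \<Sum>n<N. \<bar>coord (X m') n - coord (X m) n\<bar>) \<longlonglongrightarrow> (\<Sum>n<N. \<bar>f n - coord (X m) n\<bar>)"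
      by (intro tendsto_intros f)
    show "\<exists>M. \<forall>m'\<ge>M. (\<Sum>n<N. \<bar>coord (X m') n - coord (X m) n\<bar>) \<le> e"
      using that sum_coord_le_norm[of "{..<N}" "X _ - X m"] by (metis (no_types, lifting) coord_simps(4) finite_lessThan order_trans sum.cong)
  qed
  have cau: "\<exists>M. \<forall>m\<ge>M. \<forall>m'\<ge>M. norm (X m' - X m) < e" if "e > 0" for e
    using X that unfolding Cauchy_def dist_norm by meson
  obtain M where M: "\<And>m m'. m \<ge> M \<Longrightarrow> m' \<ge> M \<Longrightarrow> norm (X m' - X m) \<le> 1"
    using cau[of 1] by (meson less_imp_le zero_less_one)
  have "(\<Sum>n<N. \<bar>f n\<bar>) \<le> 1 + norm (X M)" for N
  proof -
    have "(\<Sum>n<N. \<bar>f n\<bar>) \<le> (\<Sum>n<N. \<bar>f n - coord (X M) n\<bar>) + (\<Sum>n<N. \<bar>coord (X M) n\<bar>)"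
      by (subst sum.distrib[symmetric], rule sum_mono) auto
    also have "\<dots> \<le> 1 + norm (X M)"
      using lim[of M M 1 N] M sum_coord_le_norm by (intro add_mono) auto
    finally show ?thesis .
  qed
  then have cf: "coord (Abs_l1 f) = f" using f0 by (intro l1_of_bounded_sums)
  have "X \<longlonglongrightarrow> Abs_l1 f"
  proof (rule metric_LIMSEQ_I)
    fix e :: real assume "0 < e"
    then obtain M where M: "\<And>m m'. m \<ge> M \<Longrightarrow> m' \<ge> M \<Longrightarrow> norm (X m' - X m) \<le> e/2"
      using cau[of "e/2"] by (meson less_imp_le half_gt_zero)
    have "dist (X m) (Abs_l1 f) < e" if "m \<ge> M" for m
    proof -
      have "norm (Abs_l1 f - X m) \<le> e/2"
        by (rule norm_l1_leI) (use lim[of M m "e/2"] M that cf in simp)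
      then show ?thesis using \<open>0 < e\<close> by (simp add: dist_norm norm_minus_commute)
    qed
    then show "\<exists>M. \<forall>m\<ge>M. dist (X m) (Abs_l1 f) < e" by blast
  qed
  then show "convergent X" by (rule convergentI)
qed

text \<open>\<open>pos_part_norm \<theta>\<close> is used with \<open>\<theta> = 1\<close>, giving the norm of the positive part, and with
  \<open>\<theta>\<^sub>n = n\<^sup>1\<^sup>-\<^sup>p\<close>, giving the first moment of the positive part.\<close>

definition pos_part_norm :: "(nat \<Rightarrow> real) \<Rightarrow> l1 \<Rightarrow> real" where
  "pos_part_norm \<theta> x = (\<Sum>n. \<theta> n * max (coord x n) 0)"

context
  fixes \<theta> :: "nat \<Rightarrow> real"
  assumes \<theta>: "\<And>n. 0 \<le> \<theta> n" "\<And>n. \<theta> n \<le> 1"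
begin

lemma summable_weighted_coord: "summable (\<lambda>n. \<theta> n * coord x n)"
  by (rule summable_comparison_test'[OF summable_coord[of x], of 0])
     (use \<theta> in \<open>auto simp: abs_mult intro: mult_left_le_one_le\<close>)

lemma summable_pos_part: "summable (\<lambda>n. \<theta> n * max (coord x n) 0)"
proof (rule summable_comparison_test'[OF summable_coord[of x], of 0])
  fix n
  have "\<theta> n * max (coord x n) 0 \<le> 1 * max (coord x n) 0" by (intro mult_right_mono \<theta>) auto
  then show "norm (\<theta> n * max (coord x n) 0) \<le> \<bar>coord x n\<bar>" using \<theta>(1)[of n] by (auto simp: max_def)
qed

lemma pos_part_norm_nonneg: "0 \<le> pos_part_norm \<theta> x"
  unfolding pos_part_norm_def by (rule suminf_nonneg[OF summable_pos_part]) (use \<theta> in auto)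

text \<open>Subadditivity and weights at most 1. The factor 1 is written out so that the statement
  matches the hypothesis with constant L on abstract functionals.\<close>

lemma pos_part_norm_add_le: "pos_part_norm \<theta> (x + y) \<le> pos_part_norm \<theta> x + 1 * norm y"
proof -
  have "pos_part_norm \<theta> (x + y) \<le> (\<Sum>n. \<theta> n * max (coord x n) 0 + \<bar>coord y n\<bar>)"
    unfolding pos_part_norm_def
  proof (intro suminf_le summable_add summable_pos_part summable_coord)
    fix n
    have "\<theta> n * max (coord (x + y) n) 0 \<le> \<theta> n * (max (coord x n) 0 + \<bar>coord y n\<bar>)"
      using \<theta> by (intro mult_left_mono) auto
    also have "\<dots> \<le> \<theta> n * max (coord x n) 0 + \<bar>coord y n\<bar>"
      using \<theta> by (simp add: distrib_left mult_left_le_one_le)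
    finally show "\<theta> n * max (coord (x + y) n) 0 \<le> \<theta> n * max (coord x n) 0 + \<bar>coord y n\<bar>" .
  qed
  then show ?thesis
    by (simp add: pos_part_norm_def norm_l1_def suminf_add[OF summable_pos_part summable_coord])
qed

end

text \<open>Through this, an estimate of positive parts for x and for - x becomes an estimate of the
  norm.\<close>

lemma norm_l1_eq_pos_parts: "norm x = pos_part_norm (\<lambda>_. 1) x + pos_part_norm (\<lambda>_. 1) (- x)"
proof -
  have "norm x = (\<Sum>n. 1 * max (coord x n) 0 + 1 * max (coord (- x) n) 0)"
    unfolding norm_l1_def by (intro suminf_cong) simp
  also have "\<dots> = pos_part_norm (\<lambda>_. 1) x + pos_part_norm (\<lambda>_. 1) (- x)"
    unfolding pos_part_norm_def by (intro suminf_add[symmetric] summable_pos_part) auto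
  finally show ?thesis .
qed

section \<open>The isometry between the weighted sequence space and \<open>l1\<close>\<close>

lemma wgt_0 [simp]: "wgt p 0 = 0" by (simp add: wgt_def)
lemma wgt_pos [simp]: "0 < n \<Longrightarrow> 0 < wgt p n" by (simp add: wgt_def)
lemma wgt_eq_0_iff [simp]: "wgt p n = 0 \<longleftrightarrow> n = 0" by (simp add: wgt_def)
lemma wgt_nonneg [simp]: "0 \<le> wgt p n" by (simp add: wgt_def)

definition to_l1 :: "real \<Rightarrow> (nat \<Rightarrow> real) \<Rightarrow> l1" where
  "to_l1 p f = Abs_l1 (\<lambda>n. wgt p n * f n)"

text \<open>At n = 0 the quotient is by \<open>wgt p 0 = 0\<close>, hence 0 by the convention for
  division, which is the value that \<open>l1w p\<close> prescribes.\<close>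

definition of_l1 :: "real \<Rightarrow> l1 \<Rightarrow> nat \<Rightarrow> real" where
  "of_l1 p x n = coord x n / wgt p n"

lemma coord_to_l1: "f \<in> l1w p \<Longrightarrow> coord (to_l1 p f) n = wgt p n * f n"
  unfolding to_l1_def l1w_def by (subst Abs_l1_inverse) (auto simp: abs_mult)

lemma wgt_mult_of_l1: "wgt p n * of_l1 p x n = coord x n"
  by (cases "n = 0") (simp_all add: of_l1_def)

lemma of_l1_mem [simp]: "of_l1 p x \<in> l1w p"
proof -
  have "wgt p n * \<bar>of_l1 p x n\<bar> = \<bar>coord x n\<bar>" for n
    unfolding wgt_mult_of_l1[of p n x, symmetric] by (simp add: abs_mult)
  then show ?thesis using summable_coord[of x] by (simp add: l1w_def) (simp add: of_l1_def)
qed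

lemma of_to_l1 [simp]: "f \<in> l1w p \<Longrightarrow> of_l1 p (to_l1 p f) = f"
proof
  fix n assume "f \<in> l1w p"
  then show "of_l1 p (to_l1 p f) n = f n"
    by (cases "n = 0") (auto simp: of_l1_def coord_to_l1 l1w_def)
qed

lemma to_of_l1 [simp]: "to_l1 p (of_l1 p x) = x"
  by (rule l1_eqI) (simp add: coord_to_l1 wgt_mult_of_l1)

lemma wnorm_eq_norm: "f \<in> l1w p \<Longrightarrow> wnorm p f = norm (to_l1 p f)"
  by (simp add: wnorm_def norm_l1_def coord_to_l1 abs_mult)

lemma l1w_lincomb:
  assumes "f \<in> l1w p" "g \<in> l1w p"
  shows "(\<lambda>n. x * f n + y * g n) \<in> l1w p"
    and "to_l1 p (\<lambda>n. x * f n + y * g n) = x *\<^sub>R to_l1 p f + y *\<^sub>R to_l1 p g"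
proof -
  have "of_l1 p (x *\<^sub>R to_l1 p f + y *\<^sub>R to_l1 p g) = (\<lambda>n. x * f n + y * g n)"
    unfolding of_l1_def using assms
    by (intro ext) (metis (no_types, lifting) coord_simps(2,5) of_to_l1 of_l1_def add_divide_distrib times_divide_eq_right)
  then show "(\<lambda>n. x * f n + y * g n) \<in> l1w p"
    and "to_l1 p (\<lambda>n. x * f n + y * g n) = x *\<^sub>R to_l1 p f + y *\<^sub>R to_l1 p g"
    by (metis of_l1_mem, metis to_of_l1)
qed

lemma l1w_diff:
  assumes "f \<in> l1w p" "g \<in> l1w p"
  shows "(\<lambda>n. f n - g n) \<in> l1w p" "to_l1 p (\<lambda>n. f n - g n) = to_l1 p f - to_l1 p g"
  using l1w_lincomb[OF assms, of 1 "-1"] by simp_all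

lemma of_l1_lincomb: "of_l1 p (x *\<^sub>R u + y *\<^sub>R v) = (\<lambda>n. x * of_l1 p u n + y * of_l1 p v n)"
  by (simp add: of_l1_def fun_eq_iff add_divide_distrib)

lemma wnorm_diff_eq_norm:
  "f \<in> l1w p \<Longrightarrow> g \<in> l1w p \<Longrightarrow> wnorm p (\<lambda>n. f n - g n) = norm (to_l1 p f - to_l1 p g)"
  by (simp add: wnorm_eq_norm l1w_diff)

section \<open>The fragmentation semigroup\<close>

lemma pos_part_norm_tendsto:
  assumes \<theta>: "\<And>n. 0 \<le> \<theta> n" "\<And>n. \<theta> n \<le> 1" and X: "(X \<longlongrightarrow> x) F"
  shows "((\<lambda>k. pos_part_norm \<theta> (X k)) \<longlongrightarrow> pos_part_norm \<theta> x) F"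
proof -
  have "((\<lambda>k. pos_part_norm \<theta> (X k) - pos_part_norm \<theta> x) \<longlongrightarrow> 0) F"
  proof (rule Lim_null_comparison)
    show "((\<lambda>k. norm (X k - x)) \<longlongrightarrow> 0) F" using X by (simp add: LIM_zero_iff tendsto_norm_zero)
    have "norm (pos_part_norm \<theta> (X k) - pos_part_norm \<theta> x) \<le> norm (X k - x)" for k
      using pos_part_norm_add_le[of \<theta>, OF \<theta>, of x "X k - x"] pos_part_norm_add_le[of \<theta>, OF \<theta>, of "X k" "x - X k"]
      by (simp add: abs_le_iff norm_minus_commute)
    then show "eventually (\<lambda>k. norm (pos_part_norm \<theta> (X k) - pos_part_norm \<theta> x) \<le> norm (X k - x)) F"
      by simp
  qed
  then show ?thesis by (simp add: LIM_zero_iff)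
qed

locale fragmentation =
  fixes p :: real and a :: "nat \<Rightarrow> real" and b :: "nat \<Rightarrow> nat \<Rightarrow> real"
  assumes a_nonneg: "1 \<le> n \<Longrightarrow> 0 \<le> a n"
    and b_nonneg: "1 \<le> n \<Longrightarrow> 1 \<le> j \<Longrightarrow> 0 \<le> b n j"
    and b_zero: "1 \<le> n \<Longrightarrow> 1 \<le> j \<Longrightarrow> j \<le> n \<Longrightarrow> b n j = 0"
    and b_wgt: "2 \<le> j \<Longrightarrow> (\<Sum>n=1..j-1. wgt p n * b n j) \<le> wgt p j"
begin

lemma ABop_mem: "f \<in> domAB p a b \<Longrightarrow> ABop a b f \<in> l1w p"
  using l1w_lincomb(1)[of "Aop a f" p "Bop a b f" 1 1] by (simp add: domAB_def ABop_def[abs_def])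

text \<open>Where f is positive, passing from f to f - l (A + B) f adds back the loss a_n f_n and
  subtracts at most the gain produced by the positive part of f. Summed with the weights
  \<open>v\<close>, the column condition bounds this gain by the loss, separately for each parent
  size j. Membership of A f in the space makes the weighted loss, and with it the double sum,
  finite.\<close>

lemma ABop_dissipative:
  assumes \<theta>: "\<And>n. 0 \<le> \<theta> n" "\<And>n. \<theta> n \<le> 1"
    and sub: "\<And>j. 2 \<le> j \<Longrightarrow> (\<Sum>n=1..j-1. \<theta> n * wgt p n * b n j) \<le> \<theta> j * wgt p j"
    and f: "f \<in> domAB p a b" and l: "0 < l"
  shows "pos_part_norm \<theta> (to_l1 p f) \<le> pos_part_norm \<theta> (to_l1 p f - l *\<^sub>R to_l1 p (ABop a b f))"
proof -
  define v where "v n = \<theta> n * wgt p n" for n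
  define \<alpha> where "\<alpha> j = a j * max (f j) 0" for j
  define Bp where "Bp n = (\<Sum>j. b n j * \<alpha> j)" for n
  have fl: "f \<in> l1w p" "f 0 = 0" "Aop a f \<in> l1w p"
    and row: "\<And>n. 1 \<le> n \<Longrightarrow> summable (\<lambda>i. a (n + 1 + i) * b n (n + 1 + i) * f (n + 1 + i))"
    using f by (auto simp: domAB_def l1w_def)
  have v: "0 \<le> v n" "v n \<le> wgt p n" "v 0 = 0" for n
    using \<theta> by (auto simp: v_def mult_left_le_one_le)
  have \<alpha>0: "\<alpha> 0 = 0" by (simp add: \<alpha>_def fl)
  have \<alpha>nn: "0 \<le> \<alpha> j" for j using a_nonneg[of j] \<alpha>0 by (cases "j = 0") (auto simp: \<alpha>_def)
  have s\<alpha>: "summable (\<lambda>j. wgt p j * \<alpha> j)"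
  proof (rule summable_comparison_test'[of "\<lambda>j. wgt p j * \<bar>Aop a f j\<bar>" 0])
    show "summable (\<lambda>j. wgt p j * \<bar>Aop a f j\<bar>)" using fl(3) by (simp add: l1w_def)
    fix j
    have "\<alpha> j \<le> \<bar>Aop a f j\<bar>"
      using a_nonneg[of j] fl(2) by (cases "j = 0") (auto simp: \<alpha>_def Aop_def abs_mult intro!: mult_left_mono)
    then show "norm (wgt p j * \<alpha> j) \<le> wgt p j * \<bar>Aop a f j\<bar>"
      using \<alpha>nn[of j] by (simp add: abs_mult mult_left_mono)
  qed
  have sv\<alpha>: "summable (\<lambda>j. v j * \<alpha> j)"
    by (rule summable_comparison_test'[OF s\<alpha>, of 0]) (use v \<alpha>nn in \<open>auto simp: abs_mult intro!: mult_right_mono\<close>)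
  have b\<alpha>nn: "0 \<le> b n j * \<alpha> j" if "1 \<le> n" for n j
    using b_nonneg[OF that, of j] \<alpha>0 \<alpha>nn[of j] by (cases "j = 0") auto
  \<comment> \<open>One entry of a column is at most the column sum. This makes the rows of the gain
    summable against \<open>\<alpha>\<close>.\<close>
  have b_le: "wgt p n * b n j \<le> wgt p j" if "1 \<le> n" "1 \<le> j" for n j
  proof (cases "n < j")
    case True
    have "wgt p n * b n j \<le> (\<Sum>n=1..j-1. wgt p n * b n j)"
      using that True b_nonneg by (intro member_le_sum) auto
    then show ?thesis using b_wgt[of j] that True by simp
  qed (use b_zero that in auto)
  have sb: "summable (\<lambda>j. b n j * \<alpha> j)" if n: "1 \<le> n" for n
  proof (rule summable_comparison_test'[OF summable_divide[OF s\<alpha>, of "wgt p n"], of 0])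
    fix j
    have "wgt p n * (b n j * \<alpha> j) \<le> wgt p j * \<alpha> j"
      using b_le[OF n, of j] \<alpha>nn[of j] \<alpha>0 by (cases "j = 0") (auto simp: mult_right_mono simp flip: mult.assoc)
    then show "norm (b n j * \<alpha> j) \<le> wgt p j * \<alpha> j / wgt p n"
      using b\<alpha>nn[OF n, of j] wgt_pos[of n p] n by (simp add: field_simps)
  qed
  have svb: "summable (\<lambda>j. v n * (b n j * \<alpha> j))" for n
    using sb[of n] v(3) by (cases "n = 0") (auto intro: summable_mult)
  have Bop_le: "Bop a b f n \<le> Bp n" if n: "1 \<le> n" for n
  proof -
    have "Bop a b f n = (\<Sum>i. a (n + 1 + i) * b n (n + 1 + i) * f (n + 1 + i))" using n by (simp add: Bop_def)
    also have "\<dots> \<le> (\<Sum>i. b n (i + (n + 1)) * \<alpha> (i + (n + 1)))"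
    proof (rule suminf_le[OF _ row[OF n] summable_ignore_initial_segment[OF sb[OF n]]])
      fix i
      have "a (n + 1 + i) * b n (n + 1 + i) * f (n + 1 + i) \<le> a (n + 1 + i) * b n (n + 1 + i) * max (f (n + 1 + i)) 0"
        using a_nonneg b_nonneg n by (intro mult_left_mono) auto
      then show "a (n + 1 + i) * b n (n + 1 + i) * f (n + 1 + i) \<le> b n (i + (n + 1)) * \<alpha> (i + (n + 1))"
        by (simp add: \<alpha>_def mult_ac add_ac)
    qed
    also have "\<dots> = Bp n"
    proof -
      have "(\<Sum>j<n + 1. b n j * \<alpha> j) = 0"
      proof (intro sum.neutral ballI)
        fix j assume "j \<in> {..<n + 1}"
        then show "b n j * \<alpha> j = 0" using b_zero[OF n, of j] \<alpha>0 by (cases "j = 0") auto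
      qed
      then show ?thesis unfolding Bp_def using suminf_split_initial_segment[OF sb[OF n], of "n + 1"] by simp
    qed
    finally show ?thesis .
  qed
  have col: "(\<Sum>n\<le>m. v n * b n j) * \<alpha> j \<le> v j * \<alpha> j" for m j
  proof (cases "j = 0")
    case False
    have "(\<Sum>n\<le>m. v n * b n j) = (\<Sum>n\<in>{..m} \<inter> {1..j-1}. v n * b n j)"
    proof (intro sum.mono_neutral_right ballI)
      fix n assume n: "n \<in> {..m} - {..m} \<inter> {1..j-1}"
      show "v n * b n j = 0"
      proof (cases "n = 0")
        case n0: False
        then have "j \<le> n" using n False by auto
        then show ?thesis using b_zero[of n j] n0 False by simp
      qed (simp add: v)
    qed auto
    also have "\<dots> \<le> (\<Sum>n=1..j-1. v n * b n j)"
      using b_nonneg v False by (intro sum_mono2) auto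
    also have "\<dots> \<le> v j"
    proof (cases "j = 1")
      case True then show ?thesis using v by simp
    next
      case neq: False
      then show ?thesis using sub[of j] False by (simp add: v_def)
    qed
    finally show ?thesis using \<alpha>nn[of j] by (intro mult_right_mono) auto
  qed (simp add: \<alpha>0)
  have dbl: "(\<Sum>n\<le>m. v n * Bp n) \<le> (\<Sum>j. v j * \<alpha> j)" for m
  proof -
    have "v n * Bp n = (\<Sum>j. v n * (b n j * \<alpha> j))" for n
      using sb[of n] v(3) by (cases "n = 0") (auto simp: Bp_def suminf_mult)
    then have "(\<Sum>n\<le>m. v n * Bp n) = (\<Sum>j. \<Sum>n\<le>m. v n * (b n j * \<alpha> j))"
      using svb by (simp add: suminf_sum)
    also have "\<dots> \<le> (\<Sum>j. v j * \<alpha> j)"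
      using col by (intro suminf_le summable_sum svb sv\<alpha>) (simp add: sum_distrib_right mult.assoc)
    finally show ?thesis .
  qed
  let ?x = "to_l1 p f" and ?y = "to_l1 p f - l *\<^sub>R to_l1 p (ABop a b f)"
  have ptw: "\<theta> n * max (coord ?x n) 0 \<le> \<theta> n * max (coord ?y n) 0 + l * (v n * Bp n - v n * \<alpha> n)" for n
  proof (cases "n = 0")
    case False
    define g where "g = ABop a b f n"
    have g: "g = - a n * f n + Bop a b f n" using False by (simp add: g_def ABop_def Aop_def)
    have Bpn: "0 \<le> Bp n" unfolding Bp_def using False by (intro suminf_nonneg sb b\<alpha>nn) auto
    \<comment> \<open>If f n \<le> 0, the left side and the loss \<open>\<alpha> n\<close> vanish
      and \<open>Bp n\<close> is nonnegative; if f n > 0, the entry \<open>g\<close> of (A + B) f is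
      at most \<open>Bp n - \<alpha> n\<close>.\<close>
    have key: "max (f n) 0 \<le> max (f n - l * g) 0 + l * (Bp n - \<alpha> n)"
    proof (cases "0 < f n")
      case True
      have "g \<le> Bp n - \<alpha> n" using g Bop_le[of n] False True by (simp add: \<alpha>_def)
      then have "l * g \<le> l * (Bp n - \<alpha> n)" using l by simp
      then show ?thesis using True by linarith
    next
      case neg: False
      then have "\<alpha> n = 0" by (simp add: \<alpha>_def)
      then show ?thesis using neg Bpn l by (simp add: max_def)
    qed
    have wm: "wgt p n * max x 0 = max (wgt p n * x) 0" for x by (simp add: max_mult_distrib_left)
    have "v n * max (f n) 0 \<le> v n * (max (f n - l * g) 0 + l * (Bp n - \<alpha> n))"
      using key v by (intro mult_left_mono) auto
    then show ?thesis
      using fl(1) ABop_mem[OF f] wm[of "f n"] wm[of "f n - l * g"]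
      by (simp add: coord_to_l1 v_def g_def[symmetric] algebra_simps)
  qed (simp add: v)
  \<comment> \<open>The difference of two equal series is kept on purpose: partial sums of the gain
    are bounded by the total loss, from which partial sums of the loss are subtracted, and only in
    the limit does this remainder disappear.\<close>
  have "pos_part_norm \<theta> ?x \<le> pos_part_norm \<theta> ?y + l * ((\<Sum>j. v j * \<alpha> j) - (\<Sum>j. v j * \<alpha> j))"
    unfolding pos_part_norm_def
  proof (rule LIMSEQ_le)
    show "(\<lambda>m. \<Sum>n\<le>m. \<theta> n * max (coord ?x n) 0) \<longlonglongrightarrow> (\<Sum>n. \<theta> n * max (coord ?x n) 0)"
      by (rule summable_LIMSEQ'[OF summable_pos_part[of \<theta>, OF \<theta>]])
    show "(\<lambda>m. (\<Sum>n\<le>m. \<theta> n * max (coord ?y n) 0) + l * ((\<Sum>j. v j * \<alpha> j) - (\<Sum>n\<le>m. v n * \<alpha> n)))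
        \<longlonglongrightarrow> (\<Sum>n. \<theta> n * max (coord ?y n) 0) + l * ((\<Sum>j. v j * \<alpha> j) - (\<Sum>j. v j * \<alpha> j))"
      by (intro tendsto_intros summable_LIMSEQ' summable_pos_part \<theta> sv\<alpha>)
    have "(\<Sum>n\<le>m. \<theta> n * max (coord ?x n) 0) \<le> (\<Sum>n\<le>m. \<theta> n * max (coord ?y n) 0) + l * ((\<Sum>j. v j * \<alpha> j) - (\<Sum>n\<le>m. v n * \<alpha> n))" for m
    proof -
      have "(\<Sum>n\<le>m. \<theta> n * max (coord ?x n) 0) \<le> (\<Sum>n\<le>m. \<theta> n * max (coord ?y n) 0 + l * (v n * Bp n - v n * \<alpha> n))"
        by (intro sum_mono ptw)
      also have "\<dots> = (\<Sum>n\<le>m. \<theta> n * max (coord ?y n) 0) + l * ((\<Sum>n\<le>m. v n * Bp n) - (\<Sum>n\<le>m. v n * \<alpha> n))"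
        by (simp add: sum.distrib sum_distrib_left sum_subtractf right_diff_distrib)
      also have "\<dots> \<le> (\<Sum>n\<le>m. \<theta> n * max (coord ?y n) 0) + l * ((\<Sum>j. v j * \<alpha> j) - (\<Sum>n\<le>m. v n * \<alpha> n))"
        using dbl[of m] l by (intro add_left_mono mult_left_mono) auto
      finally show ?thesis .
    qed
    then show "\<exists>N. \<forall>m\<ge>N. (\<Sum>n\<le>m. \<theta> n * max (coord ?x n) 0) \<le> (\<Sum>n\<le>m. \<theta> n * max (coord ?y n) 0) + l * ((\<Sum>j. v j * \<alpha> j) - (\<Sum>n\<le>m. v n * \<alpha> n))"
      by blast
  qed
  then show ?thesis by simp
qed

lemma Gw_dissipative:
  assumes \<theta>: "\<And>n. 0 \<le> \<theta> n" "\<And>n. \<theta> n \<le> 1"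
    and sub: "\<And>j. 2 \<le> j \<Longrightarrow> (\<Sum>n=1..j-1. \<theta> n * wgt p n * b n j) \<le> \<theta> j * wgt p j"
    and G: "Gw_rel p a b f g" and l: "0 < l"
  shows "pos_part_norm \<theta> (to_l1 p f) \<le> pos_part_norm \<theta> (to_l1 p f - l *\<^sub>R to_l1 p g)"
proof -
  obtain fs where fg: "f \<in> l1w p" "g \<in> l1w p" and fs: "\<And>k. fs k \<in> domAB p a b"
    "(\<lambda>k. wnorm p (\<lambda>n. fs k n - f n)) \<longlonglongrightarrow> 0"
    "(\<lambda>k. wnorm p (\<lambda>n. ABop a b (fs k) n - g n)) \<longlonglongrightarrow> 0"
    using G unfolding Gw_rel_def by blast
  have fl: "fs k \<in> l1w p" for k using fs(1) by (simp add: domAB_def)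
  have 1: "(\<lambda>k. to_l1 p (fs k)) \<longlonglongrightarrow> to_l1 p f"
    using fs(2) fl fg by (simp add: wnorm_diff_eq_norm tendsto_norm_zero_iff LIM_zero_iff)
  have 2: "(\<lambda>k. to_l1 p (ABop a b (fs k))) \<longlonglongrightarrow> to_l1 p g"
    using fs(3) ABop_mem[OF fs(1)] fg by (simp add: wnorm_diff_eq_norm tendsto_norm_zero_iff LIM_zero_iff)
  show ?thesis
    by (rule LIMSEQ_le[OF pos_part_norm_tendsto[of \<theta>, OF \<theta> 1]
          pos_part_norm_tendsto[of \<theta>, OF \<theta> tendsto_diff[OF 1 tendsto_scaleR[OF tendsto_const 2]]]])
       (use ABop_dissipative[of \<theta>, OF \<theta> sub fs(1) l] in auto)
qed

text \<open>Fragments are smaller than the parent, so the gain of a sequence that vanishes from m on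
  vanishes there as well, whatever the growth of a. These sequences make the generator densely
  defined.\<close>

lemma finite_support_mem_domAB:
  assumes "f 0 = 0" "\<And>n. m \<le> n \<Longrightarrow> f n = 0"
  shows "f \<in> domAB p a b"
proof -
  have l: "g \<in> l1w p" if "g 0 = 0" "\<And>n. m \<le> n \<Longrightarrow> g n = 0" for g
    using that by (auto simp: l1w_def intro!: summable_finite[of "{..<m}"]) (meson not_le)
  have "Bop a b f n = 0" if "m \<le> n" for n
    unfolding Bop_def using assms(2) that by simp
  moreover have "summable (\<lambda>i. a (n + 1 + i) * b n (n + 1 + i) * f (n + 1 + i))" for n
    using assms(2)[of "n + 1 + _"] by (intro summable_finite[of "{..<m}"]) auto
  ultimately show ?thesis
    using assms unfolding domAB_def by (auto intro!: l simp: Aop_def Bop_def)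
qed

end

lemma l1_truncation_dense:
  assumes "0 < e"
  obtains m y where "norm (x - y) < e" "\<And>n. coord y n = (if n < m then coord x n else 0)"
proof -
  have "(\<lambda>m. (\<Sum>n<m. \<bar>coord x n\<bar>)) \<longlonglongrightarrow> norm x"
    unfolding norm_l1_def by (rule summable_LIMSEQ[OF summable_coord])
  from LIMSEQ_D[OF this assms] obtain m where m: "\<bar>(\<Sum>n<m. \<bar>coord x n\<bar>) - norm x\<bar> < e"
    by auto
  define y where "y = Abs_l1 (\<lambda>n. if n < m then coord x n else 0)"
  have y: "coord y n = (if n < m then coord x n else 0)" for n
    unfolding y_def by (subst Abs_l1_inverse) (auto intro!: summable_finite[of "{..<m}"] split: if_splits)
  have "norm (x - y) \<le> norm x - (\<Sum>n<m. \<bar>coord x n\<bar>)"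
  proof (rule norm_l1_leI)
    fix k
    have "(\<Sum>n<k. \<bar>coord (x - y) n\<bar>) = (\<Sum>n\<in>{..<k} - {..<m}. \<bar>coord x n\<bar>)"
      by (rule sum.mono_neutral_cong_right) (auto simp: y)
    moreover have "(\<Sum>n\<in>{..<k} - {..<m}. \<bar>coord x n\<bar>) + (\<Sum>n<m. \<bar>coord x n\<bar>) = (\<Sum>n\<in>({..<k} - {..<m}) \<union> {..<m}. \<bar>coord x n\<bar>)"
      by (rule sum.union_disjoint[symmetric]) auto
    ultimately show "(\<Sum>n<k. \<bar>coord (x - y) n\<bar>) \<le> norm x - (\<Sum>n<m. \<bar>coord x n\<bar>)"
      using sum_coord_le_norm[of "({..<k} - {..<m}) \<union> {..<m}" x] by simp
  qed
  with m y that show ?thesis by (metis abs_minus_commute abs_ge_self le_less_trans order_trans)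
qed

locale fragmentation_semigroup = fragmentation +
  fixes S :: "real \<Rightarrow> (nat \<Rightarrow> real) \<Rightarrow> nat \<Rightarrow> real"
  assumes S_gen: "generated_by_Gw p a b S"
begin

definition U :: "real \<Rightarrow> l1 \<Rightarrow> l1" where
  "U t x = to_l1 p (S t (of_l1 p x))"

lemma C0: "C0_semigroup p S" using S_gen by (simp add: generated_by_Gw_def)

lemma S_mem: "0 \<le> t \<Longrightarrow> f \<in> l1w p \<Longrightarrow> S t f \<in> l1w p"
  using C0 by (simp add: C0_semigroup_def)

lemma of_l1_U: "0 \<le> t \<Longrightarrow> of_l1 p (U t x) = S t (of_l1 p x)"
  by (simp add: U_def S_mem)

sublocale strongly_continuous_semigroup U
proof (rule strongly_continuous_semigroup.intro)
  note C = C0[unfolded C0_semigroup_def]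
  fix t s :: real and x :: l1
  show "U 0 x = x" using C by (simp add: U_def)
  show "bounded_linear (U t)" if t: "0 \<le> t"
  proof -
    obtain M where M: "\<And>f. f \<in> l1w p \<Longrightarrow> wnorm p (S t f) \<le> M * wnorm p f" using C t by meson
    have lin: "U t (c *\<^sub>R u + d *\<^sub>R v) = c *\<^sub>R U t u + d *\<^sub>R U t v" for c d u v
    proof -
      have "S t (\<lambda>n. c * of_l1 p u n + d * of_l1 p v n) = (\<lambda>n. c * S t (of_l1 p u) n + d * S t (of_l1 p v) n)"
        using C t by simp
      then show ?thesis using t by (simp add: U_def of_l1_lincomb l1w_lincomb S_mem)
    qed
    show ?thesis
    proof (rule bounded_linear_intro[of _ M])
      show "U t (u + v) = U t u + U t v" for u v using lin[of 1 u 1 v] by simp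
      show "U t (c *\<^sub>R u) = c *\<^sub>R U t u" for c u using lin[of c u 0 0] by simp
      show "norm (U t u) \<le> norm u * M" for u
        using M[of "of_l1 p u"] t by (simp add: U_def wnorm_eq_norm S_mem mult.commute)
    qed
  qed
  show "U (s + t) x = U s (U t x)" if "0 \<le> s" "0 \<le> t"
    using C that by (simp add: U_def S_mem)
  have "((\<lambda>t. wnorm p (\<lambda>n. S t (of_l1 p x) n - of_l1 p x n)) \<longlongrightarrow> 0) (at_right 0)" using C by simp
  moreover have "eventually (\<lambda>t. wnorm p (\<lambda>n. S t (of_l1 p x) n - of_l1 p x n) = norm (U t x - x)) (at_right 0)"
    unfolding eventually_at_right_field
    by (rule exI[of _ 1]) (auto simp: wnorm_diff_eq_norm S_mem U_def)
  ultimately have "((\<lambda>t. norm (U t x - x)) \<longlongrightarrow> 0) (at_right 0)" by (blast intro: Lim_transform_eventually)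
  then show "((\<lambda>t. U t x) \<longlongrightarrow> x) (at_right 0)" by (simp add: tendsto_norm_zero_iff LIM_zero_iff)
qed

lemma has_generator_value_iff: "has_generator_value x g \<longleftrightarrow> Gw_rel p a b (of_l1 p x) (of_l1 p g)"
proof -
  have eq: "wnorm p (\<lambda>n. (S h (of_l1 p x) n - of_l1 p x n) / h - of_l1 p g n) = norm ((1/h) *\<^sub>R (U h x - x) - g)"
    if h: "0 < h" for h
  proof -
    have "(\<lambda>n. (S h (of_l1 p x) n - of_l1 p x n) / h - of_l1 p g n) = of_l1 p ((1/h) *\<^sub>R (U h x - x) - g)"
      using h by (simp add: of_l1_U[symmetric]) (simp add: of_l1_def fun_eq_iff diff_divide_distrib mult.commute)
    then show ?thesis by (simp add: wnorm_eq_norm)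
  qed
  have "eventually (\<lambda>h. wnorm p (\<lambda>n. (S h (of_l1 p x) n - of_l1 p x n) / h - of_l1 p g n) = norm ((1/h) *\<^sub>R (U h x - x) - g)) (at_right 0)"
    unfolding eventually_at_right_field by (rule exI[of _ 1]) (use eq in auto)
  from tendsto_cong[OF this] have "generator_rel p S (of_l1 p x) (of_l1 p g) \<longleftrightarrow> has_generator_value x g"
    by (simp add: generator_rel_def has_generator_value_def tendsto_norm_zero_iff LIM_zero_iff)
  then show ?thesis using S_gen by (simp add: generated_by_Gw_def)
qed

lemma generator_domain_dense:
  assumes "0 < e" shows "\<exists>y g. norm (x - y) < e \<and> has_generator_value y g"
proof -
  obtain m y where y: "norm (x - y) < e" "\<And>n. coord y n = (if n < m then coord x n else 0)"
    using l1_truncation_dense[OF assms] by blast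
  have d: "of_l1 p y \<in> domAB p a b"
    by (rule finite_support_mem_domAB[of _ m]) (auto simp: of_l1_def y)
  have "Gw_rel p a b (of_l1 p y) (ABop a b (of_l1 p y))"
    unfolding Gw_rel_def using d ABop_mem[OF d]
    by (auto intro!: exI[of _ "\<lambda>_. of_l1 p y"] simp: wnorm_def)
  then have "has_generator_value y (to_l1 p (ABop a b (of_l1 p y)))"
    using ABop_mem[OF d] by (simp add: has_generator_value_iff)
  with y show ?thesis by blast
qed

lemma pos_part_norm_U_le:
  assumes \<theta>: "\<And>n. 0 \<le> \<theta> n" "\<And>n. \<theta> n \<le> 1"
    and sub: "\<And>j. 2 \<le> j \<Longrightarrow> (\<Sum>n=1..j-1. \<theta> n * wgt p n * b n j) \<le> \<theta> j * wgt p j"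
    and t: "0 \<le> t"
  shows "pos_part_norm \<theta> (U t x) \<le> pos_part_norm \<theta> x"
proof (rule dissipative_functional_decreasing[OF pos_part_norm_add_le[of \<theta>, OF \<theta>] zero_le_one generator_domain_dense _ t])
  fix x g and l :: real assume "has_generator_value x g" "0 < l"
  then show "pos_part_norm \<theta> x \<le> pos_part_norm \<theta> (x - l *\<^sub>R g)"
    using Gw_dissipative[of \<theta>, OF \<theta> sub, of "of_l1 p x" "of_l1 p g" l] by (simp add: has_generator_value_iff)
qed

lemma pos_part_norm_one_U_le: "0 \<le> t \<Longrightarrow> pos_part_norm (\<lambda>_. 1) (U t x) \<le> pos_part_norm (\<lambda>_. 1) x"
  by (rule pos_part_norm_U_le) (use b_wgt in auto)

text \<open>Contractivity is no part of \<open>C0_semigroup\<close>; it comes from the decrease of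
  the positive-part norm at x and at - x.\<close>

sublocale contraction_semigroup U
proof
  fix t :: real and x assume t: "0 \<le> t"
  interpret Ut: bounded_linear "U t" by (rule linear[OF t])
  show "norm (U t x) \<le> norm x"
    using pos_part_norm_one_U_le[OF t, of x] pos_part_norm_one_U_le[OF t, of "- x"]
    by (simp add: norm_l1_eq_pos_parts linear_neg[OF bounded_linear.linear[OF linear[OF t]]])
qed

end

section \<open>The coagulation operator\<close>

lemma has_sum_product_nonneg:
  fixes f g :: "nat \<Rightarrow> real"
  assumes f: "f sums A" "\<And>n. 0 \<le> f n" and g: "g sums B" "\<And>n. 0 \<le> g n"
  shows "((\<lambda>z. f (fst z) * g (snd z)) has_sum A * B) UNIV"
proof -
  have hf: "(f has_sum A) UNIV" and hg: "(g has_sum B) UNIV"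
    using f g by (auto intro: sums_nonneg_imp_has_sum)
  have row: "((\<lambda>j. f n * g j) has_sum f n * B) UNIV" for n by (rule has_sum_cmult_right[OF hg])
  have col: "((\<lambda>n. f n * B) has_sum A * B) UNIV" by (rule has_sum_cmult_left[OF hf])
  have "(\<lambda>z. f (fst z) * g (snd z)) summable_on (UNIV \<times> UNIV)"
    by (rule summable_on_SigmaI[where g = "\<lambda>n. f n * B"])
       (use row col f g in \<open>auto intro: has_sum_imp_summable\<close>)
  then have "((\<lambda>z. f (fst z) * g (snd z)) has_sum A * B) (UNIV \<times> UNIV)"
    by (intro has_sum_SigmaI[where g = "\<lambda>n. f n * B"]) (use row col in auto)
  then show ?thesis by simp
qed

text \<open>Image under \<open>to_l1 p\<close> of the sequence that is 1 at n and 0 elsewhere; for n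
  = 0 it is the zero vector.\<close>

definition wgt_unit :: "real \<Rightarrow> nat \<Rightarrow> l1" where
  "wgt_unit p n = Abs_l1 (\<lambda>i. if i = n then wgt p n else 0)"

lemma coord_wgt_unit: "coord (wgt_unit p n) i = (if i = n then wgt p n else 0)"
  unfolding wgt_unit_def by (subst Abs_l1_inverse) (auto intro!: summable_finite[of "{n}"])

lemma norm_wgt_unit: "norm (wgt_unit p n) = wgt p n"
  unfolding norm_l1_def by (subst suminf_finite[of "{n}"]) (auto simp: coord_wgt_unit)

text \<open>Contribution of the ordered pair (n, j): half a cluster of size n + j appears and one of
  size n is lost. The loss of the cluster of size j is booked with the swapped pair, whence the
  asymmetry.\<close>

definition coag_term :: "real \<Rightarrow> (nat \<Rightarrow> nat \<Rightarrow> real) \<Rightarrow> l1 \<Rightarrow> l1 \<Rightarrow> nat \<times> nat \<Rightarrow> l1" where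
  "coag_term p q x y z = (q (fst z) (snd z) * of_l1 p x (fst z) * of_l1 p y (snd z)) *\<^sub>R
     ((1/2) *\<^sub>R wgt_unit p (fst z + snd z) - wgt_unit p (fst z))"

text \<open>An unconditional sum over all pairs, taken in the norm of \<open>l1\<close>: norm
  bounds, the bilinear expansion of differences and the action of linear functionals can all be read
  off term by term. The two arguments are separate for the sake of that expansion.\<close>

definition coag :: "real \<Rightarrow> (nat \<Rightarrow> nat \<Rightarrow> real) \<Rightarrow> l1 \<Rightarrow> l1 \<Rightarrow> l1" where
  "coag p q x y = (\<Sum>\<^sub>\<infinity>z. coag_term p q x y z)"

lemma of_l1_0 [simp]: "of_l1 p x 0 = 0"
  by (simp add: of_l1_def)

lemma norm_sums: "(\<lambda>n. \<bar>coord x n\<bar>) sums norm x"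
  unfolding norm_l1_def by (rule summable_sums[OF summable_coord])

lemma has_sum_norm_product: "((\<lambda>z. \<bar>coord x (fst z)\<bar> * \<bar>coord y (snd z)\<bar>) has_sum norm x * norm y) UNIV"
  by (rule has_sum_product_nonneg) (auto intro: norm_sums)

section \<open>Linear functionals with weights in [0, 1]\<close>

definition weighted_sum :: "(nat \<Rightarrow> real) \<Rightarrow> l1 \<Rightarrow> real" where
  "weighted_sum \<theta> x = (\<Sum>n. \<theta> n * coord x n)"

lemma bounded_linear_weighted_sum:
  assumes \<theta>: "\<And>n. 0 \<le> \<theta> n" "\<And>n. \<theta> n \<le> 1"
  shows "bounded_linear (weighted_sum \<theta>)"
proof (rule bounded_linear_intro[of _ 1])
  note s = summable_weighted_coord[of \<theta>, OF \<theta>]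
  show "weighted_sum \<theta> (x + y) = weighted_sum \<theta> x + weighted_sum \<theta> y" for x y
    unfolding weighted_sum_def by (simp add: distrib_left suminf_add[OF s s])
  show "weighted_sum \<theta> (r *\<^sub>R x) = r *\<^sub>R weighted_sum \<theta> x" for r x
    unfolding weighted_sum_def by (simp add: mult.left_commute suminf_mult[OF s])
  fix x
  have le: "\<bar>\<theta> n * coord x n\<bar> \<le> \<bar>coord x n\<bar>" for n
    using \<theta>[of n] by (simp add: abs_mult mult_left_le_one_le)
  have sa: "summable (\<lambda>n. \<bar>\<theta> n * coord x n\<bar>)"
    by (rule summable_comparison_test'[OF summable_coord[of x], of 0]) (use le in auto)
  have "\<bar>weighted_sum \<theta> x\<bar> \<le> (\<Sum>n. \<bar>\<theta> n * coord x n\<bar>)"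
    unfolding weighted_sum_def by (rule summable_rabs[OF sa])
  also have "\<dots> \<le> norm x"
    unfolding norm_l1_def by (rule suminf_le[OF le sa summable_coord])
  finally show "norm (weighted_sum \<theta> x) \<le> norm x * 1" by simp
qed

lemma weighted_sum_wgt_unit: "weighted_sum \<theta> (wgt_unit p n) = \<theta> n * wgt p n"
  unfolding weighted_sum_def by (subst suminf_finite[of "{n}"]) (auto simp: coord_wgt_unit)

text \<open>The kernel frozen at one instant; c is the constant of (CI), which serves for a whole
  compact time interval.\<close>

locale coagulation_kernel =
  fixes p c :: real and q :: "nat \<Rightarrow> nat \<Rightarrow> real"
  assumes p: "0 \<le> p" and c: "0 \<le> c"
    and q_nonneg: "1 \<le> n \<Longrightarrow> 1 \<le> j \<Longrightarrow> 0 \<le> q n j"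
    and q_sym: "1 \<le> n \<Longrightarrow> 1 \<le> j \<Longrightarrow> q n j = q j n"
    and q_bound: "1 \<le> n \<Longrightarrow> 1 \<le> j \<Longrightarrow> q n j \<le> c * wgt p n * wgt p j / wgt p (n + j)"
begin

lemma wgt_mono: "n \<le> m \<Longrightarrow> wgt p n \<le> wgt p m"
  using p by (simp add: wgt_def powr_mono2)

lemma q_wgt: "1 \<le> n \<Longrightarrow> 1 \<le> j \<Longrightarrow> q n j * wgt p (n + j) \<le> c * wgt p n * wgt p j"
  using q_bound[of n j] wgt_pos[of "n + j" p] by (simp add: field_simps)

lemma q_le_wgt:
  assumes "1 \<le> n" "1 \<le> j" shows "q n j \<le> c * wgt p j"
proof -
  have "q n j * wgt p n \<le> q n j * wgt p (n + j)"
    using q_nonneg assms by (intro mult_left_mono wgt_mono) auto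
  also have "\<dots> \<le> (c * wgt p j) * wgt p n" using q_wgt[OF assms] by (simp add: mult_ac)
  finally show ?thesis using wgt_pos[of n p] assms by simp
qed

text \<open>The gain costs half the weight of n + j and the loss at most that weight, hence 3/2.
  Then (CI) trades the weight of n + j for w_n w_j, exactly the weights that turn the sequences into
  coordinates.\<close>

lemma norm_coag_term_le:
  "norm (coag_term p q x y z) \<le> 3/2 * c * (\<bar>coord x (fst z)\<bar> * \<bar>coord y (snd z)\<bar>)"
proof (cases "fst z = 0 \<or> snd z = 0")
  case True
  then have "coag_term p q x y z = 0" by (auto simp: coag_term_def)
  then show ?thesis using c by simp
next
  case False
  obtain n j where z: "z = (n, j)" by (cases z)
  have nj: "1 \<le> n" "1 \<le> j" using False z by auto
  let ?f = "\<bar>of_l1 p x n\<bar>" and ?g = "\<bar>of_l1 p y j\<bar>"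
  have "norm ((1/2) *\<^sub>R wgt_unit p (n + j) - wgt_unit p n) \<le> 1/2 * wgt p (n + j) + wgt p n"
    by (rule order_trans[OF norm_triangle_ineq4]) (simp add: norm_wgt_unit)
  also have "\<dots> \<le> 3/2 * wgt p (n + j)" using wgt_mono[of n "n + j"] by simp
  finally have v: "norm ((1/2) *\<^sub>R wgt_unit p (n + j) - wgt_unit p n) \<le> 3/2 * wgt p (n + j)" .
  have "norm (coag_term p q x y z) = (q n j * ?f * ?g) * norm ((1/2) *\<^sub>R wgt_unit p (n + j) - wgt_unit p n)"
    using q_nonneg[OF nj] by (simp add: coag_term_def z abs_mult)
  also have "\<dots> \<le> (q n j * ?f * ?g) * (3/2 * wgt p (n + j))"
    using v q_nonneg[OF nj] by (intro mult_left_mono) auto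
  also have "\<dots> = 3/2 * (?f * ?g) * (q n j * wgt p (n + j))" by (simp add: mult_ac)
  also have "\<dots> \<le> 3/2 * (?f * ?g) * (c * wgt p n * wgt p j)"
    by (intro mult_left_mono q_wgt nj) auto
  also have "\<dots> = 3/2 * c * (\<bar>wgt p n * of_l1 p x n\<bar> * \<bar>wgt p j * of_l1 p y j\<bar>)"
    by (simp add: abs_mult)
  finally show ?thesis by (simp add: wgt_mult_of_l1 z)
qed

lemma coag_has_sum: "(coag_term p q x y has_sum coag p q x y) UNIV"
proof -
  have "(\<lambda>z. 3/2 * c * (\<bar>coord x (fst z)\<bar> * \<bar>coord y (snd z)\<bar>)) summable_on UNIV"
    by (rule has_sum_imp_summable[OF has_sum_cmult_right[OF has_sum_norm_product]])
  then have "coag_term p q x y abs_summable_on UNIV"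
    by (rule Infinite_Sum.abs_summable_on_comparison_test') (rule norm_coag_term_le)
  then show ?thesis unfolding coag_def by (rule has_sum_infsum[OF abs_summable_summable])
qed

lemma norm_coag_le: "norm (coag p q x y) \<le> 3/2 * c * (norm x * norm y)"
  by (rule norm_infsum_le[OF coag_has_sum has_sum_cmult_right[OF has_sum_norm_product]])
     (rule norm_coag_term_le)

lemma coag_diff: "coag p q x x - coag p q y y = coag p q (x - y) x + coag p q y (x - y)"
proof -
  have "((\<lambda>z. coag_term p q x x z + - coag_term p q y y z) has_sum coag p q x x + - coag p q y y) UNIV"
    by (intro has_sum_add coag_has_sum has_sum_uminus[THEN iffD2]) (simp add: coag_has_sum)
  moreover have "(\<lambda>z. coag_term p q x x z + - coag_term p q y y z) = (\<lambda>z. coag_term p q (x - y) x z + coag_term p q y (x - y) z)"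
    unfolding coag_term_def of_l1_def by (simp add: fun_eq_iff diff_divide_distrib algebra_simps flip: scaleR_add_left scaleR_diff_left)
  moreover have "((\<lambda>z. coag_term p q (x - y) x z + coag_term p q y (x - y) z) has_sum coag p q (x - y) x + coag p q y (x - y)) UNIV"
    by (intro has_sum_add coag_has_sum)
  ultimately show ?thesis by (metis (no_types, lifting) has_sum_unique diff_conv_add_uminus)
qed

lemma norm_coag_diff_le: "norm (coag p q x x - coag p q y y) \<le> 3/2 * c * (norm x + norm y) * norm (x - y)"
proof -
  have "norm (coag p q x x - coag p q y y) \<le> norm (coag p q (x - y) x) + norm (coag p q y (x - y))"
    unfolding coag_diff by (rule norm_triangle_ineq)
  also have "\<dots> \<le> 3/2 * c * (norm (x - y) * norm x) + 3/2 * c * (norm y * norm (x - y))"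
    by (intro add_mono norm_coag_le)
  finally show ?thesis by (simp add: algebra_simps)
qed

lemma loss_summable:
  assumes "1 \<le> m"
  shows "summable (\<lambda>j. q m j * of_l1 p x m * of_l1 p x j)"
    and "summable (\<lambda>j. \<bar>q m j * of_l1 p x m * of_l1 p x j\<bar>)"
proof -
  show "summable (\<lambda>j. \<bar>q m j * of_l1 p x m * of_l1 p x j\<bar>)"
  proof (rule summable_comparison_test'[OF summable_mult[OF summable_coord[of x]], of 0 _ "c * \<bar>of_l1 p x m\<bar>"])
    fix j
    show "norm \<bar>q m j * of_l1 p x m * of_l1 p x j\<bar> \<le> c * \<bar>of_l1 p x m\<bar> * \<bar>coord x j\<bar>"
    proof (cases "j = 0")
      case False
      have "\<bar>q m j\<bar> * (\<bar>of_l1 p x m\<bar> * \<bar>of_l1 p x j\<bar>) \<le> (c * wgt p j) * (\<bar>of_l1 p x m\<bar> * \<bar>of_l1 p x j\<bar>)"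
        using q_le_wgt[OF assms, of j] q_nonneg[OF assms, of j] False by (intro mult_right_mono) auto
      then show ?thesis unfolding wgt_mult_of_l1[of p j x, symmetric] by (simp add: abs_mult mult_ac)
    qed simp
  qed
  then show "summable (\<lambda>j. q m j * of_l1 p x m * of_l1 p x j)" by (rule summable_rabs_cancel)
qed

text \<open>The coordinate m picks the antidiagonal n + j = m from the gain and the row n = m from
  the loss. Pairs containing 0 contribute nothing, as \<open>of_l1\<close> vanishes at 0, so the
  ends of the antidiagonal may be dropped.\<close>

lemma coord_coag:
  "coord (coag p q x x) m = wgt p m * (if m = 0 then 0 else
      (1/2) * (\<Sum>j=1..m-1. q (m - j) j * of_l1 p x (m - j) * of_l1 p x j)
      - (\<Sum>j. q m j * of_l1 p x m * of_l1 p x j))"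
proof (cases "m = 0")
  case False
  let ?f = "of_l1 p x"
  let ?t = "\<lambda>z. q (fst z) (snd z) * ?f (fst z) * ?f (snd z)"
  have 1: "((\<lambda>z. coord (coag_term p q x x z) m) has_sum coord (coag p q x x) m) UNIV"
    by (rule has_sum_bounded_linear[OF bounded_linear_coord coag_has_sum])
  have gain: "((\<lambda>z. if fst z + snd z = m then ?t z else 0) has_sum (\<Sum>j=1..m-1. q (m - j) j * ?f (m - j) * ?f j)) UNIV"
  proof (rule has_sum_finite_neutralI[of "(\<lambda>j. (m - j, j)) ` {..m}"])
    have "(\<Sum>z\<in>(\<lambda>j. (m - j, j)) ` {..m}. if fst z + snd z = m then ?t z else 0) = (\<Sum>j\<le>m. q (m - j) j * ?f (m - j) * ?f j)"
      by (subst sum.reindex) (auto simp: inj_on_def)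
    also have "\<dots> = (\<Sum>j=1..m-1. q (m - j) j * ?f (m - j) * ?f j)"
    proof (rule sum.mono_neutral_right)
      show "\<forall>j\<in>{..m} - {1..m - 1}. q (m - j) j * ?f (m - j) * ?f j = 0"
      proof
        fix j assume "j \<in> {..m} - {1..m - 1}"
        then have "j = 0 \<or> m - j = 0" by auto
        then show "q (m - j) j * ?f (m - j) * ?f j = 0" by auto
      qed
    qed auto
    finally show "(\<Sum>j=1..m-1. q (m - j) j * ?f (m - j) * ?f j) = (\<Sum>z\<in>(\<lambda>j. (m - j, j)) ` {..m}. if fst z + snd z = m then ?t z else 0)" by simp
    fix z :: "nat \<times> nat" assume z: "z \<in> UNIV - (\<lambda>j. (m - j, j)) ` {..m}"
    have "fst z + snd z \<noteq> m"
    proof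
      assume "fst z + snd z = m"
      then have "z = (m - snd z, snd z)" "snd z \<in> {..m}" by (auto simp: prod_eq_iff)
      with z show False by blast
    qed
    then show "(if fst z + snd z = m then ?t z else 0) = 0" by simp
  qed auto
  have "((\<lambda>j. q m j * ?f m * ?f j) has_sum (\<Sum>j. q m j * ?f m * ?f j)) UNIV"
    using loss_summable[of m x] False by (intro norm_summable_imp_has_sum summable_sums) auto
  then have "(?t has_sum (\<Sum>j. q m j * ?f m * ?f j)) (range (\<lambda>j. (m, j)))"
    by (subst has_sum_reindex) (auto simp: inj_on_def o_def)
  then have loss: "((\<lambda>z. if fst z = m then ?t z else 0) has_sum (\<Sum>j. q m j * ?f m * ?f j)) UNIV"
    by (rule has_sum_cong_neutral[THEN iffD1, rotated -1]) (auto simp: image_iff)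
  have 2: "((\<lambda>z. wgt p m * ((1/2) * (if fst z + snd z = m then ?t z else 0) + - (if fst z = m then ?t z else 0)))
      has_sum wgt p m * ((1/2) * (\<Sum>j=1..m-1. q (m - j) j * ?f (m - j) * ?f j) + - (\<Sum>j. q m j * ?f m * ?f j))) UNIV"
    by (intro has_sum_cmult_right has_sum_add gain has_sum_uminus[THEN iffD2]) (simp add: loss)
  have "(\<lambda>z. coord (coag_term p q x x z) m) = (\<lambda>z. wgt p m * ((1/2) * (if fst z + snd z = m then ?t z else 0) + - (if fst z = m then ?t z else 0)))"
    by (auto simp: fun_eq_iff coag_term_def coord_wgt_unit algebra_simps)
  with 1 2 have "coord (coag p q x x) m = wgt p m * ((1/2) * (\<Sum>j=1..m-1. q (m - j) j * ?f (m - j) * ?f j) + - (\<Sum>j. q m j * ?f m * ?f j))"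
    by (metis (no_types, lifting) has_sum_unique)
  then show ?thesis using False by simp
qed simp

text \<open>Only the loss can cause a negative entry, and by q m j \<le> c w_j it removes at most
  the fraction h c \<open>norm x\<close> of entry m.\<close>

lemma add_coag_nonneg:
  assumes x: "\<And>n. 0 \<le> coord x n" and h: "0 \<le> h" "h * (c * norm x) \<le> 1"
  shows "0 \<le> coord (x + h *\<^sub>R coag p q x x) m"
proof (cases "m = 0")
  case False
  let ?f = "of_l1 p x"
  have f: "0 \<le> ?f n" for n using x[of n] by (simp add: of_l1_def)
  have m: "1 \<le> m" using False by simp
  have "(\<Sum>j. q m j * ?f m * ?f j) \<le> (\<Sum>j. c * ?f m * \<bar>coord x j\<bar>)"
  proof (rule suminf_le[OF _ loss_summable(1)[OF m] summable_mult[OF summable_coord]])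
    fix j
    show "q m j * ?f m * ?f j \<le> c * ?f m * \<bar>coord x j\<bar>"
    proof (cases "j = 0")
      case False
      have "q m j * (?f m * ?f j) \<le> (c * wgt p j) * (?f m * ?f j)"
        using q_le_wgt[OF m, of j] f False by (intro mult_right_mono) auto
      then show ?thesis using x[of j] unfolding wgt_mult_of_l1[of p j x, symmetric] by (simp add: mult_ac f)
    qed simp
  qed
  also have "\<dots> = c * norm x * ?f m" by (simp add: suminf_mult[OF summable_coord] norm_l1_def)
  finally have "h * (\<Sum>j. q m j * ?f m * ?f j) \<le> h * (c * norm x) * ?f m"
    using h(1) by (metis mult.assoc mult_left_mono)
  also have "\<dots> \<le> 1 * ?f m" using h f by (intro mult_right_mono) auto
  finally have loss: "h * (\<Sum>j. q m j * ?f m * ?f j) \<le> ?f m" by simp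
  have "0 \<le> (\<Sum>j=1..m-1. q (m - j) j * ?f (m - j) * ?f j)"
    using f q_nonneg by (intro sum_nonneg mult_nonneg_nonneg) auto
  then have "0 \<le> h * ((1/2) * (\<Sum>j=1..m-1. q (m - j) j * ?f (m - j) * ?f j))"
    using h(1) by simp
  with loss have "0 \<le> wgt p m * (?f m + h * ((1/2) * (\<Sum>j=1..m-1. q (m - j) j * ?f (m - j) * ?f j)
      - (\<Sum>j. q m j * ?f m * ?f j)))"
    by (intro mult_nonneg_nonneg) (auto simp: right_diff_distrib)
  also have "\<dots> = coord (x + h *\<^sub>R coag p q x x) m"
    using False by (simp add: coord_coag distrib_left wgt_mult_of_l1 mult.left_commute)
  finally show ?thesis .
qed simp

text \<open>Since \<open>x\<^sup>+ + h K(x\<^sup>+) \<ge> 0\<close> for small \<open>h\<close>, only \<open>x\<^sup>-\<close> and the Lipschitz error \<open>K(x) - K(x\<^sup>+)\<close>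
  contribute to the negative part.\<close>

lemma neg_part_add_coag_le:
  assumes h: "0 \<le> h" "h * (c * norm x) \<le> 1"
  shows "pos_part_norm (\<lambda>_. 1) (- (x + h *\<^sub>R coag p q x x))
    \<le> pos_part_norm (\<lambda>_. 1) (- x) + h * (3 * c * norm x * pos_part_norm (\<lambda>_. 1) (- x))"
proof -
  define y where "y = Abs_l1 (\<lambda>n. max (coord x n) 0)"
  have "summable (\<lambda>n. \<bar>max (coord x n) 0\<bar>)"
    by (rule summable_comparison_test'[OF summable_coord[of x], of 0]) auto
  then have y: "coord y n = max (coord x n) 0" for n unfolding y_def by (subst Abs_l1_inverse) auto
  have ny: "norm y \<le> norm x"
    unfolding norm_l1_def by (rule suminf_le[OF _ summable_coord summable_coord]) (auto simp: y)
  have nd: "norm (x - y) = pos_part_norm (\<lambda>_. 1) (- x)"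
    unfolding norm_l1_def pos_part_norm_def by (rule suminf_cong) (auto simp: y)
  have z: "pos_part_norm (\<lambda>_. 1) (- (y + h *\<^sub>R coag p q y y)) = 0"
  proof -
    have "h * (c * norm y) \<le> h * (c * norm x)" using ny c h(1) by (intro mult_left_mono)
    then have nn: "0 \<le> coord (y + h *\<^sub>R coag p q y y) n" for n
      using h by (intro add_coag_nonneg) (auto simp: y)
    have "max (coord (- (y + h *\<^sub>R coag p q y y)) n) 0 = 0" for n
      by (rule max_absorb2) (use nn[of n] in simp)
    then show ?thesis unfolding pos_part_norm_def by (simp only:) simp
  qed
  have "- (x + h *\<^sub>R coag p q x x) = - (y + h *\<^sub>R coag p q y y) + - ((x - y) + h *\<^sub>R (coag p q x x - coag p q y y))"
    by (simp add: scaleR_diff_right)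
  then have "pos_part_norm (\<lambda>_. 1) (- (x + h *\<^sub>R coag p q x x))
      \<le> 0 + norm ((x - y) + h *\<^sub>R (coag p q x x - coag p q y y))"
    using pos_part_norm_add_le[of "\<lambda>_. 1" "- (y + h *\<^sub>R coag p q y y)" "- ((x - y) + h *\<^sub>R (coag p q x x - coag p q y y))"] z
    by (simp only: norm_minus_cancel) simp
  also have "\<dots> \<le> norm (x - y) + h * norm (coag p q x x - coag p q y y)"
    using norm_triangle_ineq[of "x - y" "h *\<^sub>R (coag p q x x - coag p q y y)"] h(1) by simp
  also have "\<dots> \<le> norm (x - y) + h * (3/2 * c * (norm x + norm y) * norm (x - y))"
    using h(1) by (intro add_left_mono mult_left_mono norm_coag_diff_le)
  also have "\<dots> \<le> norm (x - y) + h * (3/2 * c * (norm x + norm x) * norm (x - y))"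
    using h(1) ny c by (intro add_left_mono mult_left_mono mult_right_mono) auto
  finally show ?thesis by (simp add: nd mult_ac)
qed

text \<open>The weak form of coagulation. Averaging the series with its image under the swap of n
  and j turns the one-sided loss v_n into (v_n + v_j) / 2; for v_n = n every term is then
  zero.\<close>

lemma weighted_sum_coag:
  assumes \<theta>: "\<And>n. 0 \<le> \<theta> n" "\<And>n. \<theta> n \<le> 1"
  defines "v \<equiv> \<lambda>n. \<theta> n * wgt p n"
  shows "((\<lambda>z. q (fst z) (snd z) * of_l1 p x (fst z) * of_l1 p x (snd z)
      * ((v (fst z + snd z) - v (fst z) - v (snd z)) / 2)) has_sum weighted_sum \<theta> (coag p q x x)) UNIV"
proof -
  let ?f = "of_l1 p x"
  interpret W: bounded_linear "weighted_sum \<theta>" by (rule bounded_linear_weighted_sum[of \<theta>, OF \<theta>])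
  let ?T = "\<lambda>z. q (fst z) (snd z) * ?f (fst z) * ?f (snd z) * (1/2 * v (fst z + snd z) - v (fst z))"
  have T: "(?T has_sum weighted_sum \<theta> (coag p q x x)) UNIV"
    using has_sum_bounded_linear[OF W.bounded_linear_axioms coag_has_sum[of x x]]
    by (simp add: coag_term_def W.scaleR W.diff weighted_sum_wgt_unit v_def)
  have "((\<lambda>z. ?T (prod.swap z)) has_sum weighted_sum \<theta> (coag p q x x)) UNIV"
    using has_sum_reindex_bij_betw[OF bij_swap] T by (rule iffD2)
  then have "((\<lambda>z. ?T (snd z, fst z)) has_sum weighted_sum \<theta> (coag p q x x)) UNIV"
    by (simp only: fst_swap snd_swap fst_conv snd_conv)
  from has_sum_cmult_right[OF has_sum_add[OF T this], of "1/2"]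
  have "((\<lambda>z. 1/2 * (?T z + ?T (snd z, fst z))) has_sum weighted_sum \<theta> (coag p q x x)) UNIV" by simp
  moreover have sym: "1/2 * (?T z + ?T (snd z, fst z)) = q (fst z) (snd z) * ?f (fst z) * ?f (snd z)
      * ((v (fst z + snd z) - v (fst z) - v (snd z)) / 2)" for z
  proof (cases "fst z = 0 \<or> snd z = 0")
    case False
    then have "q (snd z) (fst z) = q (fst z) (snd z)" by (intro q_sym) auto
    then show ?thesis by (simp add: algebra_simps)
  qed auto
  ultimately show ?thesis by (simp only: sym)
qed

end

section \<open>A moment inequality\<close>

text \<open>After scaling to s + t = 1, both s \<le> s^q and t \<le> t^q hold since q \<le>
  1.\<close>

lemma powr_add_le_powr_add:
  fixes r q :: real
  assumes "0 < r" "0 \<le> q" "q \<le> 1"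
  shows "(1 + r) powr q \<le> 1 + r powr q"
proof -
  define s t where "s = 1 / (1 + r)" and "t = r / (1 + r)"
  have st: "0 < s" "s \<le> 1" "0 < t" "t \<le> 1" "s + t = 1"
    using assms by (auto simp: s_def t_def field_simps)
  have "s \<le> s powr q" "t \<le> t powr q"
    using powr_mono'[of q 1 s] powr_mono'[of q 1 t] st assms by auto
  then have "1 \<le> s powr q + t powr q" using st by linarith
  then have "(1 + r) powr q * 1 \<le> (1 + r) powr q * (s powr q + t powr q)"
    by (intro mult_left_mono) auto
  also have "\<dots> = 1 + r powr q"
    using assms by (simp add: s_def t_def powr_divide distrib_left)
  finally show ?thesis by simp
qed

text \<open>The difference of the two sides vanishes at r = 0, and its derivative is nonnegative by
  subadditivity of the power p - 1, which lies in [0, 1].\<close>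

lemma powr_one_plus_le:
  fixes r p :: real
  assumes r: "0 < r" and p: "1 \<le> p" "p \<le> 2"
  shows "(1 + r) powr p \<le> 1 + p * r + r powr p"
proof -
  define g where "g x = 1 + p * x + x powr p - (1 + x) powr p" for x
  have "g 0 \<le> g r"
  proof (rule DERIV_nonneg_imp_increasing_open[of 0 r g])
    show "continuous_on {0..r} g"
      unfolding g_def using p by (intro continuous_intros continuous_on_powr') auto
    fix x assume x: "0 < x" "x < r"
    have "(g has_real_derivative p + p * x powr (p - 1) - p * (1 + x) powr (p - 1)) (at x)"
      unfolding g_def using x by (auto intro!: derivative_eq_intros)
    moreover have "0 \<le> p + p * x powr (p - 1) - p * (1 + x) powr (p - 1)"
    proof -
      have "p * (1 + x) powr (p - 1) \<le> p * (1 + x powr (p - 1))"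
        using powr_add_le_powr_add[of x "p - 1"] x p by (intro mult_left_mono) auto
      then show ?thesis by (simp add: distrib_left)
    qed
    ultimately show "\<exists>y. (g has_real_derivative y) (at x) \<and> 0 \<le> y" by blast
  qed (use r in simp)
  then show ?thesis by (simp add: g_def)
qed

text \<open>If \<open>h\<close> were negative somewhere, the mean value theorem would make \<open>h''\<close> positive before it is
  negative, whereas \<open>h''\<close> is nondecreasing.\<close>

lemma chord_bound_powr:
  fixes x p :: real
  assumes x: "0 < x" "x < 1/2" and p: "2 \<le> p" "p \<le> 3"
  shows "1 - x powr p - (1 - x) powr p \<le> (1 - 2 powr (1 - p)) * (4 * x * (1 - x))"
proof -
  \<comment> \<open>C is chosen so that the parabola C t (1 - t) agrees with 1 - t^p - (1 - t)^p at
    t = 1/2, besides 0 and 1.\<close>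
  define C where "C = 4 * (1 - 2 powr (1 - p))"
  define h where "h t = C * (t * (1 - t)) - 1 + t powr p + (1 - t) powr p" for t
  define h1 where "h1 t = C * (1 - 2 * t) + p * t powr (p - 1) - p * (1 - t) powr (p - 1)" for t
  define h2 where "h2 t = - 2 * C + p * ((p - 1) * t powr (p - 2)) + p * ((p - 1) * (1 - t) powr (p - 2))" for t
  define h3 where "h3 t = p * ((p - 1) * ((p - 2) * t powr (p - 3))) - p * ((p - 1) * ((p - 2) * (1 - t) powr (p - 3)))" for t
  have d1: "(h has_real_derivative h1 t) (at t)" if "0 < t" "t < 1" for t
    unfolding h_def h1_def using that by (auto intro!: derivative_eq_intros simp: algebra_simps)
  have d2: "(h1 has_real_derivative h2 t) (at t)" if "0 < t" "t < 1" for t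
    unfolding h1_def h2_def using that by (auto intro!: derivative_eq_intros simp: algebra_simps)
  have d3: "(h2 has_real_derivative h3 t) (at t)" if "0 < t" "t < 1" for t
    unfolding h2_def h3_def using that by (auto intro!: derivative_eq_intros simp: algebra_simps)
  \<comment> \<open>Here p \<le> 3 enters: the power p - 3 is nonincreasing, and t \<le> 1 -
    t.\<close>
  have h3: "0 \<le> h3 t" if "0 < t" "t \<le> 1/2" for t
  proof -
    have "(1 - t) powr (p - 3) \<le> t powr (p - 3)" using that p by (intro powr_mono2') auto
    then show ?thesis unfolding h3_def using p by (simp add: mult_left_mono)
  qed
  have h0: "h 0 = 0" using p by (simp add: h_def)
  have hh: "h (1/2) = 0"
  proof -
    have "(1/2 :: real) powr p = 2 powr (- p)" by (simp add: powr_divide powr_minus_divide)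
    moreover have "2 powr (1 - p) = 2 * 2 powr (- p)" by (simp add: powr_diff powr_minus_divide)
    ultimately show ?thesis unfolding h_def C_def by (simp add: field_simps)
  qed
  have "0 \<le> h x"
  proof (rule ccontr)
    assume "\<not> ?thesis"
    then have neg: "h x < 0" by simp
    have cont: "continuous_on {0..x} h"
      unfolding h_def using p x by (intro continuous_intros continuous_on_powr') auto
    obtain u where u: "0 < u" "u < x" "h x - h 0 = h1 u * (x - 0)"
      using mvt[OF x(1) cont, of "\<lambda>t. (*) (h1 t)"] d1 x unfolding has_field_derivative_def by auto
    obtain v where v: "x < v" "v < 1/2" "h (1/2) - h x = (1/2 - x) * h1 v"
      using MVT2[OF x(2), of h h1] d1 x by auto
    have hu: "h1 u < 0" using u neg h0 x by (simp add: mult_less_0_iff)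
    have "0 < (1/2 - x) * h1 v" using v neg hh by linarith
    then have hv: "0 < h1 v" using x by (simp add: zero_less_mult_iff)
    obtain s where s: "u < s" "s < v" "h1 v - h1 u = (v - u) * h2 s"
      using MVT2[of u v h1 h2] d2 u v by auto
    obtain r where r: "v < r" "r < 1/2" "h1 (1/2) - h1 v = (1/2 - v) * h2 r"
      using MVT2[of v "1/2" h1 h2] d2 u v by auto
    \<comment> \<open>The symmetry of h about 1/2 makes the slope vanish there. So the slope rises
      from negative at u to positive at v and then falls back to 0, against the monotonicity of
      \<open>h2\<close>.\<close>
    have h1h: "h1 (1/2) = 0" by (simp add: h1_def)
    have "0 < (v - u) * h2 s" using s hu hv by linarith
    then have hs: "0 < h2 s" using u v by (simp add: zero_less_mult_iff)
    have "(1/2 - v) * h2 r < 0" using r hv h1h by linarith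
    then have hr: "h2 r < 0" using v by (simp add: mult_less_0_iff)
    have "h2 s \<le> h2 r"
    proof (rule DERIV_nonneg_imp_nondecreasing[of s r h2])
      fix t assume t: "s \<le> t" "t \<le> r"
      then have "0 < t" "t < 1" "t \<le> 1/2" using s r u by auto
      then show "\<exists>y. (h2 has_real_derivative y) (at t) \<and> 0 \<le> y"
        using d3[of t] h3[of t] by blast
    qed (use s r in simp)
    with hs hr show False by simp
  qed
  then show ?thesis unfolding h_def C_def by (simp add: algebra_simps)
qed

lemma powr_sum_lower_bound:
  fixes x y q :: real
  assumes "0 < x" "0 < y" "x + y = 1" "1 \<le> q"
  shows "2 powr (1 - q) \<le> x powr q + y powr q"
proof -
  have "((1/2) *\<^sub>R x + (1/2) *\<^sub>R y) powr q \<le> 1/2 * x powr q + 1/2 * y powr q"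
    using convex_onD[OF powr_convex[OF assms(4)], of "1/2" x y] assms by simp
  then have "(1/2) powr q \<le> 1/2 * x powr q + 1/2 * y powr q"
    using assms(3) by (simp flip: add_divide_distrib)
  moreover have "2 powr (1 - q) = 2 * (1/2 :: real) powr q" by (simp add: powr_diff powr_divide)
  ultimately show ?thesis by simp
qed

text \<open>For p \<le> 3 the chord bound is combined with convexity of the power p - 1, both sharp
  at x = y = 1/2. Beyond that p is lowered by 1: x + y = 1 gives 1 - x^p - y^p = 1 - x^(p-1) -
  y^(p-1) + x y (x^(p-2) + y^(p-2)), and Chebyshev's sum inequality raises the powers again at the
  cost of a factor 2, so that 2^(p-1) - 2 becomes 2 (2^(p-1) - 1) = 2^p - 2. The number n only
  counts unit intervals of exponents.\<close>

lemma normalized_moment_inequality: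
  fixes x y p :: real
  assumes xy: "0 < x" "0 < y" "x + y = 1" and p: "2 \<le> p" "p \<le> 3 + real n"
  shows "1 - x powr p - y powr p \<le> (2 powr p - 2) * (x * y * (x powr (p - 1) + y powr (p - 1)))"
  using p
proof (induction n arbitrary: p)
  case 0
  then have p: "2 \<le> p" "p \<le> 3" by auto
  have "1 - x powr p - y powr p \<le> (1 - 2 powr (1 - p)) * (4 * x * y)"
  proof -
    consider "x < 1/2" | "y < 1/2" | "x = 1/2" "y = 1/2" using xy by linarith
    then show ?thesis
    proof cases
      case 1
      have "y = 1 - x" using xy by simp
      then show ?thesis using chord_bound_powr[OF xy(1) 1 p] by (simp only:)
    next
      case 2
      have x: "1 - y = x" using xy by simp
      have "4 * y * x = 4 * x * y" by simp
      then show ?thesis using chord_bound_powr[OF xy(2) 2 p] unfolding x by (simp only:)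
    next
      case 3
      have "2 powr (1 - p) = 2 * (1/2 :: real) powr p" by (simp add: powr_diff powr_divide)
      then show ?thesis unfolding 3 by simp
    qed
  qed
  also have "\<dots> = (2 powr p - 2) * (x * y * 2 powr (2 - p))"
  proof -
    have "2 powr (1 - p) * 2 powr p = 2" "2 powr (2 - p) * 2 powr p = (4::real)"
      by (simp_all flip: powr_add)
    moreover have "2 powr (2 - p) = 2 * (2 powr (1 - p) :: real)" by (simp add: powr_diff)
    ultimately have e: "4 * (1 - 2 powr (1 - p)) = (2 powr p - 2) * (2 powr (2 - p) :: real)"
      by (simp add: left_diff_distrib mult.commute)
    have "(1 - 2 powr (1 - p)) * (4 * x * y) = (4 * (1 - 2 powr (1 - p))) * (x * y)" by simp
    then show ?thesis unfolding e by (simp only: mult_ac)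
  qed
  also have "\<dots> \<le> (2 powr p - 2) * (x * y * (x powr (p - 1) + y powr (p - 1)))"
  proof (intro mult_left_mono)
    show "2 powr (2 - p) \<le> x powr (p - 1) + y powr (p - 1)"
      using powr_sum_lower_bound[OF xy, of "p - 1"] p by (simp add: algebra_simps)
    have "(2::real) powr 1 \<le> 2 powr p" using p by (intro powr_mono) auto
    then show "0 \<le> (2::real) powr p - 2" by simp
  qed (use xy in auto)
  finally show ?case .
next
  case (Suc n)
  show ?case
  proof (cases "p \<le> 3")
    case True
    then show ?thesis using Suc.IH[of p] Suc.prems by simp
  next
    case False
    define X Y where "X = x powr (p - 2)" and "Y = y powr (p - 2)"
    have X: "x powr (p - 1) = x * X" "y powr (p - 1) = y * Y" "x powr p = x * (x * X)" "y powr p = y * (y * Y)"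
      using xy powr_add[of x 1 "p - 2"] powr_add[of y 1 "p - 2"] powr_add[of x 2 "p - 2"] powr_add[of y 2 "p - 2"]
      by (simp_all add: X_def Y_def power2_eq_square)
    have IH: "1 - x * X - y * Y \<le> (2 powr (p - 1) - 2) * (x * y * (X + Y))"
      using Suc.IH[of "p - 1"] Suc.prems False by (simp add: X X_def[symmetric] Y_def[symmetric])
    have cheb: "X + Y \<le> 2 * (x * X + y * Y)"
    proof -
      have "0 \<le> (x - y) * (X - Y)"
      proof (cases "x \<le> y")
        case True
        then have "X \<le> Y" unfolding X_def Y_def using xy Suc.prems by (intro powr_mono2) auto
        with True show ?thesis by (simp add: mult_nonpos_nonpos)
      next
        case F: False
        then have "Y \<le> X" unfolding X_def Y_def using xy Suc.prems by (intro powr_mono2) auto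
        with F show ?thesis by simp
      qed
      also have "\<dots> = 2 * (x * X + y * Y) - (x + y) * (X + Y)" by (simp add: algebra_simps)
      finally show ?thesis using xy(3) by simp
    qed
    have y: "y = 1 - x" using xy(3) by simp
    have "1 - x powr p - y powr p = 1 - x * X - y * Y + x * y * (X + Y)"
      unfolding X unfolding y by (simp add: algebra_simps)
    also have "\<dots> \<le> (2 powr (p - 1) - 2) * (x * y * (X + Y)) + x * y * (X + Y)" using IH by simp
    also have "\<dots> = (2 powr (p - 1) - 1) * (x * y) * (X + Y)" by (simp add: algebra_simps)
    also have "\<dots> \<le> (2 powr (p - 1) - 1) * (x * y) * (2 * (x * X + y * Y))"
    proof (intro mult_left_mono cheb mult_nonneg_nonneg)
      show "0 \<le> (2::real) powr (p - 1) - 1" using ge_one_powr_ge_zero[of 2 "p - 1"] Suc.prems by simp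
    qed (use xy in auto)
    also have "\<dots> = (2 powr p - 2) * (x * y * (x powr (p - 1) + y powr (p - 1)))"
      unfolding X by (simp add: powr_diff algebra_simps)
    finally show ?thesis .
  qed
qed

text \<open>For p \<le> 2, scaling to r = x/y leaves p r (1 + r) \<le> p (r + r^p), that is r^2
  \<le> r^p, which is why the smaller variable is divided by the larger. For p > 2, division by x +
  y leads to the normalized form.\<close>

lemma moment_inequality:
  fixes x y p :: real
  assumes xy: "0 < x" "0 < y" and p: "1 < p"
  shows "((x + y) powr p - x powr p - y powr p) * (x + y) \<le> c_p p * (x * y powr p + y * x powr p)"
proof (cases "p \<le> 2")
  case True
  have main: "((x + y) powr p - x powr p - y powr p) * (x + y) \<le> p * (x * y powr p + y * x powr p)"
    if xy: "0 < x" "x \<le> y" for x y :: real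
  proof -
    define r where "r = x / y"
    have r: "0 < r" "r \<le> 1" "x = r * y" "0 < y" using xy by (auto simp: r_def)
    have "r powr 2 \<le> r powr p" using r True by (intro powr_mono') auto
    then have "r * r \<le> r powr p" using r by (simp add: power2_eq_square)
    then have "p * r * (1 + r) \<le> p * (r + r powr p)" using p by (simp add: algebra_simps)
    moreover have "((1 + r) powr p - 1 - r powr p) * (1 + r) \<le> (p * r) * (1 + r)"
      using powr_one_plus_le[of r p] r p True by (intro mult_right_mono) auto
    ultimately have *: "((1 + r) powr p - 1 - r powr p) * (1 + r) \<le> p * (r + r powr p)" by linarith
    have "x + y = (1 + r) * y" using r by (simp add: algebra_simps)
    then have e: "(x + y) powr p = (1 + r) powr p * y powr p" "x powr p = r powr p * y powr p"
      using r by (simp_all add: powr_mult)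
    have "((x + y) powr p - x powr p - y powr p) * (x + y) = (((1 + r) powr p - 1 - r powr p) * (1 + r)) * (y powr p * y)"
      unfolding e using r by (simp add: algebra_simps)
    also have "\<dots> \<le> (p * (r + r powr p)) * (y powr p * y)" using * r by (intro mult_right_mono) auto
    also have "\<dots> = p * (x * y powr p + y * x powr p)" unfolding e using r by (simp add: algebra_simps)
    finally show ?thesis .
  qed
  show ?thesis
    using main[of x y] main[of y x] xy True
    by (cases "x \<le> y") (auto simp: c_p_def add.commute diff_diff_eq algebra_simps)
next
  case False
  define s u v where "s = x + y" and "u = x / s" and "v = y / s"
  have s: "0 < s" and uv: "0 < u" "0 < v" "u + v = 1" "x = u * s" "y = v * s"
    using xy by (auto simp: s_def u_def v_def simp flip: add_divide_distrib)
  obtain n where n: "p \<le> real n" using real_arch_simple by blast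
  have *: "1 - u powr p - v powr p \<le> (2 powr p - 2) * (u * v * (u powr (p - 1) + v powr (p - 1)))"
    using normalized_moment_inequality[OF uv(1-3), of p n] False n by simp
  have e: "x powr p = u powr p * s powr p" "y powr p = v powr p * s powr p"
    using uv s by (simp_all add: powr_mult)
  have e': "u * u powr (p - 1) = u powr p" "v * v powr (p - 1) = v powr p"
    using uv by (simp_all add: powr_mult_base)
  have "((x + y) powr p - x powr p - y powr p) * (x + y) = (1 - u powr p - v powr p) * (s powr p * s)"
    unfolding e s_def[symmetric] by (simp add: algebra_simps)
  also have "\<dots> \<le> ((2 powr p - 2) * (u * v * (u powr (p - 1) + v powr (p - 1)))) * (s powr p * s)"
    using * s by (intro mult_right_mono) auto
  also have "u * v * (u powr (p - 1) + v powr (p - 1)) = u * v powr p + v * u powr p"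
    unfolding e'[symmetric] by (simp add: algebra_simps)
  also have "(2 powr p - 2) * (u * v powr p + v * u powr p) * (s powr p * s) = (2 powr p - 2) * (x * y powr p + y * x powr p)"
    unfolding e using uv(4,5) by (simp add: algebra_simps)
  finally show ?thesis using False by (simp add: c_p_def)
qed

lemma c_p_nonneg: "1 < p \<Longrightarrow> 0 \<le> c_p p"
  using powr_mono[of 1 p 2] by (simp add: c_p_def)

section \<open>Mild solutions of the coagulation-fragmentation equation\<close>

definition mass_wgt :: "real \<Rightarrow> nat \<Rightarrow> real" where
  "mass_wgt p n = real n powr (1 - p)"

lemma mass_wgt_mult_wgt: "mass_wgt p n * wgt p n = real n"
  by (cases "n = 0") (auto simp: mass_wgt_def wgt_def simp flip: powr_add)

lemma mass_wgt_bounds: "0 \<le> mass_wgt p n" "1 < p \<Longrightarrow> mass_wgt p n \<le> 1"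
proof -
  show "0 \<le> mass_wgt p n" by (simp add: mass_wgt_def)
  show "mass_wgt p n \<le> 1" if "1 < p"
    using powr_mono[of "1 - p" 0 "real n"] that by (cases "n = 0") (auto simp: mass_wgt_def)
qed

lemma weighted_sum_one: "(\<And>n. 0 \<le> coord x n) \<Longrightarrow> weighted_sum (\<lambda>_. 1) x = norm x"
  by (simp add: weighted_sum_def norm_l1_def)

lemma coord_nonneg_if_neg_part_zero:
  assumes "pos_part_norm (\<lambda>_. 1) (- x) \<le> 0"
  shows "0 \<le> coord x n"
proof -
  have "(\<Sum>i\<in>{n}. 1 * max (coord (- x) i) 0) \<le> pos_part_norm (\<lambda>_. 1) (- x)"
    unfolding pos_part_norm_def by (rule sum_le_suminf[OF summable_pos_part[of "\<lambda>_. 1"]]) auto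
  with assms show ?thesis by simp
qed

lemma pos_part_norm_eq_weighted_sum:
  "(\<And>n. 0 \<le> coord x n) \<Longrightarrow> pos_part_norm \<theta> x = weighted_sum \<theta> x"
  by (simp add: pos_part_norm_def weighted_sum_def max_absorb1)

context coagulation_kernel
begin

lemma mass_coag:
  assumes "1 < p" shows "weighted_sum (mass_wgt p) (coag p q x x) = 0"
proof -
  have "((\<lambda>z :: nat \<times> nat. 0) has_sum weighted_sum (mass_wgt p) (coag p q x x)) UNIV"
    using weighted_sum_coag[of "mass_wgt p" x] mass_wgt_bounds assms by (simp add: mass_wgt_mult_wgt)
  then show ?thesis by (rule has_sum_unique) (simp add: has_sum_0)
qed

text \<open>The factor n + j of the kernel bound is consumed by the moment inequality, whose right
  side n w_j + j w_n separates the double sum into two equal products of first moment and norm;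
  together they cancel the 1/2 of the weak form.\<close>

lemma weight_coag_le:
  assumes p: "1 < p" and x: "\<And>n. 0 \<le> coord x n" and m: "0 \<le> m"
    and q_lin: "\<And>n j. 1 \<le> n \<Longrightarrow> 1 \<le> j \<Longrightarrow> q n j \<le> m * real (n + j)"
  shows "weighted_sum (\<lambda>_. 1) (coag p q x x) \<le> c_p p * m * weighted_sum (mass_wgt p) x * norm x"
proof -
  let ?f = "of_l1 p x" and ?\<theta> = "mass_wgt p"
  have f: "0 \<le> ?f n" for n using x[of n] by (simp add: of_l1_def)
  have cp: "0 \<le> c_p p" using p by (rule c_p_nonneg)
  have s1: "(\<lambda>n. ?\<theta> n * coord x n) sums weighted_sum ?\<theta> x"
    unfolding weighted_sum_def using summable_weighted_coord[of ?\<theta> x] mass_wgt_bounds p by (intro summable_sums) auto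
  have s2: "coord x sums norm x" using norm_sums[of x] x by simp
  have nn: "0 \<le> ?\<theta> n * coord x n" for n using mass_wgt_bounds x by simp
  have A: "((\<lambda>z. (?\<theta> (fst z) * coord x (fst z)) * coord x (snd z)) has_sum weighted_sum ?\<theta> x * norm x) UNIV"
    by (rule has_sum_product_nonneg[OF s1 nn s2 x])
  have B: "((\<lambda>z. coord x (fst z) * (?\<theta> (snd z) * coord x (snd z))) has_sum norm x * weighted_sum ?\<theta> x) UNIV"
    by (rule has_sum_product_nonneg[OF s2 x s1 nn])
  have AB: "((\<lambda>z. (c_p p * m / 2) * ((?\<theta> (fst z) * coord x (fst z)) * coord x (snd z) + coord x (fst z) * (?\<theta> (snd z) * coord x (snd z))))
      has_sum (c_p p * m / 2) * (weighted_sum ?\<theta> x * norm x + norm x * weighted_sum ?\<theta> x)) UNIV"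
    by (rule has_sum_cmult_right[OF has_sum_add[OF A B]])
  have L: "((\<lambda>z. q (fst z) (snd z) * ?f (fst z) * ?f (snd z) * ((wgt p (fst z + snd z) - wgt p (fst z) - wgt p (snd z)) / 2))
      has_sum weighted_sum (\<lambda>_. 1) (coag p q x x)) UNIV"
    using weighted_sum_coag[of "\<lambda>_. 1" x] by simp
  have "weighted_sum (\<lambda>_. 1) (coag p q x x) \<le> (c_p p * m / 2) * (weighted_sum ?\<theta> x * norm x + norm x * weighted_sum ?\<theta> x)"
  proof (rule has_sum_mono[OF L AB])
    fix z :: "nat \<times> nat"
    obtain n j where z: "z = (n, j)" by (cases z)
    have e: "?\<theta> i * coord x i = real i * ?f i" for i
      by (simp add: mass_wgt_mult_wgt flip: wgt_mult_of_l1[of p i x] mult.assoc)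
    have "q n j * ?f n * ?f j * ((wgt p (n + j) - wgt p n - wgt p j) / 2)
        \<le> (c_p p * m / 2) * (real n * ?f n * (wgt p j * ?f j) + wgt p n * ?f n * (real j * ?f j))"
    proof (cases "n = 0 \<or> j = 0")
      case False
      then have nj: "1 \<le> n" "1 \<le> j" by auto
      let ?d = "wgt p (n + j) - wgt p n - wgt p j"
      have "q n j * ?d \<le> c_p p * m * (real n * wgt p j + real j * wgt p n)"
      \<comment> \<open>The kernel bound may be multiplied only by a nonnegative number; if
        \<open>?d\<close> is not positive, neither is the left side, so superadditivity of n^p need
        not be shown.\<close>
      proof (cases "?d \<le> 0")
        case True
        then have "q n j * ?d \<le> 0" using q_nonneg[OF nj] by (simp add: mult_nonneg_nonpos)
        also have "0 \<le> c_p p * m * (real n * wgt p j + real j * wgt p n)" using cp m by simp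
        finally show ?thesis .
      next
        case d: False
        have "q n j * ?d \<le> (m * real (n + j)) * ?d" using q_lin[OF nj] d by (intro mult_right_mono) auto
        also have "\<dots> = m * (?d * (real n + real j))" by (simp add: mult_ac)
        also have "\<dots> \<le> m * (c_p p * (real n * wgt p j + real j * wgt p n))"
          using moment_inequality[of "real n" "real j" p] p nj m
          by (intro mult_left_mono) (auto simp: wgt_def)
        finally show ?thesis by (simp add: mult_ac)
      qed
      then have "(q n j * ?d) * (?f n * ?f j / 2) \<le> (c_p p * m * (real n * wgt p j + real j * wgt p n)) * (?f n * ?f j / 2)"
        using f by (intro mult_right_mono) auto
      then show ?thesis by (simp add: algebra_simps)
    qed (auto simp: f cp m)
    then show "q (fst z) (snd z) * ?f (fst z) * ?f (snd z) * ((wgt p (fst z + snd z) - wgt p (fst z) - wgt p (snd z)) / 2)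
        \<le> (c_p p * m / 2) * ((?\<theta> (fst z) * coord x (fst z)) * coord x (snd z) + coord x (fst z) * (?\<theta> (snd z) * coord x (snd z)))"
      unfolding e by (simp add: z wgt_mult_of_l1)
  qed
  then show ?thesis by (simp add: mult_ac)
qed

end

locale coagulation_fragmentation = fragmentation_semigroup +
  fixes T :: ereal and k :: "nat \<Rightarrow> nat \<Rightarrow> real \<Rightarrow> real"
  assumes p_gt: "1 < p"
    and mass: "2 \<le> j \<Longrightarrow> (\<Sum>n=1..j-1. real n * b n j) \<le> real j"
    and k_nonneg: "1 \<le> n \<Longrightarrow> 1 \<le> j \<Longrightarrow> t \<in> tset T \<Longrightarrow> 0 \<le> k n j t"
    and k_cont: "1 \<le> n \<Longrightarrow> 1 \<le> j \<Longrightarrow> continuous_on (tset T) (k n j)"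
    and k_sym: "1 \<le> n \<Longrightarrow> 1 \<le> j \<Longrightarrow> t \<in> tset T \<Longrightarrow> k n j t = k j n t"
    and CI: "0 < t' \<Longrightarrow> ereal t' < T \<Longrightarrow>
       \<exists>c>0. \<forall>n\<ge>1. \<forall>j\<ge>1. \<forall>t\<in>{0..t'}. k n j t \<le> c * wgt p n * wgt p j / wgt p (n + j)"
begin

section \<open>The time-dependent coagulation operator\<close>

definition K :: "real \<Rightarrow> l1 \<Rightarrow> l1" where
  "K t x = coag p (\<lambda>n j. k n j t) x x"

lemma kernel_on:
  assumes "0 \<le> \<tau>" "ereal \<tau> < T"
  obtains c where "0 < c" "\<And>t. t \<in> {0..\<tau>} \<Longrightarrow> coagulation_kernel p c (\<lambda>n j. k n j t)"
proof -
  \<comment> \<open>(CI) speaks of positive times, so a time t' strictly beyond \<tau> is taken,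
    which also covers \<tau> = 0.\<close>
  obtain t' where t': "\<tau> < t'" "ereal t' < T" using ereal_dense2[OF assms(2)] by auto
  obtain c where c: "c > 0" "\<And>n j t. 1 \<le> n \<Longrightarrow> 1 \<le> j \<Longrightarrow> t \<in> {0..t'} \<Longrightarrow> k n j t \<le> c * wgt p n * wgt p j / wgt p (n + j)"
    using CI[of t'] t' assms(1) by (metis le_less_trans)
  have "coagulation_kernel p c (\<lambda>n j. k n j t)" if t: "t \<in> {0..\<tau>}" for t
  proof
    have tT: "t \<in> tset T" using t assms(2) by (auto simp: tset_def intro: le_less_trans[of "ereal t" "ereal \<tau>"])
    fix n j :: nat assume nj: "1 \<le> n" "1 \<le> j"
    show "0 \<le> k n j t" "k n j t = k j n t" using k_nonneg[OF nj tT] k_sym[OF nj tT] by auto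
    show "k n j t \<le> c * wgt p n * wgt p j / wgt p (n + j)" using c(2)[OF nj, of t] t t' by simp
  qed (use p_gt c in auto)
  with c(1) that show ?thesis by blast
qed

lemma Kop_eq:
  assumes t: "t \<in> tset T" and f: "f \<in> l1w p"
  shows "Kop k t f = of_l1 p (K t (to_l1 p f))"
proof
  fix n
  obtain c where "coagulation_kernel p c (\<lambda>n j. k n j t)"
    using kernel_on[of t] t by (auto simp: tset_def)
  then interpret coagulation_kernel p c "\<lambda>n j. k n j t" .
  show "Kop k t f n = of_l1 p (K t (to_l1 p f)) n"
  proof (cases "n = 0")
    case False
    \<comment> \<open>\<open>Kop\<close> sums from size 1 on, \<open>coord_coag\<close> from 0; the
      extra term vanishes because f 0 = 0.\<close>
    have "summable (\<lambda>j. k n j t * f n * f j)" using loss_summable(1)[of n "to_l1 p f"] False f by simp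
    from suminf_split_initial_segment[OF this, of 1]
    have "(\<Sum>j. k n j t * f n * f j) = (\<Sum>i. k n (i + 1) t * f n * f (i + 1))"
      using f by (simp add: l1w_def)
    then show ?thesis using False f by (simp add: of_l1_def K_def coord_coag Kop_def)
  qed (simp add: Kop_def)
qed

text \<open>The kernel is continuous entry by entry, without uniformity in n and j. Norm continuity
  comes from the Weierstrass test over finite sets of pairs: the constant of (CI) is the same on all
  of [0, \<tau>], so the majorant does not depend on time.\<close>

lemma K_continuous_time:
  assumes \<tau>: "0 \<le> \<tau>" "ereal \<tau> < T"
  shows "continuous_on {0..\<tau>} (\<lambda>t. K t x)"
proof -
  obtain c where c: "0 < c" "\<And>t. t \<in> {0..\<tau>} \<Longrightarrow> coagulation_kernel p c (\<lambda>n j. k n j t)"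
    using kernel_on[OF \<tau>] by blast
  let ?F = "\<lambda>z t. coag_term p (\<lambda>n j. k n j t) x x z"
  have "uniform_limit {0..\<tau>} (\<lambda>X t. \<Sum>z\<in>X. ?F z t) (\<lambda>t. \<Sum>\<^sub>\<infinity>z. ?F z t) (finite_subsets_at_top UNIV)"
  proof (rule Weierstrass_m_test_general)
    fix z t assume "t \<in> {0..\<tau>}"
    then interpret coagulation_kernel p c "\<lambda>n j. k n j t" by (rule c)
    show "norm (?F z t) \<le> 3/2 * c * (\<bar>coord x (fst z)\<bar> * \<bar>coord x (snd z)\<bar>)" by (rule norm_coag_term_le)
  next
    show "(\<lambda>z. 3/2 * c * (\<bar>coord x (fst z)\<bar> * \<bar>coord x (snd z)\<bar>)) summable_on UNIV"
      by (rule has_sum_imp_summable[OF has_sum_cmult_right[OF has_sum_norm_product]])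
  qed
  then have "continuous_on {0..\<tau>} (\<lambda>t. \<Sum>\<^sub>\<infinity>z. ?F z t)"
  proof (rule uniform_limit_theorem[rotated])
    have "continuous_on {0..\<tau>} (?F z)" for z
    proof (cases "fst z = 0 \<or> snd z = 0")
      case True
      then have "?F z = (\<lambda>_. 0)" by (auto simp: coag_term_def fun_eq_iff)
      then show ?thesis by (simp only: continuous_on_const)
    next
      case False
      have "{0..\<tau>} \<subseteq> tset T" using \<tau> by (auto simp: tset_def intro: le_less_trans[of "ereal _" "ereal \<tau>"])
      then have "continuous_on {0..\<tau>} (k (fst z) (snd z))"
        using False by (intro continuous_on_subset[OF k_cont]) auto
      then show ?thesis unfolding coag_term_def by (intro continuous_intros)
    qed
    then show "\<forall>\<^sub>F X in finite_subsets_at_top UNIV. continuous_on {0..\<tau>} (\<lambda>t. \<Sum>z\<in>X. ?F z t)"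
      by (intro always_eventually allI continuous_on_sum)
  qed simp
  then show ?thesis by (simp add: K_def coag_def)
qed

text \<open>State and time are varied separately: the constant in the Lipschitz estimate is uniform
  in time, and the state stays fixed while time moves.\<close>

lemma K_continuous:
  assumes \<tau>: "0 \<le> \<tau>" "ereal \<tau> < T" and A: "A \<subseteq> {0..\<tau>}" and v: "continuous_on A v"
  shows "continuous_on A (\<lambda>s. K s (v s))"
  unfolding continuous_on_def
proof
  fix t assume t: "t \<in> A"
  obtain c where c: "0 < c" "\<And>t. t \<in> {0..\<tau>} \<Longrightarrow> coagulation_kernel p c (\<lambda>n j. k n j t)"
    using kernel_on[OF \<tau>] by blast
  have vt: "(v \<longlongrightarrow> v t) (at t within A)" using v t by (simp add: continuous_on_def)
  have 1: "((\<lambda>s. 3/2 * c * (norm (v s) + norm (v t)) * norm (v s - v t)) \<longlongrightarrow> 3/2 * c * (norm (v t) + norm (v t)) * norm (v t - v t)) (at t within A)"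
    by (intro tendsto_intros vt)
  have "continuous_on A (\<lambda>s. K s (v t))" by (rule continuous_on_subset[OF K_continuous_time[OF \<tau>] A])
  then have 2: "((\<lambda>s. norm (K s (v t) - K t (v t))) \<longlongrightarrow> 0) (at t within A)"
    using t by (intro tendsto_norm_zero) (simp add: continuous_on_def LIM_zero_iff)
  have "((\<lambda>s. K s (v s) - K t (v t)) \<longlongrightarrow> 0) (at t within A)"
  proof (rule Lim_null_comparison)
    show "((\<lambda>s. 3/2 * c * (norm (v s) + norm (v t)) * norm (v s - v t) + norm (K s (v t) - K t (v t))) \<longlongrightarrow> 0) (at t within A)"
      using tendsto_add[OF 1 2] by simp
    have "norm (K s (v s) - K t (v t)) \<le> 3/2 * c * (norm (v s) + norm (v t)) * norm (v s - v t) + norm (K s (v t) - K t (v t))"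
      if s: "s \<in> A" for s
    proof -
      interpret coagulation_kernel p c "\<lambda>n j. k n j s" using c(2) A s by blast
      have "norm (K s (v s) - K t (v t)) \<le> norm (K s (v s) - K s (v t)) + norm (K s (v t) - K t (v t))"
        using norm_triangle_ineq[of "K s (v s) - K s (v t)" "K s (v t) - K t (v t)"] by simp
      then show ?thesis using norm_coag_diff_le[of "v s" "v t"] by (simp add: K_def)
    qed
    then show "\<forall>\<^sub>F s in at t within A. norm (K s (v s) - K t (v t)) \<le> 3/2 * c * (norm (v s) + norm (v t)) * norm (v s - v t) + norm (K s (v t) - K t (v t))"
      by (simp add: eventually_at_filter)
  qed
  then show "((\<lambda>s. K s (v s)) \<longlongrightarrow> K t (v t)) (at t within A)" by (simp add: LIM_zero_iff)
qed

text \<open>The interval is closed, unlike that of \<open>mild_solution\<close>: compactness then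
  bounds the solution and makes the local Lipschitz constants uniform.\<close>

definition mild_on :: "l1 \<Rightarrow> real \<Rightarrow> (real \<Rightarrow> l1) \<Rightarrow> bool" where
  "mild_on x0 \<tau> w \<longleftrightarrow> continuous_on {0..\<tau>} w
     \<and> (\<forall>t\<in>{0..\<tau>}. w t = U t x0 + conv (\<lambda>s. K s (w s)) 0 t)"

lemma mild_on_subset: "mild_on x0 \<tau> w \<Longrightarrow> \<tau>' \<le> \<tau> \<Longrightarrow> mild_on x0 \<tau>' w"
  unfolding mild_on_def by (auto intro: continuous_on_subset)

text \<open>Mild solutions are defined by scalar integrals, one for each entry. As the integrand is
  continuous in \<open>l1\<close>, its integral exists there, coordinates pass through it, and
  uniqueness of scalar integrals makes this an equivalence.\<close>

lemma componentwise_integral_iff: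
  assumes t: "0 \<le> t" "ereal t < T" and w: "continuous_on {0..t} w"
  shows "(\<forall>n. ((\<lambda>s. S (t - s) (Kop k s (of_l1 p (w s))) n) has_integral (of_l1 p (w t) n - S t (of_l1 p x0) n)) {0..t})
    \<longleftrightarrow> w t = U t x0 + conv (\<lambda>s. K s (w s)) 0 t"
proof -
  let ?g = "\<lambda>s. K s (w s)"
  have g: "continuous_on {0..t} ?g" by (rule K_continuous[OF t order_refl w])
  have int: "((\<lambda>s. U (t - s) (?g s)) has_integral conv ?g 0 t) {0..t}"
    unfolding conv_def using integrable_continuous_real[OF conv_integrand_continuous[OF g order_refl]] by (rule integrable_integral)
  have bl: "bounded_linear (\<lambda>x. of_l1 p x n)" for n
    unfolding of_l1_def by (rule bounded_linear_divide[THEN bounded_linear_compose, OF bounded_linear_coord])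
  have I: "((\<lambda>s. S (t - s) (Kop k s (of_l1 p (w s))) n) has_integral of_l1 p (conv ?g 0 t) n) {0..t}" for n
  proof (rule has_integral_eq)
    show "((\<lambda>s. of_l1 p (U (t - s) (?g s)) n) has_integral of_l1 p (conv ?g 0 t) n) {0..t}"
      using has_integral_linear[OF int bl] by (simp add: o_def)
    fix s assume s: "s \<in> {0..t}"
    then have "s \<in> tset T" using t by (auto simp: tset_def intro: le_less_trans[of "ereal s" "ereal t"])
    then show "of_l1 p (U (t - s) (?g s)) n = S (t - s) (Kop k s (of_l1 p (w s))) n"
      using s by (simp add: of_l1_U Kop_eq)
  qed
  have "(\<forall>n. ((\<lambda>s. S (t - s) (Kop k s (of_l1 p (w s))) n) has_integral (of_l1 p (w t) n - S t (of_l1 p x0) n)) {0..t})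
      \<longleftrightarrow> (\<forall>n. of_l1 p (w t) n - S t (of_l1 p x0) n = of_l1 p (conv ?g 0 t) n)"
    by (intro iff_allI iffI) (rule has_integral_unique[OF _ I], assumption, simp only: I)
  also have "\<dots> \<longleftrightarrow> (\<forall>n. of_l1 p (w t) n = of_l1 p (U t x0 + conv ?g 0 t) n)"
    using t by (simp add: of_l1_U[symmetric] of_l1_def add_divide_distrib diff_eq_eq add.commute)
  also have "\<dots> \<longleftrightarrow> w t = U t x0 + conv ?g 0 t"
    by (subst fun_eq_iff[symmetric]) (rule inj_eq[OF inj_on_inverseI[where g = "to_l1 p"]], simp)
  finally show ?thesis .
qed

lemma mild_solution_imp_mild_on:
  assumes u: "mild_solution p S k u0 t1 u" and u0: "u0 \<in> l1w p" and t1: "t1 \<le> T" and \<tau>: "0 \<le> \<tau>" "ereal \<tau> < t1"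
  shows "mild_on (to_l1 p u0) \<tau> (\<lambda>t. to_l1 p (u t))"
proof -
  have sub: "{0..\<tau>} \<subseteq> tset t1" using \<tau> by (auto simp: tset_def intro: le_less_trans[of "ereal _" "ereal \<tau>"])
  have ul: "u t \<in> l1w p" if "t \<in> tset t1" for t using u that by (simp add: mild_solution_def)
  have cont: "continuous_on {0..\<tau>} (\<lambda>t. to_l1 p (u t))"
    unfolding continuous_on_def
  proof
    fix t assume t: "t \<in> {0..\<tau>}"
    then have tt: "t \<in> tset t1" using sub by blast
    have "((\<lambda>s. wnorm p (\<lambda>n. u s n - u t n)) \<longlongrightarrow> 0) (at t within {0..\<tau>})"
      using u tt sub unfolding mild_solution_def by (meson tendsto_within_subset)
    moreover have "\<forall>\<^sub>F s in at t within {0..\<tau>}. wnorm p (\<lambda>n. u s n - u t n) = norm (to_l1 p (u s) - to_l1 p (u t))"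
      using sub ul tt by (auto simp: eventually_at_filter wnorm_diff_eq_norm subset_iff)
    ultimately have "((\<lambda>s. norm (to_l1 p (u s) - to_l1 p (u t))) \<longlongrightarrow> 0) (at t within {0..\<tau>})"
      by (rule Lim_transform_eventually)
    then show "((\<lambda>t. to_l1 p (u t)) \<longlongrightarrow> to_l1 p (u t)) (at t within {0..\<tau>})"
      by (simp add: tendsto_norm_zero_iff LIM_zero_iff)
  qed
  have "to_l1 p (u t) = U t (to_l1 p u0) + conv (\<lambda>s. K s (to_l1 p (u s))) 0 t" if t: "t \<in> {0..\<tau>}" for t
  proof (rule componentwise_integral_iff[THEN iffD1])
    have tt: "t \<in> tset t1" using sub t by blast
    show "0 \<le> t" using t by simp
    show "ereal t < T" using tt t1 by (auto simp: tset_def)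
    show "continuous_on {0..t} (\<lambda>t. to_l1 p (u t))" using cont by (rule continuous_on_subset) (use t in auto)
    show "\<forall>n. ((\<lambda>s. S (t - s) (Kop k s (of_l1 p (to_l1 p (u s)))) n) has_integral
        (of_l1 p (to_l1 p (u t)) n - S t (of_l1 p (to_l1 p u0)) n)) {0..t}"
    proof
      fix n
      have "((\<lambda>s. S (t - s) (Kop k s (u s)) n) has_integral (u t n - S t u0 n)) {0..t}"
        using u tt by (simp add: mild_solution_def)
      then have "((\<lambda>s. S (t - s) (Kop k s (of_l1 p (to_l1 p (u s)))) n) has_integral (u t n - S t u0 n)) {0..t}"
      proof (rule has_integral_eq[rotated])
        fix s assume "s \<in> {0..t}"
        then have "u s \<in> l1w p" using sub t by (intro ul) auto
        then show "S (t - s) (Kop k s (u s)) n = S (t - s) (Kop k s (of_l1 p (to_l1 p (u s)))) n" by simp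
      qed
      then show "((\<lambda>s. S (t - s) (Kop k s (of_l1 p (to_l1 p (u s)))) n) has_integral
        (of_l1 p (to_l1 p (u t)) n - S t (of_l1 p (to_l1 p u0)) n)) {0..t}"
        using ul[OF tt] u0 by simp
    qed
  qed
  with cont show ?thesis by (simp add: mild_on_def)
qed

lemma mild_on_imp_mild_solution:
  assumes w: "mild_on x0 \<tau> w" and \<tau>: "ereal \<tau> < T"
  shows "mild_solution p S k (of_l1 p x0) (ereal \<tau>) (\<lambda>t. of_l1 p (w t))"
  unfolding mild_solution_def
proof (intro conjI ballI allI)
  have ts: "tset (ereal \<tau>) = {0..<\<tau>}" by (auto simp: tset_def)
  fix t assume t: "t \<in> tset (ereal \<tau>)"
  show "of_l1 p (w t) \<in> l1w p" by simp
  have cont: "continuous_on {0..\<tau>} w" using w by (simp add: mild_on_def)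
  have "(w \<longlongrightarrow> w t) (at t within {0..<\<tau>})"
    using cont t unfolding ts continuous_on_def by (meson atLeastAtMost_iff atLeastLessThan_iff atLeastLessThan_subseteq_atLeastAtMost_iff less_imp_le order_refl tendsto_within_subset)
  then have "((\<lambda>s. norm (w s - w t)) \<longlongrightarrow> 0) (at t within {0..<\<tau>})"
    by (intro tendsto_norm_zero) (simp add: LIM_zero_iff)
  then show "((\<lambda>s. wnorm p (\<lambda>n. of_l1 p (w s) n - of_l1 p (w t) n)) \<longlongrightarrow> 0) (at t within tset (ereal \<tau>))"
    by (simp add: ts wnorm_diff_eq_norm)
  have "t < \<tau>" "0 \<le> t" using t ts by auto
  then have tT: "ereal t < T" using \<tau> by (meson ereal_less_eq(3) le_less_trans less_imp_le)
  fix n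
  show "((\<lambda>s. S (t - s) (Kop k s (of_l1 p (w s))) n) has_integral (of_l1 p (w t) n - S t (of_l1 p x0) n)) {0..t}"
    using componentwise_integral_iff[OF \<open>0 \<le> t\<close> tT continuous_on_subset[OF cont], of x0] w \<open>t < \<tau>\<close> \<open>0 \<le> t\<close>
    by (simp add: mild_on_def)
qed

end

section \<open>A priori estimates and continuation\<close>

lemma eventually_small_step:
  fixes C :: real
  assumes "0 \<le> C"
  shows "\<forall>\<^sub>F h in at_right 0. 0 < h \<and> h * C \<le> 1"
  unfolding eventually_at_right_field
proof (intro exI[of _ "1 / (C + 1)"] conjI allI impI)
  fix h assume h: "0 < h" "h < 1 / (C + 1)"
  have "h * C \<le> h * (C + 1)" using h by simp
  also have "\<dots> \<le> 1" using h assms by (simp add: field_simps)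
  finally show "h * C \<le> 1" .
qed (use assms in auto)

lemma continuous_on_pos_part_norm:
  assumes \<theta>: "\<And>n. 0 \<le> \<theta> n" "\<And>n. \<theta> n \<le> 1" and v: "continuous_on A v"
  shows "continuous_on A (\<lambda>t. pos_part_norm \<theta> (v t))"
  using v unfolding continuous_on_def by (auto intro!: pos_part_norm_tendsto \<theta>)

context coagulation_fragmentation
begin

lemma mild_on_continuous: "mild_on x0 \<tau> w \<Longrightarrow> t \<le> \<tau> \<Longrightarrow> continuous_on {0..t} w"
  unfolding mild_on_def by (auto intro: continuous_on_subset)

lemma mild_on_bounded:
  assumes "mild_on x0 \<tau> w"
  obtains M where "0 \<le> M" "\<And>t. t \<in> {0..\<tau>} \<Longrightarrow> norm (w t) \<le> M"
proof -
  have "bounded (w ` {0..\<tau>})"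
    using assms by (intro compact_imp_bounded compact_continuous_image) (auto simp: mild_on_def)
  then obtain M where "0 < M" "\<And>t. t \<in> {0..\<tau>} \<Longrightarrow> norm (w t) \<le> M"
    by (auto simp: bounded_pos)
  with that show ?thesis by (meson less_imp_le)
qed

lemma mild_on_0: "0 \<le> \<tau> \<Longrightarrow> mild_on x0 \<tau> w \<Longrightarrow> w 0 = x0"
  by (auto simp: mild_on_def conv_def zero_time)

lemma mild_on_step:
  fixes N :: "l1 \<Rightarrow> real"
  assumes w: "mild_on x0 \<tau> w" and \<tau>: "0 \<le> \<tau>" "ereal \<tau> < T"
    and Lip: "\<And>x y. N (x + y) \<le> N x + 1 * norm y"
    and dec: "\<And>t x. 0 \<le> t \<Longrightarrow> N (U t x) \<le> N x"
    and t: "0 \<le> t" "t < \<tau>" and \<epsilon>: "0 < \<epsilon>"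
  shows "\<forall>\<^sub>F h in at_right 0. N (w (t + h)) \<le> N (w t + h *\<^sub>R K t (w t)) + h * \<epsilon>"
proof (rule mild_functional_step[OF _ _ Lip zero_le_one dec t \<epsilon>])
  show "continuous_on {0..\<tau>} (\<lambda>s. K s (w s))"
    using w by (intro K_continuous[OF \<tau> order_refl]) (simp add: mild_on_def)
qed (use w in \<open>simp add: mild_on_def\<close>)

lemma neg_part_U_le: "0 \<le> t \<Longrightarrow> pos_part_norm (\<lambda>_. 1) (- U t x) \<le> pos_part_norm (\<lambda>_. 1) (- x)"
  using pos_part_norm_one_U_le[of t "- x"] linear_neg[OF bounded_linear.linear[OF linear]] by simp

lemma mass_U_le: "0 \<le> t \<Longrightarrow> pos_part_norm (mass_wgt p) (U t x) \<le> pos_part_norm (mass_wgt p) x"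
  using mass mass_wgt_bounds p_gt by (intro pos_part_norm_U_le) (auto simp: mass_wgt_mult_wgt)

text \<open>The negative part starts at 0, so any finite rate in Gronwall's inequality keeps it
  there; M may be any bound of w on the interval, with no relation to the data.\<close>

lemma mild_on_nonneg:
  assumes w: "mild_on x0 \<tau> w" and \<tau>: "0 \<le> \<tau>" "ereal \<tau> < T" and x0: "\<And>n. 0 \<le> coord x0 n"
    and t: "t \<in> {0..\<tau>}"
  shows "0 \<le> coord (w t) n"
proof (rule coord_nonneg_if_neg_part_zero)
  let ?N = "\<lambda>x. pos_part_norm (\<lambda>_. 1) (- x)"
  obtain M where M: "0 \<le> M" "\<And>t. t \<in> {0..\<tau>} \<Longrightarrow> norm (w t) \<le> M" using mild_on_bounded[OF w] by blast
  obtain c where c: "0 < c" "\<And>t. t \<in> {0..\<tau>} \<Longrightarrow> coagulation_kernel p c (\<lambda>n j. k n j t)"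
    using kernel_on[OF \<tau>] by blast
  have "?N (w t) \<le> ?N (w 0) * exp ((3 * c * M) * (t - 0))"
  proof (rule Dini_Gronwall[of 0 t "\<lambda>t. ?N (w t)"])
    show "continuous_on {0..t} (\<lambda>t. ?N (w t))"
      using t by (intro continuous_on_pos_part_norm continuous_on_minus mild_on_continuous[OF w]) auto
    show "0 \<le> ?N (w s)" for s by (rule pos_part_norm_nonneg) auto
    show "0 \<le> 3 * c * M" using c M by simp
    show "0 \<le> t" using t by simp
    fix s \<epsilon> :: real assume s: "0 \<le> s" "s < t" and \<epsilon>: "0 < \<epsilon>"
    interpret coagulation_kernel p c "\<lambda>n j. k n j s" using c(2) s t by simp
    have Lip: "?N (x + y) \<le> ?N x + 1 * norm y" for x y
      using pos_part_norm_add_le[of "\<lambda>_. 1" "- x" "- y"] by simp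
    have "\<forall>\<^sub>F h in at_right 0. ?N (w (s + h)) \<le> ?N (w s + h *\<^sub>R K s (w s)) + h * \<epsilon>"
      using s t by (intro mild_on_step[OF w \<tau> Lip neg_part_U_le _ _ \<epsilon>]) auto
    moreover have "\<forall>\<^sub>F h in at_right 0. 0 < h \<and> h * (c * norm (w s)) \<le> 1"
      using c by (intro eventually_small_step) auto
    ultimately show "\<forall>\<^sub>F h in at_right 0. ?N (w (s + h)) \<le> ?N (w s) + h * (3 * c * M * ?N (w s) + \<epsilon>)"
    proof eventually_elim
      case (elim h)
      have "?N (w s + h *\<^sub>R K s (w s)) \<le> ?N (w s) + h * (3 * c * norm (w s) * ?N (w s))"
        unfolding K_def using elim by (intro neg_part_add_coag_le) auto
      also have "\<dots> \<le> ?N (w s) + h * (3 * c * M * ?N (w s))"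
        using M(2)[of s] s t c elim pos_part_norm_nonneg[of "\<lambda>_. 1"]
        by (intro add_left_mono mult_left_mono mult_right_mono) auto
      finally show ?case using elim by (simp add: distrib_left)
    qed
  qed
  also have "?N (w 0) = 0"
    unfolding mild_on_0[OF \<tau>(1) w] using x0 by (simp add: pos_part_norm_def max_absorb2)
  finally show "?N (w t) \<le> 0" by simp
qed

lemma mild_on_mass_le:
  assumes w: "mild_on x0 \<tau> w" and \<tau>: "0 \<le> \<tau>" "ereal \<tau> < T" and x0: "\<And>n. 0 \<le> coord x0 n"
    and t: "t \<in> {0..\<tau>}"
  shows "weighted_sum (mass_wgt p) (w t) \<le> weighted_sum (mass_wgt p) x0"
proof -
  let ?N = "pos_part_norm (mass_wgt p)"
  note pos = mild_on_nonneg[OF w \<tau> x0]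
  note \<theta> = mass_wgt_bounds(1)[of p] mass_wgt_bounds(2)[OF p_gt]
  interpret W: bounded_linear "weighted_sum (mass_wgt p)" by (rule bounded_linear_weighted_sum[of "mass_wgt p", OF \<theta>])
  obtain c where c: "0 < c" "\<And>t. t \<in> {0..\<tau>} \<Longrightarrow> coagulation_kernel p c (\<lambda>n j. k n j t)"
    using kernel_on[OF \<tau>] by blast
  have "?N (w t) \<le> ?N (w 0)"
  proof (rule Dini_nonincreasing[of 0 t "\<lambda>t. ?N (w t)"])
    show "continuous_on {0..t} (\<lambda>t. ?N (w t))"
      using t by (intro continuous_on_pos_part_norm \<theta> mild_on_continuous[OF w]) auto
    show "0 \<le> t" using t by simp
    fix s \<epsilon> :: real assume s: "0 \<le> s" "s < t" and \<epsilon>: "0 < \<epsilon>"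
    have s\<tau>: "s \<in> {0..\<tau>}" using s t by simp
    interpret coagulation_kernel p c "\<lambda>n j. k n j s" using c(2) s t by simp
    have "\<forall>\<^sub>F h in at_right 0. ?N (w (s + h)) \<le> ?N (w s + h *\<^sub>R K s (w s)) + h * \<epsilon>"
      using s t by (intro mild_on_step[OF w \<tau> pos_part_norm_add_le mass_U_le _ _ \<epsilon>] \<theta>) auto
    moreover have "\<forall>\<^sub>F h in at_right 0. 0 < h \<and> h * (c * norm (w s)) \<le> 1"
      using c by (intro eventually_small_step) auto
    ultimately show "\<forall>\<^sub>F h in at_right 0. ?N (w (s + h)) \<le> ?N (w s) + h * \<epsilon>"
    proof eventually_elim
      case (elim h)
      have "?N (w s + h *\<^sub>R K s (w s)) = weighted_sum (mass_wgt p) (w s + h *\<^sub>R K s (w s))"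
        unfolding K_def using elim pos[OF s\<tau>]
        by (intro pos_part_norm_eq_weighted_sum add_coag_nonneg) auto
      also have "\<dots> = ?N (w s)"
        using pos[OF s\<tau>] by (simp add: W.add W.scaleR K_def mass_coag[OF p_gt] pos_part_norm_eq_weighted_sum)
      finally show ?case using elim by simp
    qed
  qed
  then show ?thesis
    using pos[OF t] x0 by (simp add: mild_on_0[OF \<tau>(1) w] pos_part_norm_eq_weighted_sum)
qed

lemma mild_on_norm_le:
  assumes w: "mild_on x0 \<tau> w" and \<tau>: "0 \<le> \<tau>" "ereal \<tau> < T" and x0: "\<And>n. 0 \<le> coord x0 n"
    and m: "0 \<le> m" "\<And>n j t. 1 \<le> n \<Longrightarrow> 1 \<le> j \<Longrightarrow> t \<in> {0..\<tau>} \<Longrightarrow> k n j t \<le> m * real (n + j)"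
    and t: "t \<in> {0..\<tau>}"
  shows "norm (w t) \<le> norm x0 * exp (c_p p * m * weighted_sum (mass_wgt p) x0 * t)"
proof -
  note pos = mild_on_nonneg[OF w \<tau> x0]
  let ?C = "c_p p * m * weighted_sum (mass_wgt p) x0"
  interpret W: bounded_linear "weighted_sum (\<lambda>_. 1)" by (rule bounded_linear_weighted_sum) auto
  obtain c where c: "0 < c" "\<And>t. t \<in> {0..\<tau>} \<Longrightarrow> coagulation_kernel p c (\<lambda>n j. k n j t)"
    using kernel_on[OF \<tau>] by blast
  have cp: "0 \<le> c_p p" using p_gt by (rule c_p_nonneg)
  have "norm (w t) \<le> norm (w 0) * exp (?C * (t - 0))"
  proof (rule Dini_Gronwall[of 0 t "\<lambda>t. norm (w t)"])
    show "continuous_on {0..t} (\<lambda>t. norm (w t))"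
      using t by (intro continuous_on_norm mild_on_continuous[OF w]) auto
    show "0 \<le> ?C"
      using cp m x0 mass_wgt_bounds(1)[of p] pos_part_norm_nonneg[of "mass_wgt p" x0] mass_wgt_bounds(2)[OF p_gt]
      by (simp add: pos_part_norm_eq_weighted_sum)
    show "0 \<le> t" using t by simp
    fix s \<epsilon> :: real assume s: "0 \<le> s" "s < t" and \<epsilon>: "0 < \<epsilon>"
    have s\<tau>: "s \<in> {0..\<tau>}" using s t by simp
    interpret coagulation_kernel p c "\<lambda>n j. k n j s" using c(2) s t by simp
    have Lip: "norm (x + y) \<le> norm x + 1 * norm y" for x y :: l1 by (simp add: norm_triangle_ineq)
    have "\<forall>\<^sub>F h in at_right 0. norm (w (s + h)) \<le> norm (w s + h *\<^sub>R K s (w s)) + h * \<epsilon>"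
      using s t by (intro mild_on_step[OF w \<tau> Lip contraction _ _ \<epsilon>]) auto
    moreover have "\<forall>\<^sub>F h in at_right 0. 0 < h \<and> h * (c * norm (w s)) \<le> 1"
      using c by (intro eventually_small_step) auto
    ultimately show "\<forall>\<^sub>F h in at_right 0. norm (w (s + h)) \<le> norm (w s) + h * (?C * norm (w s) + \<epsilon>)"
    proof eventually_elim
      case (elim h)
      have "norm (w s + h *\<^sub>R K s (w s)) = weighted_sum (\<lambda>_. 1) (w s + h *\<^sub>R K s (w s))"
        unfolding K_def using elim pos[OF s\<tau>]
        by (intro weighted_sum_one[symmetric] add_coag_nonneg) auto
      also have "\<dots> = norm (w s) + h * weighted_sum (\<lambda>_. 1) (K s (w s))"
        using pos[OF s\<tau>] by (simp add: W.add W.scaleR weighted_sum_one)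
      also have "\<dots> \<le> norm (w s) + h * (c_p p * m * weighted_sum (mass_wgt p) (w s) * norm (w s))"
        unfolding K_def using elim m s\<tau> pos[OF s\<tau>] p_gt
        by (intro add_left_mono mult_left_mono weight_coag_le) auto
      \<comment> \<open>Bounding the current first moment by the initial one makes the rate constant
        in time, so that the linear Gronwall inequality applies.\<close>
      also have "\<dots> \<le> norm (w s) + h * (?C * norm (w s))"
        using elim cp m mild_on_mass_le[OF w \<tau> x0 s\<tau>]
        by (intro add_left_mono mult_left_mono mult_right_mono) auto
      finally show ?case using elim by (simp add: distrib_left)
    qed
  qed auto
  then show ?thesis by (simp add: mild_on_0[OF \<tau>(1) w])
qed

lemma mild_on_unique:
  assumes v: "mild_on x0 \<tau> v" and w: "mild_on x0 \<tau> w" and \<tau>: "0 \<le> \<tau>" "ereal \<tau> < T" and t: "t \<in> {0..\<tau>}"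
  shows "v t = w t"
proof -
  obtain M where M: "0 \<le> M" "\<And>t. t \<in> {0..\<tau>} \<Longrightarrow> norm (v t) \<le> M" using mild_on_bounded[OF v] by blast
  obtain M' where M': "0 \<le> M'" "\<And>t. t \<in> {0..\<tau>} \<Longrightarrow> norm (w t) \<le> M'" using mild_on_bounded[OF w] by blast
  obtain c where c: "0 < c" "\<And>t. t \<in> {0..\<tau>} \<Longrightarrow> coagulation_kernel p c (\<lambda>n j. k n j t)"
    using kernel_on[OF \<tau>] by blast
  let ?L = "3/2 * c * (M + M')"
  let ?g = "\<lambda>s. K s (v s) - K s (w s)"
  have cv: "continuous_on {0..\<tau>} v" and cw: "continuous_on {0..\<tau>} w" using v w by (auto simp: mild_on_def)
  have ckv: "continuous_on {0..\<tau>} (\<lambda>s. K s (v s))" and ckw: "continuous_on {0..\<tau>} (\<lambda>s. K s (w s))"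
    by (rule K_continuous[OF \<tau> order_refl cv], rule K_continuous[OF \<tau> order_refl cw])
  have g: "continuous_on {0..\<tau>} ?g" using ckv ckw by (rule continuous_on_diff)
  \<comment> \<open>The difference is itself of Duhamel form with initial value 0 and forcing
    \<open>?g\<close>; the vanishing term \<open>U t 0\<close> is kept because
    \<open>mild_functional_step\<close> asks for that shape.\<close>
  have D: "v t - w t = U t 0 + conv ?g 0 t" if t: "t \<in> {0..\<tau>}" for t
  proof -
    have "{0..t} \<subseteq> {0..\<tau>}" using t by auto
    from conv_diff[OF continuous_on_subset[OF ckv this] continuous_on_subset[OF ckw this]]
    show ?thesis using v w t linear_0[OF bounded_linear.linear[OF linear[of t]]] by (simp add: mild_on_def)
  qed
  have "norm (v t - w t) \<le> norm (v 0 - w 0) * exp (?L * (t - 0))"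
  proof (rule Dini_Gronwall[of 0 t "\<lambda>t. norm (v t - w t)"])
    show "continuous_on {0..t} (\<lambda>t. norm (v t - w t))"
      by (rule continuous_on_subset[OF continuous_on_norm[OF continuous_on_diff[OF cv cw]]]) (use t in auto)
    show "0 \<le> ?L" using c M M' by simp
    show "0 \<le> t" using t by simp
    fix s \<epsilon> :: real assume s: "0 \<le> s" "s < t" and \<epsilon>: "0 < \<epsilon>"
    have s\<tau>: "s \<in> {0..\<tau>}" using s t by simp
    interpret coagulation_kernel p c "\<lambda>n j. k n j s" using c(2) s t by simp
    have Lip: "norm (x + y) \<le> norm x + 1 * norm y" for x y :: l1 by (simp add: norm_triangle_ineq)
    have "\<forall>\<^sub>F h in at_right 0. norm (v (s + h) - w (s + h)) \<le> norm (v s - w s + h *\<^sub>R ?g s) + h * \<epsilon>"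
      using s t by (intro mild_functional_step[OF g D Lip zero_le_one contraction _ _ \<epsilon>]) auto
    moreover have "\<forall>\<^sub>F h in at_right 0. (0::real) < h" by (simp add: eventually_at_right_less)
    ultimately show "\<forall>\<^sub>F h in at_right 0. norm (v (s + h) - w (s + h)) \<le> norm (v s - w s) + h * (?L * norm (v s - w s) + \<epsilon>)"
    proof eventually_elim
      case (elim h)
      have "norm (v s - w s + h *\<^sub>R ?g s) \<le> norm (v s - w s) + h * norm (?g s)"
        using norm_triangle_ineq[of "v s - w s" "h *\<^sub>R ?g s"] elim by simp
      also have "\<dots> \<le> norm (v s - w s) + h * (3/2 * c * (norm (v s) + norm (w s)) * norm (v s - w s))"
        unfolding K_def using elim by (intro add_left_mono mult_left_mono norm_coag_diff_le) auto
      also have "\<dots> \<le> norm (v s - w s) + h * (?L * norm (v s - w s))"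
        using elim c M(2)[OF s\<tau>] M'(2)[OF s\<tau>]
        by (intro add_left_mono mult_left_mono mult_right_mono add_mono) auto
      finally show ?case using elim by (simp add: distrib_left)
    qed
  qed auto
  then show ?thesis by (simp add: mild_on_0[OF \<tau>(1) v] mild_on_0[OF \<tau>(1) w])
qed

text \<open>w need not solve the equation at t1 itself, so the solution is restarted slightly before
  t1. The guaranteed length of existence does not depend on the restart time, hence it exceeds the
  remaining time once the restart is late enough.\<close>

lemma mild_on_extend:
  assumes w: "\<And>\<tau>. 0 \<le> \<tau> \<Longrightarrow> \<tau> < t1 \<Longrightarrow> mild_on x0 \<tau> w" and t1: "0 < t1" "ereal t1 < T"
    and M: "\<And>t. 0 \<le> t \<Longrightarrow> t < t1 \<Longrightarrow> norm (w t) \<le> M"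
  obtains \<tau> v where "t1 < \<tau>" "ereal \<tau> < T" "mild_on x0 \<tau> v" "\<And>t. 0 \<le> t \<Longrightarrow> t < t1 \<Longrightarrow> v t = w t"
proof -
  obtain t' where t': "t1 < t'" "ereal t' < T" using ereal_dense2[OF t1(2)] by auto
  have t'0: "0 \<le> t'" using t' t1 by simp
  obtain c where c: "0 < c" "\<And>t. t \<in> {0..t'} \<Longrightarrow> coagulation_kernel p c (\<lambda>n j. k n j t)"
    using kernel_on[OF t'0 t'(2)] by blast
  have M0: "0 \<le> M" using order_trans[OF norm_ge_zero M[of 0]] t1 by simp
  \<comment> \<open>The extra 1 is room for the Duhamel term; B bounds \<open>K\<close> and L is its
    Lipschitz constant on the ball of radius R.\<close>
  define R where "R = M + 1"
  define B where "B = 3/2 * c * (R * R)"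
  define L where "L = 3/2 * c * (R + R)"
  have R: "0 < R" using M0 by (simp add: R_def)
  have BL: "0 \<le> B" "0 \<le> L" using c R by (auto simp: B_def L_def)
  define d where "d = min (t' - t1) (min (1 / (B + 1)) (1 / (2 * (L + 1))))"
  have d: "0 < d" "d \<le> t' - t1" using t' BL by (auto simp: d_def)
  have dB: "B * d \<le> 1"
  proof -
    have "B * d \<le> B * (1 / (B + 1))" using BL by (intro mult_left_mono) (auto simp: d_def)
    also have "\<dots> \<le> 1" using BL by (simp add: field_simps)
    finally show ?thesis .
  qed
  have dL: "L * d \<le> 1/2"
  proof -
    have "L * d \<le> L * (1 / (2 * (L + 1)))" using BL by (intro mult_left_mono) (auto simp: d_def)
    also have "\<dots> \<le> 1/2" using BL by (simp add: field_simps)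
    finally show ?thesis .
  qed
  \<comment> \<open>The restart is half a step before t1, or at 0 if t1 is too small, so that r + d
    lies beyond t1 and still within t'.\<close>
  define r where "r = max 0 (t1 - d/2)"
  define \<tau> where "\<tau> = r + d"
  have r: "0 \<le> r" "r < t1" "r \<le> \<tau>" "t1 < \<tau>" "\<tau> \<le> t'" "\<tau> - r = d"
    using d t1 t' by (auto simp: r_def \<tau>_def max_def)
  have \<tau>T: "ereal \<tau> < T" using r(5) t'(2) by (meson ereal_less_eq(3) le_less_trans)
  obtain v1 where v1: "continuous_on {r..\<tau>} v1"
    "\<And>t. t \<in> {r..\<tau>} \<Longrightarrow> v1 t = U (t - r) (w r) + conv (\<lambda>s. K s (v1 s)) r t"
  proof (rule local_mild_solution[of r \<tau> K R L B "w r"])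
    show "continuous_on {r..\<tau>} v \<Longrightarrow> continuous_on {r..\<tau>} (\<lambda>s. K s (v s))" for v
      using r by (intro K_continuous[OF t'0 t'(2)]) auto
    show "norm (w r) + B * (\<tau> - r) \<le> R" using M[of r] r dB by (simp add: R_def)
    show "L * (\<tau> - r) \<le> 1/2" using dL r by simp
    fix t and x :: l1 assume t: "t \<in> {r..\<tau>}" and x: "norm x \<le> R"
    interpret coagulation_kernel p c "\<lambda>n j. k n j t" using c(2) t r by simp
    have "norm x * norm x \<le> R * R" using x R by (intro mult_mono) auto
    then have "3/2 * c * (norm x * norm x) \<le> B" unfolding B_def using c by (intro mult_left_mono) auto
    then show "norm (K t x) \<le> B" unfolding K_def using norm_coag_le[of x x] by linarith
    fix y :: l1 assume y: "norm y \<le> R"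
    have "3/2 * c * (norm x + norm y) * norm (x - y) \<le> L * norm (x - y)"
      unfolding L_def using x y c by (intro mult_right_mono mult_left_mono add_mono) auto
    then show "norm (K t x - K t y) \<le> L * norm (x - y)"
      unfolding K_def using norm_coag_diff_le[of x y] by linarith
  qed (use r BL in auto)
  define v where "v t = (if t \<le> r then w t else v1 t)" for t
  have wr: "mild_on x0 r w" using w r by simp
  have v1r: "v1 r = w r" using v1(2)[of r] r by (simp add: conv_def zero_time)
  have vw: "v t = w t" if "t \<le> r" for t using that by (simp add: v_def)
  have vv1: "v t = v1 t" if "r \<le> t" for t using that v1r by (auto simp: v_def)
  have cv: "continuous_on {0..\<tau>} v"
  proof -
    have "continuous_on {0..r} v"
      by (rule continuous_on_eq[OF mild_on_continuous[OF wr order_refl]]) (simp add: vw)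
    moreover have "continuous_on {r..\<tau>} v"
      by (rule continuous_on_eq[OF v1(1)]) (simp add: vv1)
    ultimately have "continuous_on ({0..r} \<union> {r..\<tau>}) v"
      by (intro continuous_on_closed_Un) auto
    moreover have "{0..r} \<union> {r..\<tau>} = {0..\<tau>}" using r by auto
    ultimately show ?thesis by simp
  qed
  have gv: "continuous_on {0..\<tau>} (\<lambda>s. K s (v s))" using r by (intro K_continuous[OF t'0 t'(2) _ cv]) auto
  have "v t = U t x0 + conv (\<lambda>s. K s (v s)) 0 t" if t: "t \<in> {0..\<tau>}" for t
  proof (cases "t \<le> r")
    case True
    have "conv (\<lambda>s. K s (v s)) 0 t = conv (\<lambda>s. K s (w s)) 0 t"
      unfolding conv_def using True by (intro integral_cong) (auto simp: vw)
    then show ?thesis using wr t True by (simp add: mild_on_def vw)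
  next
    case False
    interpret Ut: bounded_linear "U (t - r)" using linear False by simp
    have e1: "conv (\<lambda>s. K s (v s)) r t = conv (\<lambda>s. K s (v1 s)) r t"
      unfolding conv_def by (intro integral_cong) (auto simp: vv1)
    have e2: "conv (\<lambda>s. K s (v s)) 0 r = conv (\<lambda>s. K s (w s)) 0 r"
      unfolding conv_def by (intro integral_cong) (auto simp: vw)
    have "v t = U (t - r) (w r) + conv (\<lambda>s. K s (v s)) r t" using v1(2)[of t] vv1[of t] e1 t False by simp
    also have "w r = U r x0 + conv (\<lambda>s. K s (v s)) 0 r" using wr r(1) e2 by (simp add: mild_on_def)
    also have "U (t - r) (U r x0 + conv (\<lambda>s. K s (v s)) 0 r) = U t x0 + U (t - r) (conv (\<lambda>s. K s (v s)) 0 r)"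
      using add_time[of "t - r" r x0] False r(1) by (simp add: Ut.add)
    also have "\<dots> + conv (\<lambda>s. K s (v s)) r t = U t x0 + conv (\<lambda>s. K s (v s)) 0 t"
      using conv_split[OF continuous_on_subset[OF gv], of 0 t r] False t r(1) by simp
    finally show ?thesis .
  qed
  with cv have mv: "mild_on x0 \<tau> v" by (simp add: mild_on_def)
  \<comment> \<open>By construction v is w only up to r; between r and t1 it comes from the fixed
    point, and agreement with w there is uniqueness.\<close>
  have "v t = w t" if t: "0 \<le> t" "t < t1" for t
  proof (rule mild_on_unique[of x0 t v w t])
    show "mild_on x0 t v" using mv by (rule mild_on_subset) (use t r in simp)
    show "ereal t < T" using t t1(2) by (meson ereal_less_eq(3) le_less_trans less_imp_le)
  qed (use w t in auto)
  with that r(4) \<tau>T mv show ?thesis by blast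
qed

end

theorem theorem4p16:
  fixes T :: ereal and p \<kappa> :: real
    and a :: "nat \<Rightarrow> real" and b :: "nat \<Rightarrow> nat \<Rightarrow> real"
    and k :: "nat \<Rightarrow> nat \<Rightarrow> real \<Rightarrow> real"
    and S :: "real \<Rightarrow> (nat \<Rightarrow> real) \<Rightarrow> nat \<Rightarrow> real"
    and \<mu> :: "real \<Rightarrow> real"
    and u0 :: "nat \<Rightarrow> real" and u :: "real \<Rightarrow> nat \<Rightarrow> real" and tmax :: ereal
  assumes T_pos: "0 < T"
    and p_gt: "p > 1"
    and a_nonneg: "\<forall>n\<ge>1. a n \<ge> 0"
    and b_nonneg: "\<forall>n\<ge>1. \<forall>j\<ge>1. b n j \<ge> 0"
    and b_zero: "\<forall>n\<ge>1. \<forall>j\<ge>1. j \<le> n \<longrightarrow> b n j = 0"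
    and k_nonneg: "\<forall>n\<ge>1. \<forall>j\<ge>1. \<forall>t\<in>tset T. k n j t \<ge> 0"
    and k_cont: "\<forall>n\<ge>1. \<forall>j\<ge>1. continuous_on (tset T) (k n j)"
    and k_sym: "\<forall>n\<ge>1. \<forall>j\<ge>1. \<forall>t\<in>tset T. k n j t = k j n t"
    and kappa: "0 < \<kappa>" "\<kappa> \<le> 1"
    and kappa_bound: "\<forall>j\<ge>2. (\<Sum>n=1..j-1. wgt p n * b n j) \<le> \<kappa> * wgt p j"
    and CI: "\<forall>t'. 0 < t' \<and> ereal t' < T \<longrightarrow>
               (\<exists>c>0. \<forall>n\<ge>1. \<forall>j\<ge>1. \<forall>t\<in>{0..t'}.
                   k n j t \<le> c * wgt p n * wgt p j / wgt p (n + j))"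
    and S_gen: "generated_by_Gw p a b S"
    and mass: "\<forall>j\<ge>2. (\<Sum>n=1..j-1. real n * b n j) \<le> real j"
    and mu_pos: "\<forall>t. 0 < t \<and> ereal t < T \<longrightarrow> \<mu> t > 0"
    and mu_mono: "mono_on {t. 0 < t \<and> ereal t < T} \<mu>"
    and mu_bound: "\<forall>t'. 0 < t' \<and> ereal t' < T \<longrightarrow>
               (\<forall>n\<ge>1. \<forall>j\<ge>1. \<forall>t\<in>{0..t'}. k n j t \<le> \<mu> t' * real (n + j))"
    and u0_l1w: "u0 \<in> l1w p"
    and u0_nonneg: "\<forall>n. u0 n \<ge> 0"
    and u_max: "maximal_mild_solution p S k u0 T tmax u"
  shows "tmax = T \<and>
    (\<forall>t\<in>tset T. wnorm p (u t) \<le> wnorm p u0 * exp (c_p p * \<mu> t * phi1 u0 * t))"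
proof -
  have b_wgt: "(\<Sum>n=1..j-1. wgt p n * b n j) \<le> wgt p j" if "2 \<le> j" for j
  proof -
    have "(\<Sum>n=1..j-1. wgt p n * b n j) \<le> \<kappa> * wgt p j" using kappa_bound that by blast
    also have "\<dots> \<le> 1 * wgt p j" using kappa by (intro mult_right_mono) auto
    finally show ?thesis by simp
  qed
  interpret coagulation_fragmentation p a b S T k
    by unfold_locales (use assms b_wgt in auto)
  let ?x0 = "to_l1 p u0" and ?w = "\<lambda>t. to_l1 p (u t)"
  have tm: "0 < tmax" "tmax \<le> T" "mild_solution p S k u0 tmax u"
    and maxi: "\<And>t2 v. tmax < t2 \<Longrightarrow> t2 \<le> T \<Longrightarrow> mild_solution p S k u0 t2 v \<Longrightarrow> (\<forall>t\<in>tset tmax. v t = u t) \<Longrightarrow> False"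
    using u_max unfolding maximal_mild_solution_def by blast+
  have mild: "mild_on ?x0 \<tau> ?w" if "0 \<le> \<tau>" "ereal \<tau> < tmax" for \<tau>
    by (rule mild_solution_imp_mild_on[OF tm(3) u0_l1w tm(2) that])
  have x0: "0 \<le> coord ?x0 n" for n using u0_nonneg u0_l1w by (simp add: coord_to_l1)
  have phi: "weighted_sum (mass_wgt p) ?x0 = phi1 u0"
    unfolding weighted_sum_def phi1_def
    by (intro suminf_cong) (simp add: coord_to_l1 u0_l1w mass_wgt_mult_wgt flip: mult.assoc)
  \<comment> \<open>\<mu> is frozen at a time t' \<ge> t. The choice t' = t is the claimed estimate,
    and a fixed t' bounds the solution uniformly up to a finite \<open>tmax\<close>.\<close>
  have bound: "norm (?w t) \<le> norm ?x0 * exp (c_p p * \<mu> t' * phi1 u0 * t)"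
    if t: "0 \<le> t" "ereal t < tmax" "t \<le> t'" "0 < t'" "ereal t' < T" for t t'
  proof -
    have tT: "ereal t < T" using t(2) tm(2) by (rule less_le_trans)
    show ?thesis
      unfolding phi[symmetric]
    proof (rule mild_on_norm_le[OF mild[OF t(1,2)] t(1) tT x0])
      show "0 \<le> \<mu> t'" using mu_pos t by (simp add: less_imp_le)
    qed (use mu_bound t in auto)
  qed
  have "tmax = T"
  proof (rule ccontr)
    assume "tmax \<noteq> T"
    then have lt: "tmax < T" using tm(2) by simp
    then obtain t1 where t1: "tmax = ereal t1" using tm(1) by (cases tmax) auto
    have t1': "0 < t1" "ereal t1 < T" using tm(1) lt t1 by auto
    \<comment> \<open>The modulus dominates the exponent at every t < t1 without any discussion of
      signs.\<close>
    define M where "M = norm ?x0 * exp (\<bar>c_p p * \<mu> t1 * phi1 u0\<bar> * t1)"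
    have M: "norm (?w t) \<le> M" if t: "0 \<le> t" "t < t1" for t
    proof -
      have "norm (?w t) \<le> norm ?x0 * exp (c_p p * \<mu> t1 * phi1 u0 * t)"
        using bound[of t t1] t t1' by (simp add: t1)
      also have "c_p p * \<mu> t1 * phi1 u0 * t \<le> \<bar>c_p p * \<mu> t1 * phi1 u0\<bar> * t1"
        using t by (intro mult_mono) auto
      then have "norm ?x0 * exp (c_p p * \<mu> t1 * phi1 u0 * t) \<le> M"
        unfolding M_def by (intro mult_left_mono) auto
      finally show ?thesis .
    qed
    obtain \<tau> v where v: "t1 < \<tau>" "ereal \<tau> < T" "mild_on ?x0 \<tau> v" "\<And>t. 0 \<le> t \<Longrightarrow> t < t1 \<Longrightarrow> v t = ?w t"
      using mild_on_extend[of t1 ?x0 ?w M] mild t1' M t1 by auto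
    have "mild_solution p S k u0 (ereal \<tau>) (\<lambda>t. of_l1 p (v t))"
      using mild_on_imp_mild_solution[OF v(3,2)] u0_l1w by simp
    moreover have "of_l1 p (v t) = u t" if "t \<in> tset tmax" for t
      using that v(4)[of t] tm(3) by (auto simp: t1 tset_def mild_solution_def)
    ultimately show False using maxi[of "ereal \<tau>" "\<lambda>t. of_l1 p (v t)"] v(1,2) t1 by (simp add: less_imp_le)
  qed
  moreover have "wnorm p (u t) \<le> wnorm p u0 * exp (c_p p * \<mu> t * phi1 u0 * t)" if t: "t \<in> tset T" for t
  proof -
    have tt: "0 \<le> t" "ereal t < tmax" using t \<open>tmax = T\<close> by (auto simp: tset_def)
    have ut: "u t \<in> l1w p" using tm(3) tt by (simp add: mild_solution_def tset_def)
    show ?thesis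
    \<comment> \<open>\<mu> is controlled on (0, T) only, so t = 0 is done apart; the exponent
      vanishes there and the solution equals its initial value.\<close>
    proof (cases "t = 0")
      case True
      then show ?thesis
        using mild_on_0[OF order_refl mild[of 0]] tt ut u0_l1w by (simp add: wnorm_eq_norm)
    next
      case False
      then show ?thesis using bound[of t t] tt \<open>tmax = T\<close> ut u0_l1w by (simp add: wnorm_eq_norm)
    qed
  qed
  ultimately show ?thesis by blast
qed

end
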